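(* Let $k,m\ge 2$ be integers. The monoid $\mathcal{POI}_{k\times m}$ is defined by the monoid presentation $\langle D\cup X\mid V\cup W\cup V'\rangle$ on $2k$ generators and $\frac12\left(9k^2+(2m+5)k-4\right)$ relations, where $D=\{d_1,\dots,d_k\}$, $X=\{x_0,\dots,x_{k-1}\}$ and $V$, $W$, $V'$ are the sets of relations listed in the context; that is, $\mathcal{POI}_{k\times m}\cong (D\cup X)^*/\rho$, where $\rho$ is the smallest congruence on the free monoid $(D\cup X)^*$ containing $V\cup W\cup V'$.
   Context: Maps are written on the right and composed from left to right. Let $n=km$, $\Omega_n=\{1,\dots,n\}$ and $I_i=\{(i-1)m+1,\dots,im\}$ for $1\le i\le k$. For $x\in\Omega_n$ let $i_x$ denote the index with $x\in I_{i_x}$. $\mathcal{POI}_{k\times m}$ is the monoid, under composition, of all injective partial maps $\alpha$ from $\Omega_n$ to $\Omega_n$ (the empty map included) such that: (stability) for all $x\in\mathrm{Dom}(\alpha)$, $I_{i_x}\subseteq\mathrm{Dom}(\alpha)$ and $I_{i_x}\alpha=I_{i_{x\alpha}}$; (order preservation) for all $x,y\in\mathrm{Dom}(\alpha)$, $i_x\le i_y$ implies $i_{x\alpha}\le i_{y\alpha}$. In the lists, a chain $u=v=w$ stands for the two relations $u=v$ and $v=w$. $V$ consists of: ($V_1$) $(d_k^md_1^{m-1})^2=1$; $(d_i^md_{i+1}^{m-1})^2=1$, $1\le i\le k-1$; ($V_2$) $d_i^{m(m-1)}=1$, $1\le i\le k$; ($V_3$) $(d_1^{(m-1)^2}d_k^md_1^{m-1})^{m-1}=1$;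 $(d_{i+1}^{(m-1)^2}d_i^md_{i+1}^{m-1})^{m-1}=1$, $1\le i\le k-1$; ($V_4$) $(d_k^md_1^{(m-1)^2(m-2)}d_k^m)^3=1$; $(d_i^md_{i+1}^{(m-1)^2(m-2)}d_i^m)^3=1$, $1\le i\le k-1$; ($V_5$) $(d_k^md_1^{(m-1)^2(m-j-1)}d_k^md_1^{(m-1)^2(j-1)})^2=1$, $2\le j\le m-2$; $(d_i^md_{i+1}^{(m-1)^2(m-j-1)}d_i^md_{i+1}^{(m-1)^2(j-1)})^2=1$, $2\le j\le m-2$, $1\le i\le k-1$; ($V_6$) $d_i^md_j^m=d_j^md_i^m$ and $d_i^{(m-1)^2}d_j^{(m-1)^2}=d_j^{(m-1)^2}d_i^{(m-1)^2}$, $1\le i<j\le k$; $d_i^{(m-1)^2}d_k^m=d_k^md_i^{(m-1)^2}$, $2\le i\le k-1$; $d_i^{(m-1)^2}d_j^m=d_j^md_i^{(m-1)^2}$, $1\le i\le k$, $1\le j\le k-1$, $i\notin\{j,j+1\}$. $W$ consists of: $x_ix_0=x_0x_{i+1}$, $1\le i\le k-2$; $x_jx_i=x_ix_j$, $2\le i+1<j\le k-1$; $x_0^2x_1=x_0^2=x_{k-1}x_0^2$; $x_{i+1}x_ix_{i+1}=x_{i+1}x_i=x_ix_{i+1}x_i$, $1\le i\le k-2$; $x_ix_{i+1}\cdots x_{k-1}x_0x_1\cdots x_{i-1}x_i=x_i$, $0\le i\le k-1$; $x_{i+1}\cdots x_{k-1}x_0x_1\cdots x_{i-1}x_i^2=x_i^2$,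 $1\le i\le k-1$. $V'$ consists of: ($V'_1$) $d_k^md_1^{m-1}x_0=x_0$, $d_1^{(m-1)^2}x_0=x_0$; ($V'_2$) $x_0d_k^md_1^{m-1}=d_1^md_2^{m-1}x_0$; $x_0d_i^md_{i+1}^{m-1}=d_{i+1}^md_{i+2}^{m-1}x_0$, $1\le i\le k-2$; $x_0d_i^{(m-1)^2}=d_{i+1}^{(m-1)^2}x_0$, $1\le i\le k-1$; ($V'_3$) $x_id_{k-i-1}^md_{k-i}^{m-1}=x_i$, $0\le i\le k-2$; $x_{k-1}d_k^md_1^{m-1}=x_{k-1}$; $x_id_{k-i}^{(m-1)^2}=x_i$, $0\le i\le k-1$; ($V'_4$) $d_i^md_{i+1}^{m-1}x_{k-i}=x_{k-i}$, $d_{i+1}^{(m-1)^2}x_{k-i}=x_{k-i}$, $1\le i\le k-1$; ($V'_5$) $x_id_{k-i}^md_{k-i+1}^{m-1}=d_{k-i-1}^md_{k-i}^{m-1}x_i$, $1\le i\le k-2$; $x_{k-1}d_1^md_2^{m-1}=d_k^md_1^{m-1}x_{k-1}$; $x_id_{k-i+1}^{(m-1)^2}=d_{k-i}^{(m-1)^2}x_i$, $1\le i\le k-1$; ($V'_6$) $x_id_k^md_1^{m-1}=d_k^md_1^{m-1}x_i$, $1\le i\le k-2$; $x_id_j^md_{j+1}^{m-1}=d_j^md_{j+1}^{m-1}x_i$, $1\le i,j\le k-1$, $j\notin\{k-i-1,k-i\}$; $x_id_j^{(m-1)^2}=d_j^{(m-1)^2}x_i$, $1\le i\le k-1$, $1\le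 j\le k$, $j\notin\{k-i,k-i+1\}$.
   Formalization: For m = 2 the stated number of relations is false (k = m = 2 gives 27 listed relations, not 25, as (V_5) is empty); the formula is proved for m ≥ 3, and for m = 2 the number proved is the formula plus k. *)

theory Defs
  imports Complex_Main "HOL-Algebra.Group"
begin

section \<open>Monoid presentations\<close>

definition free_monoid :: "'a set \<Rightarrow> 'a list monoid" where
  "free_monoid A = \<lparr>carrier = lists A, mult = (@), one = []\<rparr>"

definition congruence :: "('a, 'b) monoid_scheme \<Rightarrow> 'a rel \<Rightarrow> bool" where
  "congruence M r \<longleftrightarrow> equiv (carrier M) r \<and>
     (\<forall>a b c d. (a, b) \<in> r \<longrightarrow> (c, d) \<in> r \<longrightarrow> (a \<otimes>\<^bsub>M\<^esub> c, b \<otimes>\<^bsub>M\<^esub> d) \<in> r)"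

text \<open>The smallest congruence containing \<open>R\<close>; meaningful only for \<open>R \<subseteq> carrier M \<times> carrier M\<close>
  (see \<open>congruence_generated\<close> below), since otherwise the intersection is over the empty family.\<close>

definition generated_congruence :: "('a, 'b) monoid_scheme \<Rightarrow> 'a rel \<Rightarrow> 'a rel" where
  "generated_congruence M R = \<Inter> {r. congruence M r \<and> R \<subseteq> r}"

definition quotient_monoid :: "('a, 'b) monoid_scheme \<Rightarrow> 'a rel \<Rightarrow> 'a set monoid" where
  "quotient_monoid M r =
     \<lparr>carrier = carrier M // r,
      mult = (\<lambda>S T. \<Union>a\<in>S. \<Union>b\<in>T. r `` {a \<otimes>\<^bsub>M\<^esub> b}),
      one = r `` {\<one>\<^bsub>M\<^esub>}\<rparr>"

definition presented_monoid :: "'a set \<Rightarrow> 'a list rel \<Rightarrow> 'a list set monoid" where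
  "presented_monoid A R =
     quotient_monoid (free_monoid A) (generated_congruence (free_monoid A) R)"

lemma monoid_free_monoid: "monoid (free_monoid A)"
  by (rule monoidI) (auto simp: free_monoid_def)

lemma congruence_generated:
  assumes "monoid M" and R: "R \<subseteq> carrier M \<times> carrier M"
  shows "congruence M (generated_congruence M R)" and "R \<subseteq> generated_congruence M R"
proof -
  interpret monoid M by fact
  have top: "congruence M (carrier M \<times> carrier M)"
    by (auto simp: congruence_def equiv_def refl_on_def sym_def trans_def)
  let ?F = "{r. congruence M r \<and> R \<subseteq> r}"
  have "equiv (carrier M) (\<Inter> ?F)"
  proof (rule equivI)
    show "\<Inter> ?F \<subseteq> carrier M \<times> carrier M" using top R by blast
    show "refl_on (carrier M) (\<Inter> ?F)"
      by (auto simp: congruence_def equiv_def refl_on_def)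
    show "sym (\<Inter> ?F)"
      by (rule symI) (auto simp: congruence_def equiv_def dest: symD)
    show "trans (\<Inter> ?F)"
      by (rule transI) (auto simp: congruence_def equiv_def dest: transD)
  qed
  then show "congruence M (generated_congruence M R)"
    unfolding generated_congruence_def congruence_def by blast
  show "R \<subseteq> generated_congruence M R"
    by (auto simp: generated_congruence_def)
qed

lemma quotient_monoid_mult:
  assumes "monoid M" "congruence M r" "a \<in> carrier M" "b \<in> carrier M"
  shows "(r `` {a}) \<otimes>\<^bsub>quotient_monoid M r\<^esub> (r `` {b}) = r `` {a \<otimes>\<^bsub>M\<^esub> b}"
proof -
  have e: "equiv (carrier M) r" using assms by (simp add: congruence_def)
  have "r `` {c \<otimes>\<^bsub>M\<^esub> d} = r `` {a \<otimes>\<^bsub>M\<^esub> b}" if "(a, c) \<in> r" "(b, d) \<in> r" for c d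
    using that assms(2) equiv_class_eq[OF e] unfolding congruence_def by metis
  moreover have "(a, a) \<in> r" "(b, b) \<in> r"
    using e assms by (auto simp: equiv_def refl_on_def)
  ultimately have "(\<Union>c\<in>r `` {a}. \<Union>d\<in>r `` {b}. r `` {c \<otimes>\<^bsub>M\<^esub> d}) = r `` {a \<otimes>\<^bsub>M\<^esub> b}"
    by blast
  then show ?thesis
    by (simp add: quotient_monoid_def)
qed


section \<open>The monoid of partial maps\<close>

definition block :: "nat \<Rightarrow> nat \<Rightarrow> nat set" where
  "block m i = {(i - 1) * m + 1 .. i * m}"

definition block_index :: "nat \<Rightarrow> nat \<Rightarrow> nat \<Rightarrow> nat" where
  "block_index k m x = (THE i. i \<in> {1..k} \<and> x \<in> block m i)"

definition block_stable :: "nat \<Rightarrow> nat \<Rightarrow> (nat \<rightharpoonup> nat) \<Rightarrow> bool" where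
  "block_stable k m \<alpha> \<longleftrightarrow>
     (\<forall>x\<in>dom \<alpha>. block m (block_index k m x) \<subseteq> dom \<alpha> \<and>
        (\<lambda>y. the (\<alpha> y)) ` block m (block_index k m x) = block m (block_index k m (the (\<alpha> x))))"

definition block_order_preserving :: "nat \<Rightarrow> nat \<Rightarrow> (nat \<rightharpoonup> nat) \<Rightarrow> bool" where
  "block_order_preserving k m \<alpha> \<longleftrightarrow>
     (\<forall>x\<in>dom \<alpha>. \<forall>y\<in>dom \<alpha>. block_index k m x \<le> block_index k m y \<longrightarrow>
        block_index k m (the (\<alpha> x)) \<le> block_index k m (the (\<alpha> y)))"

text \<open>Maps are written on the right: the product of \<open>\<alpha>\<close> and \<open>\<beta>\<close> applies \<open>\<alpha>\<close> first.\<close>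

definition POI :: "nat \<Rightarrow> nat \<Rightarrow> (nat \<rightharpoonup> nat) monoid" where
  "POI k m =
     \<lparr>carrier = {\<alpha>. dom \<alpha> \<subseteq> {1..k*m} \<and> ran \<alpha> \<subseteq> {1..k*m} \<and> inj_on \<alpha> (dom \<alpha>) \<and>
                  block_stable k m \<alpha> \<and> block_order_preserving k m \<alpha>},
      mult = (\<lambda>\<alpha> \<beta>. \<beta> \<circ>\<^sub>m \<alpha>),
      one = Some |` {1..k*m}\<rparr>"

lemma block_iff: "x \<in> block m i \<longleftrightarrow> 0 < x \<and> 0 < m \<and> i = (x - 1) div m + 1"
proof (cases "0 < m \<and> 0 < x \<and> 0 < i")
  case True
  then obtain j y where i: "i = Suc j" and x: "x = Suc y"
    by (metis Suc_pred')
  have "j * m \<le> y \<and> y < Suc j * m \<longleftrightarrow> y div m = j"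
  proof
    assume "j * m \<le> y \<and> y < Suc j * m"
    then show "y div m = j" by (intro div_nat_eqI) (auto simp: mult.commute)
  next
    assume "y div m = j"
    then show "j * m \<le> y \<and> y < Suc j * m"
      using True dividend_less_div_times[of m y] div_times_less_eq_dividend[of y m]
      by (metis mult_Suc)
  qed
  moreover have "x \<in> block m i \<longleftrightarrow> j * m \<le> y \<and> y < Suc j * m"
    by (auto simp: block_def i x)
  ultimately show ?thesis using True by (auto simp: i x)
qed (auto simp: block_def)

lemma block_index_eq:
  assumes "x \<in> {1..k*m}"
  shows "block_index k m x = (x - 1) div m + 1"
    and "block_index k m x \<in> {1..k}" and "x \<in> block m (block_index k m x)"
proof -
  have m: "0 < m" "0 < x" using assms by (auto intro: gr0I)
  have "(x - 1) div m < k"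
    using assms m by (subst div_less_iff_less_mult) auto
  then show *: "block_index k m x = (x - 1) div m + 1"
    unfolding block_index_def using m by (intro the_equality) (auto simp: block_iff)
  show "block_index k m x \<in> {1..k}" "x \<in> block m (block_index k m x)"
    using \<open>(x - 1) div m < k\<close> m by (auto simp: * block_iff)
qed

lemma block_image:
  assumes \<alpha>: "\<alpha> \<in> carrier (POI k m)" and x: "x \<in> dom \<alpha>"
  shows "block m (block_index k m x) \<subseteq> dom \<alpha>"
    and "(\<lambda>y. the (\<alpha> y)) ` block m (block_index k m x) = block m (block_index k m (the (\<alpha> x)))"
  using assms by (auto simp: POI_def block_stable_def)

lemma monoid_POI: "monoid (POI k m)"
proof (rule monoidI)
  fix \<alpha> \<beta> assume \<alpha>: "\<alpha> \<in> carrier (POI k m)" and \<beta>: "\<beta> \<in> carrier (POI k m)"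
  have dom: "x \<in> dom (\<beta> \<circ>\<^sub>m \<alpha>) \<longleftrightarrow> x \<in> dom \<alpha> \<and> the (\<alpha> x) \<in> dom \<beta>" for x
    by (auto simp: map_comp_def split: option.splits)
  have app: "the ((\<beta> \<circ>\<^sub>m \<alpha>) x) = the (\<beta> (the (\<alpha> x)))" if "x \<in> dom \<alpha>" for x
    using that by auto
  have "dom (\<beta> \<circ>\<^sub>m \<alpha>) \<subseteq> dom \<alpha>" "ran (\<beta> \<circ>\<^sub>m \<alpha>) \<subseteq> ran \<beta>"
    by (auto simp: ran_def map_comp_Some_iff)
  then have "dom (\<beta> \<circ>\<^sub>m \<alpha>) \<subseteq> {1..k*m}" "ran (\<beta> \<circ>\<^sub>m \<alpha>) \<subseteq> {1..k*m}"
    using \<alpha> \<beta> by (auto simp: POI_def)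
  moreover have "inj_on (\<beta> \<circ>\<^sub>m \<alpha>) (dom (\<beta> \<circ>\<^sub>m \<alpha>))"
  proof (rule inj_onI)
    fix x y assume x: "x \<in> dom (\<beta> \<circ>\<^sub>m \<alpha>)" and y: "y \<in> dom (\<beta> \<circ>\<^sub>m \<alpha>)"
      and eq: "(\<beta> \<circ>\<^sub>m \<alpha>) x = (\<beta> \<circ>\<^sub>m \<alpha>) y"
    have inj: "inj_on \<alpha> (dom \<alpha>)" "inj_on \<beta> (dom \<beta>)" using \<alpha> \<beta> by (auto simp: POI_def)
    obtain u where u: "\<alpha> x = Some u" "u \<in> dom \<beta>" using x dom[of x] by (metis domD option.sel)
    obtain v where v: "\<alpha> y = Some v" "v \<in> dom \<beta>" using y dom[of y] by (metis domD option.sel)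
    have "\<beta> u = \<beta> v" using eq u v by simp
    then have "u = v" using inj_onD[OF inj(2)] u v by blast
    then show "x = y" using inj_onD[OF inj(1)] u v by (metis domI)
  qed
  moreover have "block_stable k m (\<beta> \<circ>\<^sub>m \<alpha>)"
    unfolding block_stable_def
  proof (intro ballI)
    fix x assume x: "x \<in> dom (\<beta> \<circ>\<^sub>m \<alpha>)"
    let ?B = "block m (block_index k m x)"
    have x1: "x \<in> dom \<alpha>" and x2: "the (\<alpha> x) \<in> dom \<beta>" using x dom by auto
    note 1 = block_image[OF \<alpha> x1] and 2 = block_image[OF \<beta> x2]
    have sub: "?B \<subseteq> dom (\<beta> \<circ>\<^sub>m \<alpha>)" using 1 2 dom by blast
    have "(\<lambda>y. the ((\<beta> \<circ>\<^sub>m \<alpha>) y)) ` ?B = (\<lambda>y. the (\<beta> y)) ` (\<lambda>y. the (\<alpha> y)) ` ?B"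
      unfolding image_image using 1(1) app by (intro image_cong) auto
    then show "?B \<subseteq> dom (\<beta> \<circ>\<^sub>m \<alpha>) \<and> (\<lambda>y. the ((\<beta> \<circ>\<^sub>m \<alpha>) y)) ` ?B =
        block m (block_index k m (the ((\<beta> \<circ>\<^sub>m \<alpha>) x)))"
      using sub 1(2) 2(2) app[OF x1] by simp
  qed
  moreover have "block_order_preserving k m (\<beta> \<circ>\<^sub>m \<alpha>)"
    using \<alpha> \<beta> by (simp add: POI_def block_order_preserving_def dom app)
  ultimately show "\<alpha> \<otimes>\<^bsub>POI k m\<^esub> \<beta> \<in> carrier (POI k m)"
    by (simp add: POI_def)
next
  have *: "dom (Some |` {1..k*m}) = {1..k*m}" by (auto simp: restrict_map_def split: if_splits)
  have sub: "block m (block_index k m x) \<subseteq> {1..k*m}" if "x \<in> {1..k*m}" for x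
  proof -
    have "block_index k m x * m \<le> k * m" using block_index_eq(2)[OF that] by simp
    then show ?thesis unfolding block_def by (meson atLeastatMost_subset_iff le_add2)
  qed
  have "block_stable k m (Some |` {1..k*m})"
    unfolding block_stable_def *
  proof (intro ballI conjI sub)
    fix x assume x: "x \<in> {1..k*m}"
    have "(\<lambda>y. the ((Some |` {1..k*m}) y)) ` block m (block_index k m x)
        = id ` block m (block_index k m x)"
      using sub[OF x] by (intro image_cong) (auto simp: restrict_map_def)
    then show "(\<lambda>y. the ((Some |` {1..k*m}) y)) ` block m (block_index k m x) =
        block m (block_index k m (the ((Some |` {1..k*m}) x)))"
      using x by simp
  qed
  moreover have "ran (Some |` {1..k*m}) \<subseteq> {1..k*m}"
    by (auto simp: ran_def restrict_map_def split: if_splits)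
  moreover have "inj_on (Some |` {1..k*m}) {1..k*m}"
    by (rule inj_onI) simp
  moreover have "block_order_preserving k m (Some |` {1..k*m})"
    unfolding block_order_preserving_def * by simp
  ultimately show "\<one>\<^bsub>POI k m\<^esub> \<in> carrier (POI k m)"
    unfolding POI_def by (simp add: *)
next
  fix \<alpha> assume \<alpha>: "\<alpha> \<in> carrier (POI k m)"
  then have sub: "dom \<alpha> \<subseteq> {1..k*m}" "ran \<alpha> \<subseteq> {1..k*m}" by (auto simp: POI_def)
  have "(\<alpha> \<circ>\<^sub>m (Some |` {1..k*m})) x = \<alpha> x" for x
  proof (cases "x \<in> {1..k*m}")
    case False
    then have "\<alpha> x = None" using sub(1) by blast
    then show ?thesis using False by (simp add: map_comp_def restrict_map_def)
  qed (simp add: map_comp_def)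
  then show "\<one>\<^bsub>POI k m\<^esub> \<otimes>\<^bsub>POI k m\<^esub> \<alpha> = \<alpha>"
    by (simp add: POI_def fun_eq_iff)
  have "((Some |` {1..k*m}) \<circ>\<^sub>m \<alpha>) x = \<alpha> x" for x
  proof (cases "\<alpha> x")
    case (Some y)
    then have "y \<in> {1..k*m}" using sub(2) ranI by fast
    then show ?thesis using Some by simp
  qed simp
  then show "\<alpha> \<otimes>\<^bsub>POI k m\<^esub> \<one>\<^bsub>POI k m\<^esub> = \<alpha>"
    by (simp add: POI_def fun_eq_iff)
next
  fix \<alpha> \<beta> \<gamma>
  show "\<alpha> \<otimes>\<^bsub>POI k m\<^esub> \<beta> \<otimes>\<^bsub>POI k m\<^esub> \<gamma> = \<alpha> \<otimes>\<^bsub>POI k m\<^esub> (\<beta> \<otimes>\<^bsub>POI k m\<^esub> \<gamma>)"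
    by (simp add: POI_def map_comp_def fun_eq_iff split: option.split)
qed


section \<open>Generators and relations\<close>

datatype gen = Dgen nat | Xgen nat

definition gens :: "nat \<Rightarrow> gen set" where
  "gens k = Dgen ` {1..k} \<union> Xgen ` {0..k-1}"

abbreviation dp :: "nat \<Rightarrow> nat \<Rightarrow> gen list" where
  "dp i e \<equiv> replicate e (Dgen i)"

abbreviation xg :: "nat \<Rightarrow> gen list" where
  "xg i \<equiv> [Xgen i]"

definition word_power :: "'a list \<Rightarrow> nat \<Rightarrow> 'a list" (infixr \<open>^^^\<close> 80) where
  "w ^^^ n = concat (replicate n w)"

text \<open>\<open>dp i e\<close> is the word \<open>d\<^sub>i\<close> to the power \<open>e\<close>, and \<open>xg i\<close> the one-letter word \<open>x\<^sub>i\<close>.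
  A relation \<open>u = v\<close> is the pair \<open>(u, v)\<close>; the empty word \<open>[]\<close> is the identity.\<close>

definition relV1 :: "nat \<Rightarrow> nat \<Rightarrow> gen list rel" where
  "relV1 k m =
     {((dp k m @ dp 1 (m-1)) ^^^ 2, [])} \<union>
     {((dp i m @ dp (i+1) (m-1)) ^^^ 2, []) | i. 1 \<le> i \<and> i \<le> k-1}"

definition relV2 :: "nat \<Rightarrow> nat \<Rightarrow> gen list rel" where
  "relV2 k m = {(dp i (m*(m-1)), []) | i. 1 \<le> i \<and> i \<le> k}"

definition relV3 :: "nat \<Rightarrow> nat \<Rightarrow> gen list rel" where
  "relV3 k m =
     {((dp 1 ((m-1)^2) @ dp k m @ dp 1 (m-1)) ^^^ (m-1), [])} \<union>
     {((dp (i+1) ((m-1)^2) @ dp i m @ dp (i+1) (m-1)) ^^^ (m-1), []) | i. 1 \<le> i \<and> i \<le> k-1}"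

definition relV4 :: "nat \<Rightarrow> nat \<Rightarrow> gen list rel" where
  "relV4 k m =
     {((dp k m @ dp 1 ((m-1)^2*(m-2)) @ dp k m) ^^^ 3, [])} \<union>
     {((dp i m @ dp (i+1) ((m-1)^2*(m-2)) @ dp i m) ^^^ 3, []) | i. 1 \<le> i \<and> i \<le> k-1}"

definition relV5 :: "nat \<Rightarrow> nat \<Rightarrow> gen list rel" where
  "relV5 k m =
     {((dp k m @ dp 1 ((m-1)^2*(m-j-1)) @ dp k m @ dp 1 ((m-1)^2*(j-1))) ^^^ 2, [])
       | j. 2 \<le> j \<and> j \<le> m-2} \<union>
     {((dp i m @ dp (i+1) ((m-1)^2*(m-j-1)) @ dp i m @ dp (i+1) ((m-1)^2*(j-1))) ^^^ 2, [])
       | i j. 2 \<le> j \<and> j \<le> m-2 \<and> 1 \<le> i \<and> i \<le> k-1}"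

definition relV6 :: "nat \<Rightarrow> nat \<Rightarrow> gen list rel" where
  "relV6 k m =
     {(dp i m @ dp j m, dp j m @ dp i m) | i j. 1 \<le> i \<and> i < j \<and> j \<le> k} \<union>
     {(dp i ((m-1)^2) @ dp j ((m-1)^2), dp j ((m-1)^2) @ dp i ((m-1)^2))
       | i j. 1 \<le> i \<and> i < j \<and> j \<le> k} \<union>
     {(dp i ((m-1)^2) @ dp k m, dp k m @ dp i ((m-1)^2)) | i. 2 \<le> i \<and> i \<le> k-1} \<union>
     {(dp i ((m-1)^2) @ dp j m, dp j m @ dp i ((m-1)^2))
       | i j. 1 \<le> i \<and> i \<le> k \<and> 1 \<le> j \<and> j \<le> k-1 \<and> i \<notin> {j, j+1}}"

definition relV :: "nat \<Rightarrow> nat \<Rightarrow> gen list rel" where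
  "relV k m = relV1 k m \<union> relV2 k m \<union> relV3 k m \<union> relV4 k m \<union> relV5 k m \<union> relV6 k m"

definition relW :: "nat \<Rightarrow> gen list rel" where
  "relW k =
     {(xg i @ xg 0, xg 0 @ xg (i+1)) | i. 1 \<le> i \<and> i \<le> k-2} \<union>
     {(xg j @ xg i, xg i @ xg j) | i j. 2 \<le> i+1 \<and> i+1 < j \<and> j \<le> k-1} \<union>
     {(xg 0 @ xg 0 @ xg 1, xg 0 @ xg 0), (xg 0 @ xg 0, xg (k-1) @ xg 0 @ xg 0)} \<union>
     {(xg (i+1) @ xg i @ xg (i+1), xg (i+1) @ xg i) | i. 1 \<le> i \<and> i \<le> k-2} \<union>
     {(xg (i+1) @ xg i, xg i @ xg (i+1) @ xg i) | i. 1 \<le> i \<and> i \<le> k-2} \<union>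
     {(map Xgen [i..<k] @ map Xgen [0..<i] @ xg i, xg i) | i. i \<le> k-1} \<union>
     {(map Xgen [i+1..<k] @ map Xgen [0..<i] @ xg i @ xg i, xg i @ xg i) | i. 1 \<le> i \<and> i \<le> k-1}"

definition relV'1 :: "nat \<Rightarrow> nat \<Rightarrow> gen list rel" where
  "relV'1 k m = {(dp k m @ dp 1 (m-1) @ xg 0, xg 0), (dp 1 ((m-1)^2) @ xg 0, xg 0)}"

definition relV'2 :: "nat \<Rightarrow> nat \<Rightarrow> gen list rel" where
  "relV'2 k m =
     {(xg 0 @ dp k m @ dp 1 (m-1), dp 1 m @ dp 2 (m-1) @ xg 0)} \<union>
     {(xg 0 @ dp i m @ dp (i+1) (m-1), dp (i+1) m @ dp (i+2) (m-1) @ xg 0) | i. 1 \<le> i \<and> i \<le> k-2} \<union>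
     {(xg 0 @ dp i ((m-1)^2), dp (i+1) ((m-1)^2) @ xg 0) | i. 1 \<le> i \<and> i \<le> k-1}"

definition relV'3 :: "nat \<Rightarrow> nat \<Rightarrow> gen list rel" where
  "relV'3 k m =
     {(xg i @ dp (k-i-1) m @ dp (k-i) (m-1), xg i) | i. i \<le> k-2} \<union>
     {(xg (k-1) @ dp k m @ dp 1 (m-1), xg (k-1))} \<union>
     {(xg i @ dp (k-i) ((m-1)^2), xg i) | i. i \<le> k-1}"

definition relV'4 :: "nat \<Rightarrow> nat \<Rightarrow> gen list rel" where
  "relV'4 k m =
     {(dp i m @ dp (i+1) (m-1) @ xg (k-i), xg (k-i)) | i. 1 \<le> i \<and> i \<le> k-1} \<union>
     {(dp (i+1) ((m-1)^2) @ xg (k-i), xg (k-i)) | i. 1 \<le> i \<and> i \<le> k-1}"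

definition relV'5 :: "nat \<Rightarrow> nat \<Rightarrow> gen list rel" where
  "relV'5 k m =
     {(xg i @ dp (k-i) m @ dp (k-i+1) (m-1), dp (k-i-1) m @ dp (k-i) (m-1) @ xg i)
       | i. 1 \<le> i \<and> i \<le> k-2} \<union>
     {(xg (k-1) @ dp 1 m @ dp 2 (m-1), dp k m @ dp 1 (m-1) @ xg (k-1))} \<union>
     {(xg i @ dp (k-i+1) ((m-1)^2), dp (k-i) ((m-1)^2) @ xg i) | i. 1 \<le> i \<and> i \<le> k-1}"

definition relV'6 :: "nat \<Rightarrow> nat \<Rightarrow> gen list rel" where
  "relV'6 k m =
     {(xg i @ dp k m @ dp 1 (m-1), dp k m @ dp 1 (m-1) @ xg i) | i. 1 \<le> i \<and> i \<le> k-2} \<union>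
     {(xg i @ dp j m @ dp (j+1) (m-1), dp j m @ dp (j+1) (m-1) @ xg i)
       | i j. 1 \<le> i \<and> i \<le> k-1 \<and> 1 \<le> j \<and> j \<le> k-1 \<and> j \<notin> {k-i-1, k-i}} \<union>
     {(xg i @ dp j ((m-1)^2), dp j ((m-1)^2) @ xg i)
       | i j. 1 \<le> i \<and> i \<le> k-1 \<and> 1 \<le> j \<and> j \<le> k \<and> j \<notin> {k-i, k-i+1}}"

definition relV' :: "nat \<Rightarrow> nat \<Rightarrow> gen list rel" where
  "relV' k m = relV'1 k m \<union> relV'2 k m \<union> relV'3 k m \<union> relV'4 k m \<union> relV'5 k m \<union> relV'6 k m"

definition rels :: "nat \<Rightarrow> nat \<Rightarrow> gen list rel" where
  "rels k m = relV k m \<union> relW k \<union> relV' k m"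

lemma Dgen_in_gens: "Dgen i \<in> gens k \<longleftrightarrow> 1 \<le> i \<and> i \<le> k"
  by (auto simp: gens_def)

lemma Xgen_in_gens: "k \<ge> 1 \<Longrightarrow> Xgen i \<in> gens k \<longleftrightarrow> i < k"
  by (auto simp: gens_def)

lemma set_word_power: "set (w ^^^ n) = (if n = 0 then {} else set w)"
  by (simp add: word_power_def)

lemma rels_subset:
  assumes "k \<ge> 2"
  shows "rels k m \<subseteq> carrier (free_monoid (gens k)) \<times> carrier (free_monoid (gens k))"
proof -
  have k: "k \<ge> 1" using assms by simp
  have "relV k m \<subseteq> lists (gens k) \<times> lists (gens k)"
    using assms unfolding relV_def relV1_def relV2_def relV3_def relV4_def relV5_def relV6_def
      lists_eq_set
    by (auto simp: Dgen_in_gens set_word_power)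
  moreover have "relW k \<subseteq> lists (gens k) \<times> lists (gens k)"
    using assms unfolding relW_def lists_eq_set
    by (auto simp: Xgen_in_gens[OF k])
  moreover have "relV' k m \<subseteq> lists (gens k) \<times> lists (gens k)"
    using assms unfolding relV'_def relV'1_def relV'2_def relV'3_def relV'4_def relV'5_def relV'6_def
      lists_eq_set
    by (auto simp: Dgen_in_gens Xgen_in_gens[OF k])
  ultimately show ?thesis
    by (auto simp: rels_def free_monoid_def)
qed

end

(*
  Idea. Write q = (m-1)^2. Since q = 1 mod m and q = 0 mod m-1, the generator d_i is the commuting
  product of an m-cycle g_i = d_i^q on the block I_i and an (m-1)-cycle d_i^m on the next block
  (cyclically), which fixes one point; e_j = d_{j-1}^m d_j^(m-1) is a transposition on I_j.  On the
  pairs (e_j, g_j), V is Moore's presentation of the symmetric group of degree m together with the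
  commutation of distinct blocks.  V' says how the x_i carry e_j and g_j from one block to
  another, or absorb them, so every word is equivalent to u v, with u a word in the e_j, g_j and v
  a word in the x_i, and in u the blocks outside the domain of v may be erased.  It remains to see
  that Moore's relations present the symmetric group (through the Coxeter presentation and its
  normal form) and that W presents the monoid of order-preserving partial injections of a k-chain.
  For the latter put s_a = x_{k-a}, the map moving a to a+1.  W yields idempotents f_a (the identity
  off a) and inverses z_a of the s_a.  A word whose map has domain A is a path of configurations of
  card A particles on the chain, starting at A; moving all particles down to the initial segment,
  the lowest first, shows that any two paths with the same ends are equal.

  The presented monoid is replaced by its right regular representation, so that all computations
  take place in a type of class monoid_mult.
*)
theory Submission
  imports Defs "HOL-Combinatorics.Permutations"
begin

text \<open>Two obstacles shape the proof. First, the presented monoid comes with neither inverses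
  nor the structure of an inverse monoid: that the idempotents of X commute, that different blocks
  commute, and that a word in X is determined by its map must all be extracted from the listed
  words. Hence the algebra is done in locales that assume only equations; \<open>moore\<close> and
  \<open>coxeter\<close> are then instantiated both in an unknown model and by permutations, and the
  two are compared on the same words. Secondly, V and V' treat the pair of blocks k, 1 apart from
  the pairs i, i+1, and write e_1 through d_k and d_1. Indexing each relation by the block it acts
  on, with the cyclic predecessor \<open>prv\<close>, removes this; the reindexed lists serve
  soundness, completeness and counting alike.

  The separate clause for m = 2 comes from V5: its index runs through 2..m-2, which has m-3 elements
  for m >= 3 but none for m = 2, where the closed formula would count -1 for each of the k
  blocks.\<close>

section \<open>Maps composed from left to right, and values of words\<close>

datatype 'a endo = Endo (app: "'a \<Rightarrow> 'a")

instantiation endo :: (type) monoid_mult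
begin

definition one_endo :: "'a endo" where "one_endo = Endo id"

definition times_endo :: "'a endo \<Rightarrow> 'a endo \<Rightarrow> 'a endo" where
  "f * g = Endo (app g \<circ> app f)"

instance by standard (auto simp: one_endo_def times_endo_def endo.expand)

end

lemma app_one [simp]: "app 1 x = x"
  by (simp add: one_endo_def)

lemma app_times [simp]: "app (f * g) x = app g (app f x)"
  by (simp add: times_endo_def)

lemma endo_eqI: "(\<And>x. app f x = app g x) \<Longrightarrow> f = g"
  by (cases f; cases g) auto

definition word_val :: "('b \<Rightarrow> 'a::monoid_mult) \<Rightarrow> 'b list \<Rightarrow> 'a" where
  "word_val \<nu> w = prod_list (map \<nu> w)"

lemma word_val_simps [simp]:
  "word_val \<nu> [] = 1"
  "word_val \<nu> (a # w) = \<nu> a * word_val \<nu> w"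
  "word_val \<nu> (u @ w) = word_val \<nu> u * word_val \<nu> w"
  "word_val \<nu> (replicate n a) = \<nu> a ^ n"
  "word_val \<nu> (w ^^^ n) = word_val \<nu> w ^ n"
proof -
  show "word_val \<nu> (w ^^^ n) = word_val \<nu> w ^ n"
    by (induction n) (auto simp: word_val_def word_power_def)
qed (auto simp: word_val_def prod_list_replicate)

section \<open>A criterion for presentations\<close>

text \<open>The right regular action of a free monoid on the classes of a congruence turns the
  quotient into a submonoid of a type of class \<open>monoid_mult\<close>.\<close>

definition class_action :: "'a set \<Rightarrow> 'a list rel \<Rightarrow> 'a \<Rightarrow> 'a list set endo" where
  "class_action A r a =
     Endo (\<lambda>S. if S \<in> lists A // r then \<Union>v\<in>S. r `` {v @ [a]} else S)"

lemma
  assumes r: "congruence (free_monoid A) r" and w: "w \<in> lists A"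
  shows class_action_class: "v \<in> lists A \<Longrightarrow> app (word_val (class_action A r) w) (r `` {v}) = r `` {v @ w}"
    and class_action_other: "S \<notin> lists A // r \<Longrightarrow> app (word_val (class_action A r) w) S = S"
proof -
  have e: "equiv (lists A) r"
    and c: "\<And>a b c d. (a, b) \<in> r \<Longrightarrow> (c, d) \<in> r \<Longrightarrow> (a @ c, b @ d) \<in> r"
    using r by (auto simp: congruence_def free_monoid_def)
  have step: "app (class_action A r a) (r `` {v}) = r `` {v @ [a]}" if "a \<in> A" "v \<in> lists A" for a v
  proof -
    have "r `` {u @ [a]} = r `` {v @ [a]}" if "u \<in> r `` {v}" for u
    proof -
      have "([a], [a]) \<in> r" using e \<open>a \<in> A\<close> by (simp add: equiv_def refl_on_def)
      then have "(v @ [a], u @ [a]) \<in> r" using c that by auto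
      then show ?thesis using equiv_class_eq[OF e] by blast
    qed
    moreover have "v \<in> r `` {v}" using equiv_class_self[OF e \<open>v \<in> lists A\<close>] .
    ultimately have "(\<Union>u\<in>r `` {v}. r `` {u @ [a]}) = r `` {v @ [a]}"
      by (intro SUP_eq_const) blast+
    then show ?thesis
      using quotientI[OF \<open>v \<in> lists A\<close>, of r] by (simp add: class_action_def)
  qed
  show "app (word_val (class_action A r) w) (r `` {v}) = r `` {v @ w}" if "v \<in> lists A"
    using w that by (induction w arbitrary: v) (auto simp: step)
  show "app (word_val (class_action A r) w) S = S" if "S \<notin> lists A // r"
    using w that by (induction w) (auto simp: class_action_def)
qed

text \<open>Evaluating both words at the class of the empty word gives one direction. Conversely,
  compatibility of the congruence gives equality on the classes, and everywhere else each letter is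
  the identity.\<close>

lemma class_action_eq_iff:
  assumes r: "congruence (free_monoid A) r" and "u \<in> lists A" "v \<in> lists A"
  shows "word_val (class_action A r) u = word_val (class_action A r) v \<longleftrightarrow> (u, v) \<in> r"
proof
  have e: "equiv (lists A) r"
    and c: "\<And>a b c d. (a, b) \<in> r \<Longrightarrow> (c, d) \<in> r \<Longrightarrow> (a @ c, b @ d) \<in> r"
    using r by (auto simp: congruence_def free_monoid_def)
  note cls = class_action_class[OF r] and oth = class_action_other[OF r]
  {
    assume "word_val (class_action A r) u = word_val (class_action A r) v"
    then have "r `` {[] @ u} = r `` {[] @ v}"
      using cls[of u "[]"] cls[of v "[]"] assms by simp
    then show "(u, v) \<in> r" using e assms by (simp add: eq_equiv_class_iff)
  next
    assume uv: "(u, v) \<in> r"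
    show "word_val (class_action A r) u = word_val (class_action A r) v"
    proof (rule endo_eqI)
      fix S
      show "app (word_val (class_action A r) u) S = app (word_val (class_action A r) v) S"
      proof (cases "S \<in> lists A // r")
        case True
        then obtain w where w: "w \<in> lists A" "S = r `` {w}" by (rule quotientE)
        have "(w, w) \<in> r" using e w by (simp add: equiv_def refl_on_def)
        then have "r `` {w @ u} = r `` {w @ v}" using c uv equiv_class_eq[OF e] by blast
        then show ?thesis using w cls assms by simp
      next
        case False
        then show ?thesis using oth[OF assms(2) False] oth[OF assms(3) False] by simp
      qed
    qed
  }
qed

text \<open>The kernel of \<open>h\<close> is a congruence containing R, hence contains the
  generated one; the reverse inclusion is \<open>complete\<close> applied to the class action.
  Completeness is demanded for any assignment that satisfies R, so that it can be proved by
  computing in a monoid instead of rewriting words.\<close>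

lemma presented_monoid_iso:
  assumes "monoid M"
    and R: "R \<subseteq> lists A \<times> lists A"
    and hom: "\<And>u v. u \<in> lists A \<Longrightarrow> v \<in> lists A \<Longrightarrow> h (u @ v) = h u \<otimes>\<^bsub>M\<^esub> h v"
    and h1: "h [] = \<one>\<^bsub>M\<^esub>"
    and onto: "h ` lists A = carrier M"
    and rel: "\<And>u v. (u, v) \<in> R \<Longrightarrow> h u = h v"
    and complete: "\<And>(\<nu> :: 'a \<Rightarrow> 'a list set endo) u v.
      (\<And>a b. (a, b) \<in> R \<Longrightarrow> word_val \<nu> a = word_val \<nu> b) \<Longrightarrow>
      u \<in> lists A \<Longrightarrow> v \<in> lists A \<Longrightarrow> h u = h v \<Longrightarrow> word_val \<nu> u = word_val \<nu> v"
  shows "M \<cong> presented_monoid A R"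
proof -
  interpret monoid M by fact
  let ?F = "free_monoid A" and ?r = "generated_congruence (free_monoid A) R"
  have [simp]: "carrier ?F = lists A" "(\<otimes>\<^bsub>?F\<^esub>) = (@)" "\<one>\<^bsub>?F\<^esub> = []"
    by (auto simp: free_monoid_def)
  have "R \<subseteq> carrier ?F \<times> carrier ?F" using R by simp
  note gen = congruence_generated[OF monoid_free_monoid this]
  have e: "equiv (lists A) ?r" using gen(1) by (simp add: congruence_def)
  have r_iff: "(u, v) \<in> ?r \<longleftrightarrow> h u = h v" if uv: "u \<in> lists A" "v \<in> lists A" for u v
  proof
    \<comment> \<open>The kernel of \<open>h\<close>.\<close>
    let ?s = "{(u, v). u \<in> lists A \<and> v \<in> lists A \<and> h u = h v}"
    have "congruence ?F ?s"
      unfolding congruence_def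
      by (auto simp: equiv_def refl_on_def sym_def trans_def hom)
    moreover have "R \<subseteq> ?s" using R rel by auto
    ultimately have "?r \<subseteq> ?s" by (auto simp: generated_congruence_def)
    then show "h u = h v" if "(u, v) \<in> ?r" using that by auto
  next
    assume eq: "h u = h v"
    have "word_val (class_action A ?r) u = word_val (class_action A ?r) v"
    proof (rule complete[OF _ uv eq])
      fix a b assume ab: "(a, b) \<in> R"
      then show "word_val (class_action A ?r) a = word_val (class_action A ?r) b"
        using R gen(2) by (subst class_action_eq_iff[OF gen(1)]) auto
    qed
    then show "(u, v) \<in> ?r" using class_action_eq_iff[OF gen(1) uv] by simp
  qed
  define w where "w \<alpha> = (SOME u. u \<in> lists A \<and> h u = \<alpha>)" for \<alpha>
  have w: "w \<alpha> \<in> lists A \<and> h (w \<alpha>) = \<alpha>" if \<alpha>: "\<alpha> \<in> carrier M" for \<alpha>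
  proof -
    obtain u where "u \<in> lists A" "\<alpha> = h u" using \<alpha> onto by (metis imageE)
    then show ?thesis
      unfolding w_def using someI[of "\<lambda>u. u \<in> lists A \<and> h u = \<alpha>" u] by simp
  qed
  have cls: "?r `` {u} = ?r `` {v} \<longleftrightarrow> h u = h v" if "u \<in> lists A" "v \<in> lists A" for u v
    using eq_equiv_class_iff[OF e] that r_iff by simp
  let ?f = "\<lambda>\<alpha>. ?r `` {w \<alpha>}"
  have "?f \<in> iso M (presented_monoid A R)"
  proof (rule isoI)
    show "?f \<in> hom M (presented_monoid A R)"
    proof (rule homI)
      fix \<alpha> \<beta> assume \<alpha>: "\<alpha> \<in> carrier M" and \<beta>: "\<beta> \<in> carrier M"
      have "?f (\<alpha> \<otimes>\<^bsub>M\<^esub> \<beta>) = ?r `` {w \<alpha> @ w \<beta>}"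
        using w[OF \<alpha>] w[OF \<beta>] w[of "\<alpha> \<otimes>\<^bsub>M\<^esub> \<beta>"] \<alpha> \<beta> hom by (subst cls) auto
      then show "?f (\<alpha> \<otimes>\<^bsub>M\<^esub> \<beta>) = ?f \<alpha> \<otimes>\<^bsub>presented_monoid A R\<^esub> ?f \<beta>"
        using quotient_monoid_mult[OF monoid_free_monoid gen(1), of "w \<alpha>" "w \<beta>"] w[OF \<alpha>] w[OF \<beta>]
        by (simp add: presented_monoid_def)
    qed (use w in \<open>auto simp: presented_monoid_def quotient_monoid_def quotientI\<close>)
    show "bij_betw ?f (carrier M) (carrier (presented_monoid A R))"
    proof (rule bij_betwI')
      fix \<alpha> \<beta> assume "\<alpha> \<in> carrier M" "\<beta> \<in> carrier M"
      then show "?f \<alpha> = ?f \<beta> \<longleftrightarrow> \<alpha> = \<beta>" using w cls by metis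
    next
      fix \<alpha> assume "\<alpha> \<in> carrier M"
      then show "?f \<alpha> \<in> carrier (presented_monoid A R)"
        using w by (auto simp: presented_monoid_def quotient_monoid_def quotientI)
    next
      fix S assume "S \<in> carrier (presented_monoid A R)"
      then have "S \<in> lists A // ?r" by (simp add: presented_monoid_def quotient_monoid_def)
      then obtain u where u: "u \<in> lists A" "S = ?r `` {u}" by (rule quotientE)
      then have "h u \<in> carrier M" using onto by blast
      then show "\<exists>\<alpha>\<in>carrier M. S = ?f \<alpha>" using u w cls by metis
    qed
  qed
  then show ?thesis by (auto simp: is_iso_def)
qed

lemma word_val_commute:
  assumes "\<And>a. a \<in> set w \<Longrightarrow> \<nu> a * c = c * \<nu> a"
  shows "word_val \<nu> w * c = c * word_val \<nu> w"
  using assms by (induction w) (auto simp: mult.assoc, metis mult.assoc)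

lemma word_val_cong: "(\<And>a. a \<in> set w \<Longrightarrow> \<nu> a = \<mu> a) \<Longrightarrow> word_val \<nu> w = word_val \<mu> w"
  by (induction w) auto

section \<open>Descending products of generators\<close>

text \<open>The product \<open>t (n - 1) * ... * t r\<close>. It serves as a coset representative in
  the symmetric group, as a run of letters of X, and, in \<open>settle\<close>, as the path of one
  particle.\<close>

definition desc :: "(nat \<Rightarrow> 'a::monoid_mult) \<Rightarrow> nat \<Rightarrow> nat \<Rightarrow> 'a" where
  "desc t n r = word_val t (rev [r..<n])"

lemma desc_empty [simp]: "n \<le> r \<Longrightarrow> desc t n r = 1"
  by (simp add: desc_def)

lemma desc_Suc: "r \<le> n \<Longrightarrow> desc t (Suc n) r = t n * desc t n r"
  by (simp add: desc_def)

lemma desc_rec: "r < n \<Longrightarrow> desc t n r = desc t n (Suc r) * t r"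
  by (simp add: desc_def upt_conv_Cons)

lemma desc_split: "r \<le> q \<Longrightarrow> q \<le> n \<Longrightarrow> desc t n r = desc t n q * desc t q r"
  using upt_add_eq_append[of r q "n - q"] by (simp add: desc_def)

lemma desc_commute:
  "(\<And>a. r \<le> a \<Longrightarrow> a < n \<Longrightarrow> t a * c = c * t a) \<Longrightarrow> desc t n r * c = c * desc t n r"
  unfolding desc_def by (rule word_val_commute) auto

section \<open>The symmetric group\<close>

text \<open>Squares are left open, so that the Coxeter generators, indexed from 0, and the
  non-invertible letters of the chain monoid, indexed from 1, both fit.\<close>

locale braid_monoid =
  fixes t :: "nat \<Rightarrow> 'a::monoid_mult" and L N :: nat
  assumes braid: "L \<le> i \<Longrightarrow> Suc i < N \<Longrightarrow> t i * t (Suc i) * t i = t (Suc i) * t i * t (Suc i)"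
    and comm: "L \<le> i \<Longrightarrow> i + 2 \<le> j \<Longrightarrow> j < N \<Longrightarrow> t i * t j = t j * t i"
begin

lemma comm':
  assumes "L \<le> i" "L \<le> j" "i < N" "j < N" "i + 2 \<le> j \<or> j + 2 \<le> i"
  shows "t i * t j = t j * t i"
  using assms comm[of i j] comm[of j i] by auto

text \<open>The letter \<open>t s\<close> travels left until it meets
  \<open>t s * t (s - 1)\<close>, where the braid relation turns it into \<open>t (s - 1)\<close>;
  the factors further left have indices above s and let that pass.\<close>

lemma desc_slide:
  assumes "L \<le> r" "r < s" "s < n" "n \<le> N"
  shows "desc t n r * t s = t (s - 1) * desc t n r"
proof -
  obtain q where s: "s = Suc q" using assms by (cases s) auto
  have d: "desc t n r = desc t n (Suc s) * (t (Suc q) * t q) * desc t q r"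
  proof -
    have "desc t n r = desc t n (Suc s) * desc t (Suc s) r"
      using assms by (intro desc_split) auto
    also have "desc t (Suc s) r = t (Suc q) * t q * desc t q r"
      using assms s by (simp add: desc_Suc mult.assoc)
    finally show ?thesis by (simp add: mult.assoc)
  qed
  have c1: "desc t q r * t s = t s * desc t q r"
    using assms s by (intro desc_commute comm') auto
  have c2: "desc t n (Suc s) * t q = t q * desc t n (Suc s)"
    using assms s by (intro desc_commute comm') auto
  have b: "t s * t q * t s = t q * t s * t q"
    using braid[of q] assms s by simp
  have "desc t n r * t s = desc t n (Suc s) * (t s * t q * (t s * desc t q r))"
    unfolding d using c1 by (simp add: mult.assoc s)
  also have "\<dots> = desc t n (Suc s) * (t q * t s * t q * desc t q r)"
    using b by (simp flip: mult.assoc)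
  also have "\<dots> = t q * (desc t n (Suc s) * (t s * t q * desc t q r))"
    using c2 by (simp flip: mult.assoc)
  also have "\<dots> = t (s - 1) * desc t n r"
    unfolding d by (simp add: mult.assoc s)
  finally show ?thesis .
qed

end

locale coxeter = braid_monoid t 0 N for t :: "nat \<Rightarrow> 'a::monoid_mult" and N +
  assumes square: "i < N \<Longrightarrow> t i * t i = 1"
begin

text \<open>The descending products represent the right cosets of the subgroup generated by
  \<open>t 0, ..., t (n - 2)\<close>. Multiplication by a generator either keeps the representative
  and lets a generator of that subgroup out on the left, or changes r by one.\<close>

lemma desc_times:
  assumes "s < n" "r \<le> n" "n \<le> N"
  shows "desc t n r * t s =
    (if r < s then t (s - 1) * desc t n r else if s = r then desc t n (Suc r)
     else if Suc s = r then desc t n s else t s * desc t n r)"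
proof -
  consider "r < s" | "s = r" | "Suc s = r" | "Suc s < r" by linarith
  then show ?thesis
  proof cases
    case 1
    then show ?thesis using desc_slide[of r s n] assms by simp
  next
    case 2
    then show ?thesis using desc_rec[of r n t] square[of s] assms by (simp add: mult.assoc)
  next
    case 3
    then show ?thesis using desc_rec[of s n t] assms by simp
  next
    case 4
    have "desc t n r * t s = t s * desc t n r"
      using 4 assms by (intro desc_commute comm') auto
    then show ?thesis using 4 by simp
  qed
qed

lemma word_val_rev: "set w \<subseteq> {..<N} \<Longrightarrow> word_val t w * word_val t (rev w) = 1"
proof (induction w)
  case (Cons a w)
  then have "t a * (word_val t w * word_val t (rev w)) * t a = 1" using square by simp
  then show ?case by (simp add: mult.assoc)
qed simp

end

text \<open>Which case of \<open>desc_times\<close> applies depends on indices only. Hence one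
  reduction serves two Coxeter systems at once, with the same w' and r, and the unknown system can
  be compared with the transpositions.\<close>

lemma coxeter_normal_form:
  fixes t :: "nat \<Rightarrow> 'a::monoid_mult" and T :: "nat \<Rightarrow> 'b::monoid_mult"
  assumes t: "coxeter t N" and T: "coxeter T N" and w: "set w \<subseteq> {..<Suc n}" and n: "Suc n \<le> N"
  obtains w' r where "set w' \<subseteq> {..<n}" "r \<le> Suc n"
    "word_val t w = word_val t w' * desc t (Suc n) r"
    "word_val T w = word_val T w' * desc T (Suc n) r"
proof -
  have "\<exists>w' r. set w' \<subseteq> {..<n} \<and> r \<le> Suc n \<and>
    word_val t w = word_val t w' * desc t (Suc n) r \<and>
    word_val T w = word_val T w' * desc T (Suc n) r"
    using w
  proof (induction w rule: rev_induct)
    case Nil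
    show ?case by (intro exI[of _ "[]"] exI[of _ "Suc n"]) simp
  next
    case (snoc s w)
    then obtain w' r where IH: "set w' \<subseteq> {..<n}" "r \<le> Suc n"
      "word_val t w = word_val t w' * desc t (Suc n) r"
      "word_val T w = word_val T w' * desc T (Suc n) r" and s: "s < Suc n" by auto
    note E = coxeter.desc_times[OF t s IH(2) n] coxeter.desc_times[OF T s IH(2) n]
    consider "r < s" | "s = r" | "Suc s = r" | "Suc s < r" by linarith
    then show ?case
    proof cases
      case 1
      then show ?thesis using IH E s
        by (intro exI[of _ "w' @ [s - 1]"] exI[of _ r]) (auto simp: mult.assoc)
    next
      case 2
      then show ?thesis using IH E s
        by (intro exI[of _ w'] exI[of _ "Suc r"]) (auto simp: mult.assoc)
    next
      case 3
      then show ?thesis using IH E s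
        by (intro exI[of _ w'] exI[of _ s]) (auto simp: mult.assoc)
    next
      case 4
      then show ?thesis using IH E s
        by (intro exI[of _ "w' @ [s]"] exI[of _ r]) (auto simp: mult.assoc)
    qed
  qed
  then show ?thesis using that by blast
qed

section \<open>Adjacent transpositions as a faithful model of the Coxeter relations\<close>

definition adj :: "nat \<Rightarrow> nat endo" where
  "adj i = Endo (transpose i (Suc i))"

lemma app_adj [simp]: "app (adj i) x = transpose i (Suc i) x"
  by (simp add: adj_def)

lemma coxeter_adj: "coxeter adj N"
  by unfold_locales (auto intro!: endo_eqI simp: transpose_def)

text \<open>The image of the top point tells the coset representatives apart.\<close>

lemma app_desc_adj: "r \<le> n \<Longrightarrow> app (desc adj n r) n = r"
  by (induction n) (auto simp: desc_Suc le_Suc_eq transpose_def)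

lemma app_word_adj_fixed: "set w \<subseteq> {..<n} \<Longrightarrow> n < x \<Longrightarrow> app (word_val adj w) x = x"
  by (induction w) (auto simp: transpose_def)

text \<open>A trivial permutation fixes the top point, so the representative in the normal form is
  empty and the induction hypothesis applies to what is left.\<close>

lemma coxeter_trivial:
  assumes "coxeter t N"
  shows "set w \<subseteq> {..<n} \<Longrightarrow> n \<le> N \<Longrightarrow> word_val adj w = 1 \<Longrightarrow> word_val t w = 1"
proof (induction n arbitrary: w)
  case (Suc n)
  obtain w' r where w': "set w' \<subseteq> {..<n}" "r \<le> Suc n"
    "word_val t w = word_val t w' * desc t (Suc n) r"
    "word_val adj w = word_val adj w' * desc adj (Suc n) r"
    using coxeter_normal_form[OF assms coxeter_adj Suc.prems(1,2)] .
  have "app (word_val adj w) (Suc n) = r"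
    unfolding w'(4) using app_word_adj_fixed[OF w'(1)] app_desc_adj[OF w'(2)] by simp
  then have "r = Suc n" using Suc.prems by simp
  then show ?case using Suc.IH[OF w'(1)] Suc.prems w' by simp
qed simp

text \<open>The generators are involutions, so reversing a word inverts it; this reduces equality of
  two words to triviality of one.\<close>

theorem coxeter_faithful:
  assumes t: "coxeter t N" and uv: "set u \<subseteq> {..<N}" "set v \<subseteq> {..<N}"
    and eq: "word_val adj u = word_val adj v"
  shows "word_val t u = word_val t v"
proof -
  have "word_val adj (u @ rev v) = 1"
    using eq coxeter.word_val_rev[OF coxeter_adj uv(2)] by simp
  then have *: "word_val t u * word_val t (rev v) = 1"
    using coxeter_trivial[OF t, of "u @ rev v" N] uv by simp
  have "word_val t (rev v) * word_val t v = 1"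
    using coxeter.word_val_rev[OF t, of "rev v"] uv by simp
  then have "word_val t u = word_val t u * word_val t (rev v) * word_val t v"
    by (simp add: mult.assoc)
  then show ?thesis using * by simp
qed

section \<open>Moore's presentation by a transposition and a long cycle\<close>

text \<open>As the ambient structure is only a monoid, the inverse of \<open>g ^ j\<close> is
  written \<open>g ^ (m - j)\<close>.\<close>

locale moore =
  fixes e g :: "'a::monoid_mult" and m :: nat
  assumes m2: "m \<ge> 2" and e2: "e * e = 1" and gm: "g ^ m = 1" and eg: "(e * g) ^ (m - 1) = 1"
    and e3: "(e * g ^ (m - 1) * e * g) ^ 3 = 1"
    and ej: "2 \<le> j \<Longrightarrow> j \<le> m - 2 \<Longrightarrow> (e * g ^ (m - j) * e * g ^ j) ^ 2 = 1"
begin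

definition t :: "nat \<Rightarrow> 'a" where "t j = g ^ (m - j) * e * g ^ j"

lemma g_inverse: "j \<le> m \<Longrightarrow> g ^ (m - j) * g ^ j = 1" "j \<le> m \<Longrightarrow> g ^ j * g ^ (m - j) = 1"
  using gm by (simp_all flip: power_add)

lemma t_conj: "i + j \<le> m \<Longrightarrow> t (i + j) = g ^ (m - i) * t j * g ^ i"
proof -
  assume ij: "i + j \<le> m"
  have "g ^ (m - i) * g ^ (m - j) = g ^ (m - (i + j)) * g ^ m"
    using ij by (simp flip: power_add)
  then show ?thesis using gm by (simp add: t_def mult.assoc power_add add.commute[of i j])
      (simp flip: mult.assoc)
qed

lemma t_0 [simp]: "t 0 = e"
  by (simp add: t_def gm)

lemma conj_mult: "i \<le> m \<Longrightarrow> (g ^ (m - i) * x * g ^ i) * (g ^ (m - i) * y * g ^ i) = g ^ (m - i) * (x * y) * g ^ i"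
  using g_inverse(2)[of i] by (simp add: mult.assoc) (metis mult.assoc mult_1_left)

lemma t_square: "j \<le> m \<Longrightarrow> t j * t j = 1"
  using conj_mult[of j e e] g_inverse(1)[of j] e2 by (simp add: t_def)

lemma e_cancel: "e * (e * x) = x"
  using e2 by (simp flip: mult.assoc)

lemma t_cancel: "j \<le> m \<Longrightarrow> t j * (t j * x) = x"
  using t_square by (simp flip: mult.assoc)

text \<open>Conjugation by \<open>g ^ i\<close> takes the pair \<open>t 0\<close>,
  \<open>t d\<close> to \<open>t i\<close>, \<open>t (i + d)\<close>, so each relation has to be
  shown only for pairs starting with \<open>t 0 = e\<close>: the braid relation (d = 1) is
  \<open>e3\<close>, the commutation (d >= 2) is \<open>ej\<close>.\<close>

sublocale coxeter t "m - 1"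
proof
  fix i assume i: "Suc i < m - 1"
  have 1: "t 1 = g ^ (m - 1) * e * g" by (simp add: t_def)
  have "(e * t 1) ^ 3 = 1" using e3 unfolding 1 by (simp only: mult.assoc)
  then have "(e * t 1 * e) * (t 1 * e * t 1) = 1"
    by (simp add: power3_eq_cube mult.assoc)
  then have "(e * t 1 * e) * (t 1 * e * t 1) * (t 1 * e * t 1) = t 1 * e * t 1" by simp
  moreover have "(t 1 * e * t 1) * (t 1 * e * t 1) = 1"
    using e_cancel t_cancel[of 1] t_square[of 1] m2 by (simp add: mult.assoc)
  ultimately have *: "e * t 1 * e = t 1 * e * t 1" by (simp add: mult.assoc)
  have "t i = g ^ (m - i) * e * g ^ i" "t (Suc i) = g ^ (m - i) * t 1 * g ^ i"
    using t_conj[of i 0] t_conj[of i 1] i by auto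
  then show "t i * t (Suc i) * t i = t (Suc i) * t i * t (Suc i)"
    using conj_mult[of i] * i by simp
next
  fix i j assume ij: "i + 2 \<le> j" "j < m - 1"
  define d where "d = j - i"
  have d: "j = i + d" "2 \<le> d" "d \<le> m - 2" "d \<le> m" using ij by (auto simp: d_def)
  have "(e * t d) * (e * t d) = 1"
    using ej[OF d(2,3)] by (simp add: t_def power2_eq_square mult.assoc)
  then have "e * (e * t d * (e * t d)) * t d = e * t d" by (simp add: mult.assoc)
  then have *: "e * t d = t d * e"
    using e_cancel t_square[OF d(4)] by (simp add: mult.assoc)
  have "t i = g ^ (m - i) * e * g ^ i" "t j = g ^ (m - i) * t d * g ^ i"
    using t_conj[of i 0] t_conj[of i d] d ij by auto
  then show "t i * t j = t j * t i"
    using conj_mult[of i] * ij by simp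
next
  fix i assume "i < m - 1"
  then show "t i * t i = 1" using t_square by simp
qed

text \<open>Between consecutive conjugates the powers of g collapse to a single g, so the whole
  product is \<open>g * (g * e) ^ (m - 1)\<close>; the second factor is conjugate to
  \<open>(e * g) ^ (m - 1) = 1\<close>.\<close>

lemma g_eq_desc: "g = desc t (m - 1) 0"
proof -
  have *: "desc t (m - 1) (m - 1 - n) = g * (g * e) ^ n * g ^ (m - 1 - n)" if "n \<le> m - 1" for n
    using that
  proof (induction n)
    case 0
    then show ?case using gm m2 by (simp flip: power_Suc)
  next
    case (Suc n)
    define r where "r = m - 1 - Suc n"
    have r: "m - 1 - n = Suc r" "r < m - 1" using Suc.prems by (auto simp: r_def)
    have mr: "Suc r \<le> m" "m - r = Suc (m - Suc r)" using r by auto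
    have "desc t (m - 1) r = desc t (m - 1) (Suc r) * t r" using r(2) by (rule desc_rec)
    also have "\<dots> = g * (g * e) ^ n * (g ^ Suc r * g ^ (m - Suc r)) * g * e * g ^ r"
      using Suc.IH Suc.prems unfolding r(1) t_def mr(2) by (simp add: mult.assoc power_commutes)
    also have "\<dots> = g * (g * e) ^ Suc n * g ^ r"
      using g_inverse(2)[OF mr(1)] by (simp add: mult.assoc power_commutes)
    finally show ?case by (simp add: r_def)
  qed
  have "(g * e) ^ (m - 1) = e * (e * g) ^ (m - 1) * e"
  proof -
    have "e * (e * g) ^ n * e = (g * e) ^ n" for n
    proof (induction n)
      case (Suc n)
      have "e * (e * g) ^ Suc n * e = (e * e) * g * (e * e) * (e * g) ^ n * e"
        using e_cancel by (simp add: mult.assoc)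
      also have "\<dots> = g * e * (e * (e * g) ^ n * e)" using e2 e_cancel by (simp add: mult.assoc)
      finally show ?case using Suc by simp
    qed (simp add: e2)
    then show ?thesis by simp
  qed
  then have "(g * e) ^ (m - 1) = 1" using eg e2 by simp
  then show ?thesis using *[of "m - 1"] by simp
qed

definition val :: "bool \<Rightarrow> 'a" where "val b = (if b then e else g)"

end

text \<open>In the Boolean words \<open>True\<close> stands for the transposition and
  \<open>False\<close> for the cycle; the cycle is spelled out as in
  \<open>g_eq_desc\<close>.\<close>

definition coxeter_word :: "nat \<Rightarrow> bool list \<Rightarrow> nat list" where
  "coxeter_word m u = concat (map (\<lambda>b. if b then [0] else rev [0..<m-1]) u)"

lemma set_coxeter_word: "m \<ge> 2 \<Longrightarrow> set (coxeter_word m u) \<subseteq> {..<m-1}"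
  by (auto simp: coxeter_word_def split: if_splits)

lemma (in moore) word_val_coxeter_word: "word_val t (coxeter_word m u) = word_val val u"
proof (induction u)
  case (Cons b u)
  then show ?case
    using g_eq_desc by (cases b) (auto simp: coxeter_word_def val_def desc_def)
qed (simp add: coxeter_word_def)

section \<open>The permutation model of Moore's presentation\<close>

definition rot :: "nat \<Rightarrow> nat endo" where
  "rot m = Endo (\<lambda>r. if r < m then Suc r mod m else r)"

lemma app_rot_power: "app (rot m ^ n) r = (if r < m then (r + n) mod m else r)"
proof (induction n arbitrary: r)
  case (Suc n)
  then show ?case by (auto simp: rot_def mod_simps)
qed auto

lemma app_rot_power':
  "n \<le> m \<Longrightarrow> app (rot m ^ n) r = (if r < m then if r + n < m then r + n else r + n - m else r)"
  by (simp add: app_rot_power mod_if)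

text \<open>The bound on j keeps j and j+1 from wrapping around the cycle.\<close>

lemma rot_conj: "j < m - 1 \<Longrightarrow> rot m ^ (m - j) * adj 0 * rot m ^ j = adj j"
proof (rule endo_eqI)
  fix x assume j: "j < m - 1"
  then have r: "m - j \<le> m" "j \<le> m" by auto
  consider "x < j" | "x = j" | "x = Suc j" | "Suc j < x" "x < m" | "m \<le> x" by linarith
  then show "app (rot m ^ (m - j) * adj 0 * rot m ^ j) x = app (adj j) x"
  proof cases
    case 1
    then have "app (rot m ^ (m - j)) x = x + m - j" using j by (auto simp: app_rot_power'[OF r(1)])
    then show ?thesis using 1 j by (auto simp: app_rot_power'[OF r(2)] transpose_def)
  next
    case 4
    then have "app (rot m ^ (m - j)) x = x - j" using j by (auto simp: app_rot_power'[OF r(1)])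
    then show ?thesis using 4 j by (auto simp: app_rot_power'[OF r(2)] transpose_def)
  qed (use j in \<open>auto simp: app_rot_power'[OF r(1)] app_rot_power'[OF r(2)] transpose_def\<close>)
qed

lemma moore_adj_rot:
  assumes m: "m \<ge> 2"
  shows "moore (adj 0) (rot m) m"
proof
  show "adj 0 * adj 0 = 1" by (auto intro!: endo_eqI)
  show "rot m ^ m = 1" by (auto intro!: endo_eqI simp: app_rot_power)
  show eg: "(adj 0 * rot m) ^ (m - 1) = 1"
  proof (rule endo_eqI)
    \<comment> \<open>The product fixes 1 and permutes 0, 2, 3, ..., m-1 cyclically;
      \<open>unlab\<close> numbers this cycle by 0, ..., m-2, and \<open>lab\<close> is its inverse
      there.\<close>
    define lab where "lab x = (if x = 0 then 0 else x - 1 :: nat)" for x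
    define unlab where "unlab x = (if x = 0 then 0 else x + 1 :: nat)" for x
    have step: "app (adj 0 * rot m) (unlab y) = unlab (Suc y mod (m - 1))" if "y < m - 1" for y
    proof (cases "Suc y = m - 1")
      case True
      then have "m = Suc (Suc y)" by simp
      then show ?thesis by (cases "y = 0") (auto simp: unlab_def rot_def transpose_def)
    next
      case False
      then show ?thesis using that m by (cases "y = 0") (auto simp: unlab_def rot_def transpose_def)
    qed
    have pow: "app ((adj 0 * rot m) ^ n) (unlab y) = unlab ((y + n) mod (m - 1))" if "y < m - 1" for n y
      using that
    proof (induction n arbitrary: y)
      case (Suc n)
      have "Suc y mod (m - 1) < m - 1" using Suc.prems by simp
      from Suc.IH[OF this] show ?case using step[OF Suc.prems] by (simp add: mod_simps)
    qed simp
    have one: "app (adj 0 * rot m) 1 = 1" using m by (auto simp: rot_def transpose_def)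
    have ones: "app ((adj 0 * rot m) ^ n) 1 = 1" for n
      by (induction n) (use one in auto)
    have big: "app ((adj 0 * rot m) ^ n) x = x" if "x \<ge> m" for n x
      by (induction n) (use m that in \<open>auto simp: rot_def transpose_def\<close>)
    fix x
    consider "x = 1" | "x \<ge> m" | "x < m" "x \<noteq> 1" by linarith
    then show "app ((adj 0 * rot m) ^ (m - 1)) x = app 1 x"
    proof cases
      case 3
      then have "x = unlab (lab x)" "lab x < m - 1" using m by (auto simp: lab_def unlab_def)
      then show ?thesis using pow[of "lab x" "m - 1"] by (metis app_one mod_add_self2 mod_less)
    qed (use ones big in simp_all)
  qed
  show "(adj 0 * rot m ^ (m - 1) * adj 0 * rot m) ^ 3 = 1"
  \<comment> \<open>\<open>rot_conj\<close> at j = 1 requires m >= 3. For m = 2 the relation just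
    shown says that \<open>adj 0 * rot m\<close> itself is 1.\<close>
  proof (cases "m = 2")
    case True
    then have "adj 0 * rot m = 1" using eg by simp
    then show ?thesis using True by (simp add: mult.assoc)
  next
    case False
    then have "adj 0 * rot m ^ (m - 1) * adj 0 * rot m = adj 0 * adj 1"
      using rot_conj[of 1 m] m by (simp add: mult.assoc)
    then show ?thesis by (auto intro!: endo_eqI simp: power3_eq_cube transpose_def)
  qed
  fix j assume j: "2 \<le> j" "j \<le> m - 2"
  then have "adj 0 * rot m ^ (m - j) * adj 0 * rot m ^ j = adj 0 * adj j"
    using rot_conj[of j m] by (simp add: mult.assoc)
  then show "(adj 0 * rot m ^ (m - j) * adj 0 * rot m ^ j) ^ 2 = 1"
    using j by (auto intro!: endo_eqI simp: power2_eq_square transpose_def)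
qed (use m in simp)

definition perm_val :: "nat \<Rightarrow> bool \<Rightarrow> nat endo" where
  "perm_val m b = (if b then adj 0 else rot m)"

lemma perm_coxeter_word:
  assumes "m \<ge> 2"
  shows "word_val adj (coxeter_word m u) = word_val (perm_val m) u"
proof -
  interpret moore "adj 0" "rot m" m by (rule moore_adj_rot[OF assms])
  have "word_val adj (coxeter_word m u) = word_val t (coxeter_word m u)"
    using set_coxeter_word[OF assms, of u] rot_conj[of _ m]
    by (intro word_val_cong) (auto simp: t_def)
  then show ?thesis
    using word_val_coxeter_word by (simp add: val_def[abs_def] perm_val_def[abs_def])
qed

text \<open>Equal permutations give translated words that agree in the adjacent transpositions,
  hence in the Coxeter system \<open>t\<close> derived from Moore's relations.\<close>

theorem (in moore) moore_faithful:
  assumes "word_val (perm_val m) u = word_val (perm_val m) v"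
  shows "word_val val u = word_val val v"
proof -
  have "word_val adj (coxeter_word m u) = word_val adj (coxeter_word m v)"
    using assms perm_coxeter_word[OF m2] by simp
  then have "word_val t (coxeter_word m u) = word_val t (coxeter_word m v)"
    using coxeter_faithful[OF coxeter_axioms] set_coxeter_word[OF m2] by blast
  then show ?thesis by (simp add: word_val_coxeter_word)
qed

lemma permutes_desc_adj: "app (desc adj n r) permutes {..n}"
proof (induction n)
  case 0
  then show ?case by (simp add: permutes_def)
next
  case (Suc n)
  show ?case
  proof (cases "r \<le> n")
    case True
    have "app (desc adj (Suc n) r) = app (desc adj n r) \<circ> transpose n (Suc n)"
      using True by (auto simp: desc_Suc)
    moreover have "transpose n (Suc n) permutes {..Suc n}" by (rule permutes_swap_id) auto
    moreover have "app (desc adj n r) permutes {..Suc n}" by (rule permutes_subset[OF Suc]) auto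
    ultimately show ?thesis using permutes_compose by metis
  qed (auto simp: permutes_def one_endo_def)
qed

text \<open>Split off on the right the descending product that sends the top point where f sends it;
  the quotient fixes the top point.\<close>

lemma permutes_coxeter_word:
  "f permutes {..n} \<Longrightarrow> \<exists>w. set w \<subseteq> {..<n} \<and> word_val adj w = Endo f"
proof (induction n arbitrary: f)
  case 0
  then have "f = id" by simp
  then show ?case by (intro exI[of _ "[]"]) (simp add: one_endo_def id_def)
next
  case (Suc n)
  let ?r = "f (Suc n)"
  let ?d = "app (desc adj (Suc n) ?r)"
  have r: "?r \<le> Suc n" using permutes_in_image[OF Suc.prems, of "Suc n"] by simp
  have d: "?d permutes {..Suc n}" by (rule permutes_desc_adj)
  have "inv_into UNIV ?d \<circ> f permutes {..Suc n}"
    using permutes_compose[OF Suc.prems permutes_inv[OF d]] .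
  moreover have "(inv_into UNIV ?d \<circ> f) (Suc n) = Suc n"
    using app_desc_adj[OF r] permutes_inverses(2)[OF d] by (metis comp_apply)
  ultimately have "inv_into UNIV ?d \<circ> f permutes {..n}"
    by (elim permutes_superset) (auto simp: le_Suc_eq)
  from Suc.IH[OF this] obtain w where w: "set w \<subseteq> {..<n}" "word_val adj w = Endo (inv_into UNIV ?d \<circ> f)"
    by blast
  have "word_val adj (w @ rev [?r..<Suc n]) = Endo f"
    unfolding word_val_simps w(2) desc_def[symmetric]
    by (rule endo_eqI) (simp add: permutes_inverses(1)[OF d])
  then show ?case using w by (intro exI[of _ "w @ rev [?r..<Suc n]"]) auto
qed

lemma permutes_word:
  assumes m: "m \<ge> 2" and f: "f permutes {..<m}"
  obtains u where "word_val (perm_val m) u = Endo f"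
proof -
  have "{..m - 1} = {..<m}" using m by auto
  then obtain w where w: "set w \<subseteq> {..<m-1}" "word_val adj w = Endo f"
    using permutes_coxeter_word[of f "m - 1"] f by auto
  have "\<exists>u. word_val (perm_val m) u = word_val adj w" using w(1)
  proof (induction w)
    case (Cons j w)
    then obtain u where u: "word_val (perm_val m) u = word_val adj w" by auto
    \<comment> \<open>The j-th adjacent transposition is the first one conjugated by the j-th power
      of the rotation.\<close>
    have "word_val (perm_val m) (replicate (m - j) False @ True # replicate j False @ u) = word_val adj (j # w)"
      using rot_conj[of j m] Cons.prems u by (simp add: perm_val_def flip: mult.assoc)
    then show ?case by blast
  qed (metis word_val_simps(1))
  then show ?thesis using w that by auto
qed

lemma perm_val_permutes:
  assumes "m \<ge> 2"
  shows "app (word_val (perm_val m) u) permutes {..<m}"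
proof (induction u)
  case (Cons b u)
  have "app (perm_val m b) permutes {..<m}"
  proof (cases b)
    case True
    then show ?thesis using assms permutes_swap_id[of 0 "{..<m}" 1] by (simp add: perm_val_def adj_def)
  next
    case False
    have "bij_betw (app (rot m)) {..<m} {..<m}"
      using app_rot_power'[of 1 m] app_rot_power'[of "m - 1" m] assms
      by (intro bij_betwI[where g = "app (rot m ^ (m - 1))"]) auto
    then show ?thesis using False
      by (intro bij_imp_permutes) (auto simp: perm_val_def rot_def)
  qed
  moreover have "app (word_val (perm_val m) (b # u)) = app (word_val (perm_val m) u) \<circ> app (perm_val m b)"
    by (simp add: times_endo_def)
  ultimately show ?case using permutes_compose Cons by metis
qed (simp add: permutes_def one_endo_def)

section \<open>Products over families of commuting elements\<close>

lemma word_val_mult: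
  assumes "distinct L" and "\<And>a b. a \<in> set L \<Longrightarrow> b \<in> set L \<Longrightarrow> a \<noteq> b \<Longrightarrow> u a * v b = v b * u a"
  shows "word_val (\<lambda>a. u a * v a) L = word_val u L * word_val v L"
  using assms
proof (induction L)
  case (Cons a L)
  have *: "word_val u L * v a = v a * word_val u L"
    using Cons.prems by (intro word_val_commute) auto
  have "word_val (\<lambda>a. u a * v a) L = word_val u L * word_val v L" using Cons by simp
  then show ?case by (simp add: mult.assoc) (simp add: * flip: mult.assoc)
qed simp

lemma word_val_trivial: "(\<And>a. a \<in> set w \<Longrightarrow> \<nu> a = 1) \<Longrightarrow> word_val \<nu> w = 1"
  by (induction w) auto

lemma word_val_delta:
  "distinct L \<Longrightarrow> j \<in> set L \<Longrightarrow> word_val (\<lambda>i. if i = j then c else 1) L = c"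
proof (induction L)
  case (Cons a L)
  show ?case
  proof (cases "a = j")
    case True
    then have "word_val (\<lambda>i. if i = j then c else 1) L = 1"
      using Cons.prems by (intro word_val_trivial) auto
    then show ?thesis using True by simp
  qed (use Cons in auto)
qed simp

section \<open>Order-preserving partial injections of a chain\<close>

text \<open>W with \<open>s a\<close> for x_{k-a} and D for x_0. The reversal makes
  \<open>s a\<close> start at a and turns the increasing runs of letters in W into descending
  products. \<open>s_reg\<close> and \<open>D_reg\<close> say that the runs around the cycle of
  letters are generalized inverses.\<close>

locale poi_monoid =
  fixes k :: nat and D :: "'a::monoid_mult" and s :: "nat \<Rightarrow> 'a"
  assumes k2: "k \<ge> 2"
    and sD: "1 \<le> a \<Longrightarrow> Suc a < k \<Longrightarrow> s (Suc a) * D = D * s a"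
    and s_comm: "1 \<le> a \<Longrightarrow> a + 2 \<le> b \<Longrightarrow> b < k \<Longrightarrow> s a * s b = s b * s a"
    and DD_s: "D * D * s (k - 1) = D * D"
    and s_DD: "s 1 * (D * D) = D * D"
    and s_up: "1 \<le> a \<Longrightarrow> Suc a < k \<Longrightarrow> s a * s (Suc a) * s a = s a * s (Suc a)"
    and s_down: "1 \<le> a \<Longrightarrow> Suc a < k \<Longrightarrow> s (Suc a) * s a * s (Suc a) = s a * s (Suc a)"
    and s_reg: "1 \<le> a \<Longrightarrow> a < k \<Longrightarrow> s a * (desc s a 1 * D * desc s k (Suc a)) * s a = s a"
    and D_reg: "D * desc s k 1 * D = D"
    and s_sq: "1 \<le> a \<Longrightarrow> a < k \<Longrightarrow> desc s a 1 * D * desc s k (Suc a) * (s a * s a) = s a * s a"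
begin

text \<open>Both sides of the braid relation equal \<open>s a * s (Suc a)\<close>.\<close>

sublocale braid_monoid s 1 k
  using s_comm by unfold_locales (simp_all add: s_up s_down)

text \<open>As a map: a+1 goes to a, the point a is dropped, and all others stay.\<close>

definition z :: "nat \<Rightarrow> 'a" where "z a = desc s a 1 * D * desc s k (Suc a)"

text \<open>As a map: the first run drops j and raises the points below it by one, D lowers
  everything again, and the second run restores the points above j.\<close>

definition f :: "nat \<Rightarrow> 'a" where "f j = desc s j 1 * D * desc s k j"

lemma z_s: "a < k \<Longrightarrow> z a * s a = f a"
  by (simp add: z_def f_def desc_rec mult.assoc)

lemma s_z: "1 \<le> a \<Longrightarrow> s a * z a = f (Suc a)"
  by (simp add: z_def f_def desc_Suc mult.assoc)

lemma f_s: "1 \<le> a \<Longrightarrow> a < k \<Longrightarrow> f (Suc a) * s a = s a"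
  using s_reg[of a, folded z_def] s_z[of a] by simp

lemma s_f: "1 \<le> a \<Longrightarrow> a < k \<Longrightarrow> s a * f a = s a"
  using s_reg[of a, folded z_def] z_s[of a] by (simp add: mult.assoc)

lemma f_s_sq: "1 \<le> a \<Longrightarrow> a < k \<Longrightarrow> f a * s a = s a * s a"
  using s_sq[of a, folded z_def] z_s[of a] by (simp flip: mult.assoc)

lemma f_1: "f 1 = D * desc s k 1"
  by (simp add: f_def)

lemma f_k: "f k = desc s k 1 * D"
  by (simp add: f_def)

lemma f1_D: "f 1 * D = D"
  using D_reg unfolding f_1 .

lemma D_fk: "D * f k = D"
  using D_reg by (simp add: f_k mult.assoc)

lemma f_idem: assumes "1 \<le> j" "j \<le> k" shows "f j * f j = f j"
\<comment> \<open>For j > 1 the idempotent factors as \<open>s (j - 1) * z (j - 1)\<close>; for j =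
  1 there is no such letter, and \<open>D_reg\<close> takes over.\<close>
proof (cases "j = 1")
  case True
  then show ?thesis using f1_D f_1 by (metis mult.assoc)
next
  case False
  then obtain a where a: "j = Suc a" "1 \<le> a" "a < k" using assms by (cases j) auto
  have "f j * f j = f (Suc a) * s a * z a" using a by (simp add: s_z mult.assoc)
  then show ?thesis using a by (simp add: f_s s_z)
qed

lemma f_z: assumes "1 \<le> a" "a < k" shows "f a * z a = z a"
proof (cases "a = 1")
  case True
  then show ?thesis using f1_D by (simp add: z_def) (metis mult.assoc)
next
  case False
  then obtain b where b: "a = Suc b" "1 \<le> b" "b < k" using assms by (cases a) auto
  have "z a = s b * (desc s b 1 * D * desc s k (Suc a))" using b by (simp add: z_def desc_Suc mult.assoc)
  then show ?thesis using f_s[OF b(2,3)] b(1) by (simp flip: mult.assoc)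
qed

lemma z_f: assumes "1 \<le> a" "a < k" shows "z a * f (Suc a) = z a"
proof (cases "Suc a = k")
  case True
  then have "z a * f (Suc a) = desc s a 1 * (D * f k)" by (simp add: z_def mult.assoc)
  then show ?thesis using True by (simp add: D_fk) (simp add: z_def)
next
  case False
  then have *: "desc s k (Suc a) = desc s k (Suc (Suc a)) * s (Suc a)" using assms by (intro desc_rec) auto
  then show ?thesis using s_f[of "Suc a"] False assms unfolding z_def * by (simp add: mult.assoc)
qed

text \<open>Each letter loses one from its index when it crosses D.\<close>

lemma desc_D: "1 \<le> r \<Longrightarrow> n < k \<Longrightarrow> desc s (Suc n) (Suc r) * D = D * desc s n r"
proof (induction n)
  case (Suc n)
  show ?case
  proof (cases "r \<le> n")
    case True
    then have "desc s (Suc (Suc n)) (Suc r) * D = s (Suc n) * (D * desc s n r)"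
      using Suc by (simp add: desc_Suc mult.assoc)
    also have "\<dots> = D * desc s (Suc n) r"
      using True Suc.prems sD[of n] by (simp add: desc_Suc flip: mult.assoc)
    finally show ?thesis .
  qed (use Suc.prems in simp)
qed simp

text \<open>On its way through \<open>f j\<close> the letter changes its index twice, once at D and
  once, in the opposite direction, at the run that it does not commute with
  (\<open>desc_slide\<close>).\<close>

lemma s_f_comm:
  assumes "1 \<le> b" "b < k" "1 \<le> j" "j \<le> k" "j \<noteq> b" "j \<noteq> Suc b"
  shows "s b * f j = f j * s b"
proof (cases "j < b")
  case True
  then have b: "b = Suc (b - 1)" "1 \<le> b - 1" using assms by auto
  have c: "s b * desc s j 1 = desc s j 1 * s b"
    using assms True by (intro desc_commute[symmetric] comm') auto
  have "s b * f j = desc s j 1 * (s b * D) * desc s k j"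
    unfolding f_def using c by (simp flip: mult.assoc)
  also have "s b * D = D * s (b - 1)" using sD[OF b(2)] b assms by simp
  also have "desc s j 1 * (D * s (b - 1)) * desc s k j = desc s j 1 * D * (desc s k j * s b)"
    using desc_slide[of j b k] assms True by (simp add: mult.assoc)
  finally show ?thesis by (simp add: f_def mult.assoc)
next
  case False
  then have bj: "Suc b < j" using assms by auto
  have c: "desc s k j * s b = s b * desc s k j"
    using assms bj by (intro desc_commute comm') auto
  have "f j * s b = desc s j 1 * (D * s b) * desc s k j"
    unfolding f_def using c by (simp add: mult.assoc)
  also have "D * s b = s (Suc b) * D" using sD[of b] assms bj by simp
  also have "desc s j 1 * (s (Suc b) * D) * desc s k j = s b * desc s j 1 * D * desc s k j"
    using desc_slide[of 1 "Suc b" j] assms bj by (simp flip: mult.assoc)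
  finally show ?thesis by (simp add: f_def mult.assoc)
qed

lemma s_z_comm:
  assumes "1 \<le> b" "b + 2 \<le> a" "a < k"
  shows "s a * z b = z b * s a"
proof -
  have a: "a = Suc (a - 1)" "1 \<le> a - 1" using assms by auto
  have c: "s a * desc s b 1 = desc s b 1 * s a"
    using assms by (intro desc_commute[symmetric] comm') auto
  have "s a * z b = desc s b 1 * (s a * D) * desc s k (Suc b)"
    unfolding z_def using c by (simp flip: mult.assoc)
  also have "s a * D = D * s (a - 1)" using sD[OF a(2)] a assms by simp
  also have "desc s b 1 * (D * s (a - 1)) * desc s k (Suc b) = desc s b 1 * D * (desc s k (Suc b) * s a)"
    using desc_slide[of "Suc b" a k] assms by (simp add: mult.assoc)
  finally show ?thesis by (simp add: z_def mult.assoc)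
qed

text \<open>\<open>D * D\<close> absorbs the last letter s_{k-1} on its right and the first letter
  s_1 on its left, so a letter can be deleted from one run and inserted into the other.\<close>

lemma D_f: assumes "1 \<le> j" "j < k" shows "D * f j = f (Suc j) * D"
proof -
  obtain q where k: "k = Suc q" "1 \<le> q" "j \<le> q" using k2 assms by (cases k) auto
  have dq: "desc s k j = s q * desc s q j" using k by (simp add: desc_Suc)
  have "D * f j = desc s (Suc j) 2 * D * D * s q * desc s q j"
    using desc_D[of 1 j] assms by (simp add: f_def dq mult.assoc numeral_2_eq_2)
  also have "\<dots> = desc s (Suc j) 2 * (D * D) * desc s q j"
    using DD_s k by (simp add: mult.assoc)
  also have "\<dots> = desc s (Suc j) 2 * s 1 * (D * D) * desc s q j"
    using s_DD by (simp add: mult.assoc)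
  also have "desc s (Suc j) 2 * s 1 = desc s (Suc j) 1"
    using desc_rec[of 1 "Suc j" s] assms by (simp add: numeral_2_eq_2)
  also have "desc s (Suc j) 1 * (D * D) * desc s q j = desc s (Suc j) 1 * D * (desc s k (Suc j) * D)"
    using desc_D[of j q] assms k by (simp add: mult.assoc)
  finally show ?thesis by (simp add: f_def mult.assoc)
qed

lemma desc_f_comm:
  assumes "1 \<le> j" "j \<le> k" "1 \<le> r" "n \<le> k" "n < j \<or> j < r"
  shows "desc s n r * f j = f j * desc s n r"
  using assms by (intro desc_commute s_f_comm) auto

text \<open>After \<open>f_s_sq\<close> an idempotent \<open>f a\<close> stands inside the word; it
  travels left, becomes \<open>f (Suc a)\<close> at D and leaves at the front, and the letters left
  behind form \<open>f a\<close> again.\<close>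

lemma s_sq_f: assumes "1 \<le> a" "a < k" shows "s a * s a = f (Suc a) * f a"
proof -
  have "s a * s a = desc s a 1 * D * desc s k (Suc a) * (f a * s a)"
    using s_sq[OF assms] f_s_sq[OF assms] by simp
  also have "\<dots> = desc s a 1 * (D * f a) * desc s k (Suc a) * s a"
    using desc_f_comm[of a "Suc a" k] assms by (simp add: mult.assoc) (simp flip: mult.assoc)
  also have "\<dots> = f (Suc a) * (desc s a 1 * D * (desc s k (Suc a) * s a))"
    using desc_f_comm[of "Suc a" 1 a] D_f[OF assms] assms
    by (simp add: mult.assoc) (simp flip: mult.assoc)
  also have "desc s k (Suc a) * s a = desc s k a" using desc_rec[of a k s] assms by simp
  finally show ?thesis by (simp add: f_def)
qed

text \<open>Both products \<open>f\<^sub>a f\<^sub>a\<^sub>+\<^sub>1\<close> and \<open>f\<^sub>a\<^sub>+\<^sub>1 f\<^sub>a\<close> equal \<open>z\<^sub>a\<^sup>2\<close>: moving the inner letters across \<open>D\<close> turns it into a word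
  that ends in \<open>s\<^sub>a s\<^sub>a\<^sub>+\<^sub>1\<close>, which absorbs a further \<open>s\<^sub>a\<close>.\<close>

lemma f_adj:
  assumes "1 \<le> a" "a < k"
  shows f_adj_comm: "f a * f (Suc a) = f (Suc a) * f a" and z_sq: "z a * z a = f a * f (Suc a)"
proof -
  obtain q where k: "k = Suc q" "1 \<le> q" "a \<le> q" using k2 assms by (cases k) auto
  define P where "P = desc s a 1 * (desc s (Suc a) 2 * (D * D))"
  have Da: "D * desc s a 1 = desc s (Suc a) 2 * D"
    using desc_D[of 1 a] assms by (simp add: numeral_2_eq_2)
  have DDs: "D * D * desc s k a = D * D * desc s q a"
  proof -
    have "desc s k a = s q * desc s q a" using k by (simp add: desc_Suc)
    then show ?thesis using DD_s k by (simp flip: mult.assoc)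
  qed
  have "f (Suc a) * f a = desc s a 1 * D * desc s k (Suc a) * (f a * s a)"
    using s_sq[OF assms] f_s_sq[OF assms] s_sq_f[OF assms] by simp
  also have "\<dots> = desc s a 1 * D * (f a * desc s k (Suc a)) * s a"
    using desc_f_comm[of a "Suc a" k] assms by (simp flip: mult.assoc) (simp add: mult.assoc)
  also have "\<dots> = desc s a 1 * (D * desc s a 1) * D * desc s k a * (desc s k (Suc a) * s a)"
    by (simp add: f_def mult.assoc)
  also have "\<dots> = desc s a 1 * desc s (Suc a) 2 * (D * D * desc s k a) * (desc s k (Suc a) * s a)"
    unfolding Da by (simp add: mult.assoc)
  also have "\<dots> = P * desc s q a * desc s k (Suc a) * s a"
    unfolding DDs by (simp add: P_def mult.assoc)
  finally have ff: "f (Suc a) * f a = P * desc s q a * desc s k (Suc a) * s a" .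
  have "z a * z a = desc s a 1 * D * (desc s k (Suc a) * desc s a 1) * D * desc s k (Suc a)"
    by (simp add: z_def mult.assoc)
  also have "desc s k (Suc a) * desc s a 1 = desc s a 1 * desc s k (Suc a)"
    using assms by (intro desc_commute desc_commute[symmetric] comm') auto
  also have "desc s a 1 * D * (desc s a 1 * desc s k (Suc a)) * D * desc s k (Suc a)
      = desc s a 1 * (D * desc s a 1) * (desc s k (Suc a) * D) * desc s k (Suc a)"
    by (simp add: mult.assoc)
  also have "desc s k (Suc a) * D = D * desc s q a"
    using desc_D[of a q] assms k by simp
  also have "desc s a 1 * (D * desc s a 1) * (D * desc s q a) * desc s k (Suc a)
      = P * desc s q a * desc s k (Suc a)"
    unfolding Da by (simp add: P_def mult.assoc)
  finally have zz: "z a * z a = P * desc s q a * desc s k (Suc a)" .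
  have absorb: "P * desc s q a * desc s k (Suc a) * s a = P * desc s q a * desc s k (Suc a)"
  proof (cases "a = q")
    case True
    then show ?thesis using DD_s k by (simp add: P_def mult.assoc)
  next
    case False
    have c: "s a * desc s k (Suc (Suc a)) = desc s k (Suc (Suc a)) * s a"
      using assms by (intro desc_commute[symmetric] comm') auto
    have "desc s q a * desc s k (Suc a) = desc s q (Suc a) * (s a * desc s k (Suc (Suc a))) * s (Suc a)"
      using False k desc_rec[of a q s] desc_rec[of "Suc a" k s] by (simp add: mult.assoc)
    then have X: "desc s q a * desc s k (Suc a)
        = desc s q (Suc a) * desc s k (Suc (Suc a)) * (s a * s (Suc a))"
      unfolding c by (simp add: mult.assoc)
    then have "desc s q a * desc s k (Suc a) * s a
        = desc s q (Suc a) * desc s k (Suc (Suc a)) * (s a * s (Suc a) * s a)"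
      by (simp add: mult.assoc)
    also have "s a * s (Suc a) * s a = s a * s (Suc a)" using s_up[of a] False k assms by simp
    finally show ?thesis using X by (simp add: mult.assoc)
  qed
  \<comment> \<open>In \<open>s a * s a = f (Suc a) * f a\<close> each idempotent stands next to the
    \<open>z a\<close> that absorbs it.\<close>
  have "f a * f (Suc a) = z a * (s a * s a) * z a"
    using z_s s_z assms by (simp add: mult.assoc) (simp flip: mult.assoc)
  also have "\<dots> = (z a * f (Suc a)) * (f a * z a)"
    unfolding s_sq_f[OF assms] by (simp add: mult.assoc)
  also have "\<dots> = z a * z a" using z_f f_z assms by simp
  finally show "z a * z a = f a * f (Suc a)" ..
  then show "f a * f (Suc a) = f (Suc a) * f a" using ff zz absorb by simp
qed

lemma f_s_adj: assumes "1 \<le> a" "a < k"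
  shows "f a * s a = f a * f (Suc a)" and "s a * f (Suc a) = f a * f (Suc a)"
proof -
  show 1: "f a * s a = f a * f (Suc a)"
    using f_s_sq s_sq_f f_adj_comm assms by simp
  have "s a * f (Suc a) = (s a * s a) * z a" using s_z assms by (simp add: mult.assoc)
  also have "\<dots> = f a * (s a * z a)" using f_s_sq[symmetric] assms by (simp add: mult.assoc)
  finally show "s a * f (Suc a) = f a * f (Suc a)" using s_z assms by simp
qed

text \<open>For i < j the idempotent \<open>f j\<close> travels left through \<open>f i\<close>. At
  the letter \<open>s (j - 1)\<close> it drops to \<open>f (j - 1)\<close>, because both products
  equal \<open>f (j - 1) * f j\<close>, and at D it rises to \<open>f j\<close> again.\<close>

lemma f_comm: assumes "1 \<le> i" "i \<le> k" "1 \<le> j" "j \<le> k" shows "f i * f j = f j * f i"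
proof -
  have less: "f i * f j = f j * f i" if ij: "1 \<le> i" "i < j" "j \<le> k" for i j
  proof -
    obtain h where j: "j = Suc h" "1 \<le> h" "i \<le> h" "h < k" using ij by (cases j) auto
    have c1: "desc s h i * f j = f j * desc s h i"
      using ij j by (intro desc_f_comm) auto
    have c2: "desc s k j * f h = f h * desc s k j"
      using ij j by (intro desc_f_comm) auto
    have c3: "desc s i 1 * f j = f j * desc s i 1"
      using ij j by (intro desc_f_comm) auto
    have c4: "s h * f j = f h * s h" using f_s_adj[of h] j by simp
    have d: "desc s k i = desc s k j * (s h * desc s h i)"
      using desc_split[of i j k s] desc_Suc[of i h s] ij j by simp
    have "desc s k i * f j = desc s k j * (s h * f j) * desc s h i"
      unfolding d using c1 by (simp add: mult.assoc)
    also have "\<dots> = f h * desc s k i"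
      unfolding d c4 using c2 by (simp flip: mult.assoc)
    finally have "desc s k i * f j = f h * desc s k i" .
    then have "f i * f j = desc s i 1 * (D * f h) * desc s k i"
      by (simp add: f_def[of i] mult.assoc)
    also have "D * f h = f j * D" using D_f[of h] j by simp
    also have "desc s i 1 * (f j * D) * desc s k i = f j * f i"
      using c3 by (simp add: f_def[of i] flip: mult.assoc)
    finally show ?thesis .
  qed
  consider "i < j" | "j < i" | "i = j" by linarith
  then show ?thesis using less[of i j] less[of j i] assms by cases auto
qed

lemma z_f_adj: assumes "1 \<le> a" "a < k"
  shows "f (Suc a) * z a = f a * f (Suc a)" and "z a * f a = f a * f (Suc a)"
proof -
  have "f (Suc a) * z a = s a * (z a * z a)" using s_z assms by (simp flip: mult.assoc)
  also have "\<dots> = s a * f a * f (Suc a)" unfolding z_sq[OF assms] by (simp add: mult.assoc)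
  also have "\<dots> = f a * f (Suc a)" using s_f f_s_adj assms by simp
  finally show "f (Suc a) * z a = f a * f (Suc a)" .
  have "z a * f a = (z a * z a) * s a" using z_s assms by (simp add: mult.assoc)
  also have "\<dots> = f a * (f (Suc a) * s a)" unfolding z_sq[OF assms] by (simp add: mult.assoc)
  finally show "z a * f a = f a * f (Suc a)" using f_s f_s_adj assms by simp
qed

text \<open>Writing \<open>z a\<close> as \<open>z a * s a * z a\<close> brings in the letter
  \<open>s a\<close>, through which \<open>f j\<close> passes; the rest is a computation with
  commuting idempotents.\<close>

lemma z_f_comm:
  assumes "1 \<le> a" "a < k" "1 \<le> j" "j \<le> k" "j \<noteq> a" "j \<noteq> Suc a"
  shows "z a * f j = f j * z a"
proof -
  have "z a * f j = z a * (f (Suc a) * f j)" using z_f assms by (simp flip: mult.assoc)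
  also have "f (Suc a) * f j = f j * (s a * z a)" using f_comm[of "Suc a" j] s_z assms by simp
  also have "z a * (f j * (s a * z a)) = z a * s a * f j * z a"
    using s_f_comm[of a j] assms by (simp add: mult.assoc)
  also have "\<dots> = f j * (f a * z a)"
    using z_s f_comm[of a j] assms by (simp add: mult.assoc)
  finally show ?thesis using f_z assms by simp
qed

text \<open>The new factor completes the run after D to a full one, enclosed by two letters D, and
  \<open>D_reg\<close> removes it. For j = k-1 this expresses D by the \<open>z a\<close>, which is
  how D is tracked later.\<close>

lemma D_z_prod: "1 \<le> j \<Longrightarrow> j < k \<Longrightarrow> word_val z [1..<Suc j] = D * desc s k (Suc j)"
proof (induction j rule: dec_induct)
  case base
  then show ?case by (simp add: z_def)
next
  case (step j)
  then have "word_val z [1..<Suc (Suc j)] = D * desc s k (Suc j) * z (Suc j)"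
    by (subst upt_Suc_append) (auto simp flip: mult.assoc)
  also have "\<dots> = D * (desc s k (Suc j) * desc s (Suc j) 1) * D * desc s k (Suc (Suc j))"
    by (simp add: z_def mult.assoc)
  also have "desc s k (Suc j) * desc s (Suc j) 1 = desc s k 1"
    using desc_split[of 1 "Suc j" k s] step by simp
  finally show ?case using D_reg by simp
qed

lemma D_eq: "D = word_val z [1..<k]"
  using D_z_prod[of "k - 1"] k2 by simp

end

section \<open>Partial maps of the chain and configurations of particles\<close>

definition pre :: "('a \<rightharpoonup> 'b) \<Rightarrow> 'b set \<Rightarrow> 'a set" where "pre p B = {b. \<exists>c\<in>B. p b = Some c}"

definition img :: "('a \<rightharpoonup> 'b) \<Rightarrow> 'a set \<Rightarrow> 'b set" where "img p A = {c. \<exists>b\<in>A. p b = Some c}"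

lemma img_fixed: "(\<And>b. b \<in> A \<Longrightarrow> p b = Some b) \<Longrightarrow> img p A = A"
  by (auto simp: img_def)

lemma img_move: "a \<in> A \<Longrightarrow> p a = Some c \<Longrightarrow> img p A = insert c (img p (A - {a}))"
  by (auto simp: img_def)

text \<open>\<open>up\<close> and \<open>down\<close> are the maps of \<open>s a\<close> and
  \<open>z a\<close>; \<open>shift k j\<close>, below, is that of z_1 ... z_{j-1}, so that
  \<open>shift k k\<close> belongs to D.\<close>

definition up :: "nat \<Rightarrow> nat \<Rightarrow> nat \<rightharpoonup> nat" where
  "up k a b = (if b = a then Some (Suc a) else if b = Suc a \<or> b \<notin> {1..k} then None else Some b)"

definition down :: "nat \<Rightarrow> nat \<Rightarrow> nat \<rightharpoonup> nat" where
  "down k a b = (if b = Suc a then Some a else if b = a \<or> b \<notin> {1..k} then None else Some b)"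

definition shift :: "nat \<Rightarrow> nat \<Rightarrow> nat \<rightharpoonup> nat" where
  "shift k j b = (if b \<in> {2..j} then Some (b - 1) else if b \<in> {j<..k} then Some b else None)"

context poi_monoid
begin

text \<open>The partial identity with domain A, built from the idempotents of the missing
  points.\<close>

definition eps :: "nat set \<Rightarrow> 'a" where
  "eps A = word_val (\<lambda>j. if j \<in> A then 1 else f j) [1..<Suc k]"

lemma eps_cong: assumes "A \<inter> {1..k} = B \<inter> {1..k}" shows "eps A = eps B"
  unfolding eps_def
proof (rule word_val_cong)
  fix a assume "a \<in> set [1..<Suc k]"
  then have "a \<in> {1..k}" by auto
  then have "a \<in> A \<longleftrightarrow> a \<in> B" using assms by blast
  then show "(if a \<in> A then 1 else f a) = (if a \<in> B then 1 else f a)" by simp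
qed

lemma eps_mult: "eps A * eps B = eps (A \<inter> B)"
proof -
  have "eps A * eps B = word_val (\<lambda>j. (if j \<in> A then 1 else f j) * (if j \<in> B then 1 else f j)) [1..<Suc k]"
    unfolding eps_def by (rule word_val_mult[symmetric]) (auto intro: f_comm)
  also have "\<dots> = eps (A \<inter> B)"
    unfolding eps_def by (rule word_val_cong) (auto simp: f_idem)
  finally show ?thesis .
qed

lemma eps_single:
  assumes "j \<in> {1..k}"
  shows "eps (- {j}) = f j"
proof -
  have "eps (- {j}) = word_val (\<lambda>i. if i = j then f j else 1) [1..<Suc k]"
    unfolding eps_def by (rule word_val_cong) auto
  also have "\<dots> = f j" using assms by (intro word_val_delta) auto
  finally show ?thesis .
qed

lemma eps_f: "j \<in> {1..k} \<Longrightarrow> eps A * f j = eps (A - {j})"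
  using eps_mult[of A "- {j}"] by (simp add: eps_single Diff_eq)

lemma eps_absorb: "j \<in> {1..k} \<Longrightarrow> j \<notin> A \<Longrightarrow> eps A * (f j * x) = eps A * x"
  using eps_f[of j A] by (simp flip: mult.assoc)

lemma eps_minus: assumes "x \<in> {1..k}" shows "eps ({1..k} - {x}) = f x"
proof -
  have "({1..k} - {x}) \<inter> {1..k} = - {x} \<inter> {1..k}" by auto
  then show ?thesis using eps_cong eps_single[OF assms] by metis
qed

lemma eps_minus2:
  assumes "x \<in> {1..k}" "y \<in> {1..k}"
  shows "eps ({1..k} - {x, y}) = f x * f y"
proof -
  have "{1..k} - {x, y} = {1..k} - {x} - {y}" by auto
  then show ?thesis using eps_f[OF assms(2)] eps_minus[OF assms(1)] by metis
qed

lemmas eps_minus_simps = eps_minus[simplified] eps_minus2[simplified]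

definition rank :: "nat set \<Rightarrow> nat \<Rightarrow> nat" where "rank A a = card (A \<inter> {1..a})"

text \<open>The word \<open>settle A\<close> moves the points of \<open>A\<close>, the lowest first, down to the initial segment
  of the same size.\<close>

definition settle :: "nat set \<Rightarrow> 'a" where
  "settle A = word_val (\<lambda>a. if a \<in> A then desc z a (rank A a) else 1) [1..<Suc k]"

text \<open>Raising a particle to a free place changes no rank, so \<open>settle\<close> changes
  only in the factor of that particle, by one more leading \<open>z a\<close>. The letter
  \<open>s a\<close> passes the factors of the lower particles and meets this \<open>z a\<close>;
  their product \<open>f (Suc a)\<close> is absorbed by \<open>eps A\<close>.\<close>

lemma settle_up:
  assumes a: "1 \<le> a" "a < k" "a \<in> A" "Suc a \<notin> A"
  shows "eps A * s a * settle (insert (Suc a) (A - {a})) = eps A * settle A"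
proof -
  let ?B = "insert (Suc a) (A - {a})"
  let ?u = "\<lambda>A c. if c \<in> A then desc z c (rank A c) else 1"
  have L: "[1..<Suc k] = [1..<a] @ [a, Suc a] @ [Suc (Suc a)..<Suc k]"
  proof -
    have "[1..<Suc k] = [1..<a] @ [a..<Suc k]"
      using a upt_add_eq_append[of 1 a "Suc k - a"] by simp
    also have "[a..<Suc k] = [a, Suc a] @ [Suc (Suc a)..<Suc k]"
      using a by (simp add: upt_conv_Cons del: upt_Suc)
    finally show ?thesis .
  qed
  have lo: "rank ?B c = rank A c" if "c < a" for c
    using that unfolding rank_def by (intro arg_cong[where f = card]) auto
  have hi: "rank ?B c = rank A c" if "Suc a < c" for c
  proof -
    have "?B \<inter> {1..c} = insert (Suc a) (A \<inter> {1..c} - {a})" using that a by auto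
    moreover have "card (insert (Suc a) (A \<inter> {1..c} - {a})) = Suc (card (A \<inter> {1..c} - {a}))"
      using a by (intro card_insert_disjoint) auto
    moreover have "Suc (card (A \<inter> {1..c} - {a})) = card (A \<inter> {1..c})"
      using a that by (intro card.remove[symmetric]) auto
    ultimately show ?thesis by (simp add: rank_def)
  qed
  have mid: "rank ?B (Suc a) = rank A a"
  proof -
    have "?B \<inter> {1..Suc a} = insert (Suc a) (A \<inter> {1..a} - {a})" using a by auto
    moreover have "card (insert (Suc a) (A \<inter> {1..a} - {a})) = Suc (card (A \<inter> {1..a} - {a}))"
      using a by (intro card_insert_disjoint) auto
    moreover have "Suc (card (A \<inter> {1..a} - {a})) = card (A \<inter> {1..a})"
      using a by (intro card.remove[symmetric]) auto
    ultimately show ?thesis by (simp add: rank_def)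
  qed
  have "rank A a \<le> a" unfolding rank_def using card_mono[of "{1..a}" "A \<inter> {1..a}"] by simp
  then have dz: "desc z (Suc a) (rank A a) = z a * desc z a (rank A a)" by (rule desc_Suc)
  define P where "P = word_val (?u A) [1..<a]"
  define Q where "Q = word_val (?u A) [Suc (Suc a)..<Suc k]"
  have TA: "settle A = P * desc z a (rank A a) * Q"
    unfolding settle_def L P_def Q_def using a by (simp add: mult.assoc)
  have "word_val (?u ?B) [1..<a] = P"
    unfolding P_def by (rule word_val_cong) (auto simp: lo)
  moreover have "word_val (?u ?B) [Suc (Suc a)..<Suc k] = Q"
    unfolding Q_def by (rule word_val_cong) (auto simp: hi)
  ultimately have TB: "settle ?B = P * (z a * desc z a (rank A a)) * Q"
    unfolding settle_def L using a by (simp add: mult.assoc mid dz)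
  have r1: "1 \<le> rank A c" if "c \<in> A" "1 \<le> c" for c
    using that card_gt_0_iff[of "A \<inter> {1..c}"] by (auto simp: rank_def Suc_le_eq)
  \<comment> \<open>A particle at c < a uses only letters \<open>z b\<close> with b < c, so all
    indices in P are at most a-2.\<close>
  have comm: "P * x = x * P" if "\<And>b. 1 \<le> b \<Longrightarrow> b + 2 \<le> a \<Longrightarrow> z b * x = x * z b" for x
    unfolding P_def
  proof (rule word_val_commute)
    fix c assume c: "c \<in> set [1..<a]"
    show "?u A c * x = x * ?u A c"
    proof (cases "c \<in> A")
      case True
      then have "desc z c (rank A c) * x = x * desc z c (rank A c)"
        using c r1[of c] by (intro desc_commute that) auto
      then show ?thesis using True by simp
    qed simp
  qed
  have sP: "P * s a = s a * P" using a by (intro comm s_z_comm[symmetric]) auto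
  have fP: "P * f (Suc a) = f (Suc a) * P" using a by (intro comm z_f_comm) auto
  have "s a * settle ?B = P * (s a * z a) * desc z a (rank A a) * Q"
    unfolding TB using sP by (simp flip: mult.assoc)
  also have "\<dots> = f (Suc a) * settle A"
    unfolding TA s_z[OF a(1)] using fP by (simp flip: mult.assoc)
  finally have "eps A * (s a * settle ?B) = eps A * settle A"
    using eps_absorb[of "Suc a" A] a by simp
  then show ?thesis by (simp add: mult.assoc)
qed

text \<open>The invariant under which y behaves like p: it transports partial identities along p,
  and following y by the settling of the image configuration amounts to settling at once. This is
  preserved by products and determines y from p.\<close>

definition track :: "'a \<Rightarrow> (nat \<rightharpoonup> nat) \<Rightarrow> bool" where
  "track y p \<longleftrightarrow> dom p \<subseteq> {1..k} \<and> ran p \<subseteq> {1..k} \<and>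
     (\<forall>B. y * eps B = eps (pre p B) * y) \<and>
     (\<forall>A\<subseteq>dom p. eps A * y * settle (img p A) = eps A * settle A)"

text \<open>\<open>eps B\<close> is a product of idempotents \<open>f j\<close> and preimages
  respect intersections, so the single \<open>f j\<close> suffice;
  \<open>eps (dom p) * y = y\<close> is the case of the empty product.\<close>

lemma track_preI:
  assumes p: "dom p \<subseteq> {1..k}" "ran p \<subseteq> {1..k}"
    and y: "eps (dom p) * y = y" and f: "\<And>j. j \<in> {1..k} \<Longrightarrow> y * f j = eps (pre p (- {j})) * y"
  shows "y * eps B = eps (pre p B) * y"
proof -
  have "y * word_val (\<lambda>j. if j \<in> B then 1 else f j) L = eps (pre p (B \<union> - set L)) * y"
    if "set L \<subseteq> {1..k}" for L
    using that
  proof (induction L)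
    case Nil
    have "pre p UNIV = dom p" by (auto simp: pre_def)
    then show ?case using y by simp
  next
    case (Cons j L)
    show ?case
    proof (cases "j \<in> B")
      case True
      then have "B \<union> - set (j # L) = B \<union> - set L" by auto
      then show ?thesis using Cons True by simp
    next
      case False
      then have S: "B \<union> - set (j # L) = - {j} \<inter> (B \<union> - set L)" by auto
      have "pre p (B \<union> - set (j # L)) = pre p (- {j}) \<inter> pre p (B \<union> - set L)"
        unfolding S by (auto simp: pre_def)
      then have e: "eps (pre p (B \<union> - set (j # L))) = eps (pre p (- {j})) * eps (pre p (B \<union> - set L))"
        by (simp only: eps_mult)
      let ?w = "word_val (\<lambda>j. if j \<in> B then 1 else f j)"
      have "y * ?w (j # L) = y * f j * ?w L" using False by (simp add: mult.assoc)
      also have "y * f j = eps (pre p (- {j})) * y" using f Cons.prems by simp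
      also have "\<dots> * ?w L = eps (pre p (- {j})) * (y * ?w L)" by (simp add: mult.assoc)
      also have "y * ?w L = eps (pre p (B \<union> - set L)) * y" using Cons by simp
      finally show ?thesis unfolding e by (simp only: mult.assoc)
    qed
  qed
  note * = this
  have L: "set [1..<Suc k] = {1..k}" by auto
  have "y * eps B = eps (pre p (B \<union> - {1..k})) * y"
    unfolding eps_def[of B] using *[of "[1..<Suc k]"] by (simp only: L subset_refl)
  moreover have "pre p (B \<union> - {1..k}) = pre p B" using p(2) by (auto simp: pre_def ran_def)
  ultimately show ?thesis by simp
qed

lemma track_mult:
  assumes "track y p" "track y' p'"
  shows "track (y * y') (p' \<circ>\<^sub>m p)"
  unfolding track_def
proof (intro conjI allI impI)
  have pp: "dom (p' \<circ>\<^sub>m p) \<subseteq> dom p" "ran (p' \<circ>\<^sub>m p) \<subseteq> ran p'"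
    by (auto simp: ran_def map_comp_Some_iff)
  then show "dom (p' \<circ>\<^sub>m p) \<subseteq> {1..k}" "ran (p' \<circ>\<^sub>m p) \<subseteq> {1..k}"
    using assms by (auto simp: track_def)
  have [simp]: "pre (p' \<circ>\<^sub>m p) B = pre p (pre p' B)" "img (p' \<circ>\<^sub>m p) B = img p' (img p B)" for B
    by (auto simp: pre_def img_def map_comp_Some_iff)
  show "y * y' * eps B = eps (pre (p' \<circ>\<^sub>m p) B) * (y * y')" for B
    using assms by (simp add: track_def mult.assoc) (simp flip: mult.assoc)
  fix A assume A: "A \<subseteq> dom (p' \<circ>\<^sub>m p)"
  let ?B = "img p A"
  have AB: "A \<subseteq> dom p" "?B \<subseteq> dom p'"
    using A by (auto simp: img_def map_comp_def subset_iff dom_def split: option.splits)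
  then have A_pre: "A \<inter> pre p ?B = A" by (fastforce simp: img_def pre_def)
  \<comment> \<open>As A lies in the preimage of its image, \<open>eps ?B\<close> can be produced
    behind y, where the settling equation of y' requires it.\<close>
  have "eps A * y = eps A * (eps (pre p ?B) * y)"
    using eps_mult[of A "pre p ?B"] A_pre by (simp flip: mult.assoc)
  also have "eps (pre p ?B) * y = y * eps ?B" using assms(1) by (simp add: track_def)
  finally have 1: "eps A * y = eps A * y * eps ?B" unfolding mult.assoc .
  have 2: "eps ?B * y' * settle (img p' ?B) = eps ?B * settle ?B"
    and 3: "eps A * y * settle ?B = eps A * settle A"
    using assms AB by (auto simp: track_def)
  have "eps A * (y * y') * settle (img (p' \<circ>\<^sub>m p) A) = eps A * y * (eps ?B * y' * settle (img p' ?B))"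
    by (simp add: 1[symmetric] flip: mult.assoc)
  also have "\<dots> = eps A * y * settle ?B" unfolding 2 by (simp add: 1[symmetric] flip: mult.assoc)
  finally show "eps A * (y * y') * settle (img (p' \<circ>\<^sub>m p) A) = eps A * settle A" using 3 by simp
qed

lemma eps_all: "{1..k} \<subseteq> A \<Longrightarrow> eps A = 1"
  unfolding eps_def by (rule word_val_trivial) (auto simp: subset_iff)

lemma track_one: "track 1 (Some |` {1..k})"
  unfolding track_def
proof (intro conjI allI impI)
  show d: "dom (Some |` {1..k}) \<subseteq> {1..k}" and "ran (Some |` {1..k}) \<subseteq> {1..k}"
    by (auto simp: restrict_map_def ran_def split: if_splits)
  have "eps (pre (Some |` {1..k}) B) = eps B" for B
    by (rule eps_cong) (auto simp: pre_def restrict_map_def)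
  then show "1 * eps B = eps (pre (Some |` {1..k}) B) * 1" for B by simp
  fix A assume "A \<subseteq> dom (Some |` {1..k})"
  then have "img (Some |` {1..k}) A = A" using d by (intro img_fixed) auto
  then show "eps A * 1 * settle (img (Some |` {1..k}) A) = eps A * settle A" by simp
qed

lemma track_s:
  assumes a: "1 \<le> a" "a < k"
  shows "track (s a) (up k a)"
proof -
  have d: "dom (up k a) = {1..k} - {Suc a}" and r: "ran (up k a) \<subseteq> {1..k}"
    using a by (auto simp: up_def dom_def ran_def split: if_splits)
  have Pre: "pre (up k a) (- {a}) = {1..k} - {Suc a}"
    "pre (up k a) (- {Suc a}) = {1..k} - {a, Suc a}"
    "\<And>j. j \<noteq> a \<Longrightarrow> j \<noteq> Suc a \<Longrightarrow> pre (up k a) (- {j}) = {1..k} - {j, Suc a}"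
    using a by (auto simp: pre_def up_def split: if_splits)
  have fs: "f a * f (Suc a) * s a = f a * f (Suc a)"
    using f_s f_s_adj a by (simp add: mult.assoc)
  have "s a * eps B = eps (pre (up k a) B) * s a" for B
  proof (rule track_preI)
    show "eps (dom (up k a)) * s a = s a" using a by (simp add: d eps_minus_simps f_s)
    fix j assume j: "j \<in> {1..k}"
    consider "j = a" | "j = Suc a" | "j \<noteq> a" "j \<noteq> Suc a" by blast
    then show "s a * f j = eps (pre (up k a) (- {j})) * s a"
    proof cases
      case 1
      then show ?thesis using a by (simp add: Pre eps_minus_simps f_s s_f)
    next
      case 2
      then show ?thesis using a by (simp add: Pre eps_minus_simps fs f_s_adj)
    next
      case 3
      then show ?thesis using a j by (simp add: Pre eps_minus_simps mult.assoc f_s s_f_comm)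
    qed
  qed (use d r in auto)
  moreover have "eps A * s a * settle (img (up k a) A) = eps A * settle A" if A: "A \<subseteq> dom (up k a)" for A
  proof (cases "a \<in> A")
    case True
    have "img (up k a) (A - {a}) = A - {a}"
      using A unfolding d by (intro img_fixed) (auto simp: up_def)
    then have "img (up k a) A = insert (Suc a) (A - {a})"
      using img_move[OF True, of "up k a" "Suc a"] by (simp add: up_def)
    then show ?thesis using settle_up[OF a True] A d by auto
  next
    case False
    then have i: "img (up k a) A = A"
      using A unfolding d by (intro img_fixed) (auto simp: up_def)
    have na: "Suc a \<notin> A" using A d by auto
    \<comment> \<open>Both places are empty, so \<open>eps A\<close> supplies both idempotents, and
      these absorb the letter.\<close>
    have "eps A * s a = eps A * (f a * (f (Suc a) * s a))"
      using na False a by (simp add: eps_absorb)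
    also have "\<dots> = eps A * (f a * f (Suc a))" using fs by (simp add: mult.assoc)
    also have "\<dots> = eps A" using na False a by (simp add: eps_absorb eps_f)
    finally show ?thesis using i by simp
  qed
  ultimately show ?thesis using d r by (auto simp: track_def)
qed

text \<open>The settling equation for lowering a particle is that of \<open>s a\<close> read
  backwards: from the lowered configuration \<open>settle_up\<close> returns to B, and
  \<open>z a * s a = f a\<close> vanishes because a is not occupied in B.\<close>

lemma track_z:
  assumes a: "1 \<le> a" "a < k"
  shows "track (z a) (down k a)"
proof -
  have d: "dom (down k a) = {1..k} - {a}" and r: "ran (down k a) \<subseteq> {1..k}"
    using a by (auto simp: down_def dom_def ran_def split: if_splits)
  have Pre: "pre (down k a) (- {Suc a}) = {1..k} - {a}"
    "pre (down k a) (- {a}) = {1..k} - {a, Suc a}"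
    "\<And>j. j \<noteq> a \<Longrightarrow> j \<noteq> Suc a \<Longrightarrow> pre (down k a) (- {j}) = {1..k} - {j, a}"
    using a by (auto simp: pre_def down_def split: if_splits)
  have fz: "f a * f (Suc a) * z a = f a * f (Suc a)"
    using f_idem[of a] z_f_adj a by (simp add: mult.assoc) (simp flip: mult.assoc)
  have *: "z a * eps B = eps (pre (down k a) B) * z a" for B
  proof (rule track_preI)
    show "eps (dom (down k a)) * z a = z a" using a by (simp add: d eps_minus_simps f_z)
    fix j assume j: "j \<in> {1..k}"
    consider "j = a" | "j = Suc a" | "j \<noteq> a" "j \<noteq> Suc a" by blast
    then show "z a * f j = eps (pre (down k a) (- {j})) * z a"
    proof cases
      case 1
      then show ?thesis using a by (simp add: Pre eps_minus_simps fz z_f_adj)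
    next
      case 2
      then show ?thesis using a by (simp add: Pre eps_minus_simps f_z z_f)
    next
      case 3
      then show ?thesis using a j by (simp add: Pre eps_minus_simps mult.assoc f_z z_f_comm)
    qed
  qed (use d r in auto)
  moreover have "eps B * z a * settle (img (down k a) B) = eps B * settle B" if B: "B \<subseteq> dom (down k a)" for B
  proof (cases "Suc a \<in> B")
    case True
    let ?A = "insert a (B - {Suc a})"
    have "img (down k a) (B - {Suc a}) = B - {Suc a}"
      using B unfolding d by (intro img_fixed) (auto simp: down_def)
    then have i: "img (down k a) B = ?A"
      using img_move[OF True, of "down k a" a] by (simp add: down_def)
    have p: "pre (down k a) ?A = B"
      using B True a unfolding d by (auto simp: pre_def down_def split: if_splits)
    have BA: "insert (Suc a) (?A - {a}) = B" using B True d by auto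
    have aA: "eps ?A * s a * settle B = eps ?A * settle ?A"
      using settle_up[of a ?A] a BA by auto
    have "eps B * z a * settle ?A = z a * (eps ?A * settle ?A)"
      using *[of ?A] p by (simp flip: mult.assoc)
    also have "\<dots> = eps B * z a * s a * settle B"
      unfolding aA[symmetric] using *[of ?A] p by (simp flip: mult.assoc)
    also have "\<dots> = eps B * (f a * settle B)" using z_s a by (simp add: mult.assoc)
    also have "\<dots> = eps B * settle B" using B d a by (intro eps_absorb) auto
    finally show ?thesis using i by simp
  next
    case False
    then have i: "img (down k a) B = B"
      using B unfolding d by (intro img_fixed) (auto simp: down_def)
    have na: "a \<notin> B" using B d by auto
    have "eps B * z a = eps B * (f a * (f (Suc a) * z a))"
      using na False a by (simp add: eps_absorb)
    also have "\<dots> = eps B * (f a * f (Suc a))" using fz by (simp add: mult.assoc)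
    also have "\<dots> = eps B" using na False a by (simp add: eps_absorb eps_f)
    finally show ?thesis using i by simp
  qed
  ultimately show ?thesis using d r by (auto simp: track_def)
qed

lemma track_D: "track D (shift k k)"
proof -
  have "track (word_val z [1..<j]) (shift k j)" if "2 \<le> j" "j \<le> k" for j
    using that
  proof (induction j rule: dec_induct)
    case base
    have "shift k 2 = down k 1"
      using k2 by (auto simp: fun_eq_iff shift_def down_def)
    then show ?case using track_z[of 1] k2 by (simp add: numeral_2_eq_2)
  next
    case (step j)
    have "shift k (Suc j) = down k j \<circ>\<^sub>m shift k j"
      using step by (auto simp: fun_eq_iff shift_def down_def map_comp_def)
    then show ?case using track_mult[OF step.IH track_z[of j]] step by simp
  qed
  from this[OF k2 order_refl] show ?thesis unfolding D_eq[symmetric] .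
qed

lemma settle_initial:
  assumes "\<And>a. 1 \<le> a \<Longrightarrow> Suc a \<in> B \<Longrightarrow> a \<in> B"
  shows "settle B = 1"
proof -
  have "{1..b} \<subseteq> B" if "b \<in> B" for b
    using that
  proof (induction b)
    case (Suc b)
    then show ?case using assms[of b] by (cases "b = 0") (auto simp: le_Suc_eq)
  qed simp
  then have "rank B b = b" if "b \<in> B" for b
    using that by (simp add: rank_def Int_absorb1)
  then show ?thesis unfolding settle_def by (intro word_val_trivial) auto
qed

text \<open>Induction on the sum of the positions: lower one particle by \<open>z a\<close>, undo
  the settling of the lower configuration, and raise the particle again by
  \<open>s a\<close>.\<close>

lemma settle_inverse:
  "B \<subseteq> {1..k} \<Longrightarrow> \<exists>y. eps B * settle B * y = eps B"
proof (induction "\<Sum>B" arbitrary: B rule: less_induct)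
  case less
  show ?case
  proof (cases "\<exists>a. 1 \<le> a \<and> Suc a \<in> B \<and> a \<notin> B")
    case False
    then have "settle B = 1" by (intro settle_initial) auto
    then show ?thesis by (intro exI[of _ 1]) simp
  next
    case True
    then obtain a where a: "1 \<le> a" "Suc a \<in> B" "a \<notin> B" by blast
    then have ak: "a < k" using less.prems by auto
    let ?A = "insert a (B - {Suc a})"
    have fin: "finite B" using less.prems finite_subset by blast
    have "\<Sum>?A = a + \<Sum>(B - {Suc a})" using fin a by (intro sum.insert) auto
    moreover have "\<Sum>B = Suc a + \<Sum>(B - {Suc a})" using fin a by (intro sum.remove) auto
    ultimately have "\<Sum>?A < \<Sum>B" by simp
    then obtain y where y: "eps ?A * settle ?A * y = eps ?A"
      using less.hyps[of ?A] less.prems a ak by auto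
    note tz = track_z[OF a(1) ak]
    have p: "pre (down k a) ?A = B" and d: "B \<subseteq> dom (down k a)"
      using less.prems a by (auto simp: pre_def down_def dom_def subset_iff split: if_splits)
    have "img (down k a) (B - {Suc a}) = B - {Suc a}"
      using less.prems a by (intro img_fixed) (auto simp: down_def)
    then have i: "img (down k a) B = ?A"
      using img_move[OF a(2), of "down k a" a] by (simp add: down_def)
    have zA: "z a * eps ?A = eps B * z a" using tz p by (simp add: track_def)
    have zT: "eps B * z a * settle ?A = eps B * settle B" using tz i d unfolding track_def by metis
    have "eps B * settle B * (y * s a) = z a * (eps ?A * settle ?A * y) * s a"
      unfolding zT[symmetric] using zA by (simp flip: mult.assoc)
    also have "\<dots> = eps B * (z a * s a)" unfolding y using zA by (simp flip: mult.assoc)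
    also have "\<dots> = eps B" using z_s a ak by (simp add: eps_f)
    finally show ?thesis by blast
  qed
qed

text \<open>Such a y equals \<open>eps A * settle A * w\<close>, with A the domain of p and w
  undoing the settling of the image; all three factors are determined by p.\<close>

theorem track_unique:
  assumes "track y p" "track y' p"
  shows "y = y'"
proof -
  let ?A = "dom p" and ?B = "img p (dom p)"
  have B: "?B \<subseteq> {1..k}" using assms by (auto simp: track_def img_def ran_def)
  then obtain w where w: "eps ?B * settle ?B * w = eps ?B" using settle_inverse by blast
  have "y = eps ?A * settle ?A * w" if "track y p" for y
  proof -
    have "y = y * eps UNIV" by (simp add: eps_all)
    also have "\<dots> = eps ?A * y" using that by (auto simp: track_def pre_def dom_def)
    finally have 1: "eps ?A * y = y" by simp
    have "pre p ?B = ?A" by (auto simp: pre_def img_def)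
    then have 2: "y * eps ?B = y" using that 1 by (simp add: track_def)
    have 3: "eps ?A * y * settle ?B = eps ?A * settle ?A" using that by (simp add: track_def)
    have "y = eps ?A * y * (eps ?B * settle ?B * w)" using 1 2 w by simp
    also have "\<dots> = eps ?A * (y * eps ?B) * settle ?B * w" by (simp add: mult.assoc)
    also have "\<dots> = eps ?A * settle ?A * w" unfolding 2 3 ..
    finally show ?thesis .
  qed
  then show ?thesis using assms by metis
qed

end

section \<open>The relations hold\<close>

definition nxt :: "nat \<Rightarrow> nat \<Rightarrow> nat" where "nxt k i = (if i = k then 1 else Suc i)"

definition prv :: "nat \<Rightarrow> nat \<Rightarrow> nat" where "prv k j = (if j = 1 then k else j - 1)"

lemma nxt_prv: "j \<in> {1..k} \<Longrightarrow> nxt k (prv k j) = j"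
  by (auto simp: nxt_def prv_def)

lemma prv_range: "j \<in> {1..k} \<Longrightarrow> prv k j \<in> {1..k}"
  by (auto simp: prv_def)

lemma prv_neq: "k \<ge> 2 \<Longrightarrow> j \<in> {1..k} \<Longrightarrow> prv k j \<noteq> j"
  by (auto simp: prv_def)

lemma prv_inj: "inj_on (prv k) {1..k}"
  by (metis inj_on_inverseI nxt_prv)

text \<open>The pairs (k, 1) and (i, i+1) are the pairs of cyclic neighbours, indexed here by the
  second member.\<close>

lemma cyclic_pairs:
  assumes "k \<ge> 2"
  shows "{F k 1} \<union> {F i (i + 1) | i. 1 \<le> i \<and> i \<le> k - 1} = (\<lambda>j. F (prv k j) j) ` {1..k}"
proof (intro equalityI subsetI)
  fix y assume "y \<in> {F k 1} \<union> {F i (i + 1) | i. 1 \<le> i \<and> i \<le> k - 1}"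
  then consider "y = F k 1" | i where "y = F i (i + 1)" "1 \<le> i" "i \<le> k - 1" by blast
  then show "y \<in> (\<lambda>j. F (prv k j) j) ` {1..k}"
  proof cases
    case 1
    then show ?thesis using assms by (intro image_eqI[of _ _ 1]) (auto simp: prv_def)
  next
    case 2
    then show ?thesis by (intro image_eqI[of _ _ "i + 1"]) (auto simp: prv_def)
  qed
next
  fix y assume "y \<in> (\<lambda>j. F (prv k j) j) ` {1..k}"
  then obtain j where j: "y = F (prv k j) j" "1 \<le> j" "j \<le> k" by auto
  show "y \<in> {F k 1} \<union> {F i (i + 1) | i. 1 \<le> i \<and> i \<le> k - 1}"
  proof (cases "j = 1")
    case True
    then show ?thesis using j by (simp add: prv_def)
  next
    case False
    then have "y = F (j - 1) (j - 1 + 1)" "1 \<le> j - 1" "j - 1 \<le> k - 1" using j by (auto simp: prv_def)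
    then show ?thesis by blast
  qed
qed

section \<open>The relations V indexed by blocks\<close>

definition eword :: "nat \<Rightarrow> nat \<Rightarrow> nat \<Rightarrow> gen list" where
  "eword k m j = dp (prv k j) m @ dp j (m-1)"

definition gword :: "nat \<Rightarrow> nat \<Rightarrow> gen list" where
  "gword m j = dp j ((m-1)^2)"

lemma relV1_eq: "k \<ge> 2 \<Longrightarrow> relV1 k m = (\<lambda>j. (eword k m j ^^^ 2, [])) ` {1..k}"
  unfolding relV1_def eword_def
  using cyclic_pairs[of k "\<lambda>i j. ((dp i m @ dp j (m-1)) ^^^ 2, [])"] by simp

lemma relV2_eq: "relV2 k m = (\<lambda>j. (dp j (m*(m-1)), [])) ` {1..k}"
  by (auto simp: relV2_def)

lemma relV3_eq: "k \<ge> 2 \<Longrightarrow> relV3 k m = (\<lambda>j. ((gword m j @ eword k m j) ^^^ (m-1), [])) ` {1..k}"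
  unfolding relV3_def eword_def gword_def
  using cyclic_pairs[of k "\<lambda>i j. ((dp j ((m-1)^2) @ dp i m @ dp j (m-1)) ^^^ (m-1), [])"] by simp

lemma relV4_eq: "k \<ge> 2 \<Longrightarrow> relV4 k m =
    (\<lambda>j. ((dp (prv k j) m @ dp j ((m-1)^2*(m-2)) @ dp (prv k j) m) ^^^ 3, [])) ` {1..k}"
  unfolding relV4_def
  using cyclic_pairs[of k "\<lambda>i j. ((dp i m @ dp j ((m-1)^2*(m-2)) @ dp i m) ^^^ 3, [])"] by simp

definition V5lhs :: "nat \<Rightarrow> nat \<Rightarrow> nat \<Rightarrow> nat \<Rightarrow> gen list" where
  "V5lhs m t i j = (dp i m @ dp j ((m-1)^2*(m-t-1)) @ dp i m @ dp j ((m-1)^2*(t-1))) ^^^ 2"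

lemma relV5_eq:
  assumes "k \<ge> 2"
  shows "relV5 k m = (\<lambda>(j, t). (V5lhs m t (prv k j) j, [])) ` ({1..k} \<times> {2..m-2})"
proof -
  have "relV5 k m = (\<Union>t\<in>{2..m-2}. {(V5lhs m t k 1, [])} \<union>
      {(V5lhs m t i (i + 1), []) | i. 1 \<le> i \<and> i \<le> k - 1})"
    unfolding relV5_def V5lhs_def by auto
  also have "\<dots> = (\<Union>t\<in>{2..m-2}. (\<lambda>j. (V5lhs m t (prv k j) j, [])) ` {1..k})"
    using cyclic_pairs[OF assms, of "\<lambda>i j. (V5lhs m t i j, [])" for t] by (intro SUP_cong) auto
  finally show ?thesis by auto
qed

text \<open>In the mixed relations d_i^m is indexed by the block it acts on, the one after i. The
  excluded pairs are those in the same block, i = j, and those that are powers of one generator, i =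
  \<open>prv k j\<close>.\<close>

lemma relV6_eq:
  assumes "k \<ge> 2"
  shows "relV6 k m =
     (\<lambda>(i, j). (dp i m @ dp j m, dp j m @ dp i m)) ` {(i, j). 1 \<le> i \<and> i < j \<and> j \<le> k} \<union>
     (\<lambda>(i, j). (gword m i @ gword m j, gword m j @ gword m i)) ` {(i, j). 1 \<le> i \<and> i < j \<and> j \<le> k} \<union>
     (\<lambda>(i, j). (gword m i @ dp (prv k j) m, dp (prv k j) m @ gword m i)) `
       {(i, j). i \<in> {1..k} \<and> j \<in> {1..k} \<and> i \<noteq> j \<and> i \<noteq> prv k j}"
proof -
  let ?F = "\<lambda>i j. (gword m i @ dp j m, dp j m @ gword m i)"
  have "{?F i k | i. 2 \<le> i \<and> i \<le> k-1} \<union> {?F i j | i j. 1 \<le> i \<and> i \<le> k \<and> 1 \<le> j \<and> j \<le> k-1 \<and> i \<notin> {j, j+1}}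
    = (\<lambda>(i, j). ?F i (prv k j)) ` {(i, j). i \<in> {1..k} \<and> j \<in> {1..k} \<and> i \<noteq> j \<and> i \<noteq> prv k j}" (is "?L = ?R")
  proof (intro equalityI subsetI)
    fix y assume "y \<in> ?L"
    then consider i where "y = ?F i k" "2 \<le> i" "i \<le> k-1"
      | i j where "y = ?F i j" "1 \<le> i" "i \<le> k" "1 \<le> j" "j \<le> k-1" "i \<notin> {j, j+1}" by blast
    then show "y \<in> ?R"
    proof cases
      case 1
      then show ?thesis using assms by (intro image_eqI[of _ _ "(i, 1)"]) (auto simp: prv_def)
    next
      case 2
      then show ?thesis using assms by (intro image_eqI[of _ _ "(i, j + 1)"]) (auto simp: prv_def)
    qed
  next
    fix y assume "y \<in> ?R"
    then obtain i j where y: "y = ?F i (prv k j)" "i \<in> {1..k}" "j \<in> {1..k}" "i \<noteq> j" "i \<noteq> prv k j" by auto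
    show "y \<in> ?L"
    proof (cases "j = 1")
      case True
      then have "y = ?F i k" "2 \<le> i" "i \<le> k-1" using y by (auto simp: prv_def)
      then show ?thesis by blast
    next
      case False
      then have "y = ?F i (j - 1)" "1 \<le> i" "i \<le> k" "1 \<le> j - 1" "j - 1 \<le> k-1" "i \<notin> {j - 1, j - 1 + 1}"
        using y by (auto simp: prv_def)
      then show ?thesis by blast
    qed
  qed
  moreover have "relV6 k m =
     (\<lambda>(i, j). (dp i m @ dp j m, dp j m @ dp i m)) ` {(i, j). 1 \<le> i \<and> i < j \<and> j \<le> k} \<union>
     (\<lambda>(i, j). (gword m i @ gword m j, gword m j @ gword m i)) ` {(i, j). 1 \<le> i \<and> i < j \<and> j \<le> k} \<union> ?L"
    unfolding relV6_def gword_def by auto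
  ultimately show ?thesis by simp
qed

section \<open>How the letters x_i move blocks, and the shape of V'\<close>

definition xstep :: "nat \<Rightarrow> nat \<Rightarrow> nat \<rightharpoonup> nat" where
  "xstep k i = (if i = 0 then shift k k else up k (k - i))"

text \<open>The block map \<open>xstep k i\<close> is defined on every block but \<open>xlo k i\<close>, sends \<open>j\<close> to \<open>xmv k i j\<close>,
  and misses the block \<open>k - i\<close>.\<close>

definition xlo :: "nat \<Rightarrow> nat \<Rightarrow> nat" where "xlo k i = (if i = 0 then 1 else Suc (k - i))"

definition xmv :: "nat \<Rightarrow> nat \<Rightarrow> nat \<Rightarrow> nat" where
  "xmv k i j = (if i = 0 then j - 1 else if j = k - i then Suc j else j)"

lemma xstep_eq:
  assumes "i < k" "k \<ge> 2"
  shows "xstep k i b = (if b \<in> {1..k} \<and> b \<noteq> xlo k i then Some (xmv k i b) else None)"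
  using assms by (auto simp: xstep_def xlo_def xmv_def shift_def up_def)

lemma xlo_range: "i < k \<Longrightarrow> xlo k i \<in> {1..k}"
  by (auto simp: xlo_def)

lemma xmv_range: "i < k \<Longrightarrow> j \<in> {1..k} \<Longrightarrow> j \<noteq> xlo k i \<Longrightarrow> xmv k i j \<in> {1..k} - {k - i}"
  by (auto simp: xlo_def xmv_def)

lemma xmv_inj: "i < k \<Longrightarrow> j \<noteq> xlo k i \<Longrightarrow> j' \<noteq> xlo k i \<Longrightarrow> j \<in> {1..k} \<Longrightarrow> j' \<in> {1..k} \<Longrightarrow>
    xmv k i j = xmv k i j' \<longleftrightarrow> j = j'"
  by (auto simp: xlo_def xmv_def)

lemma xmv_onto:
  assumes "i < k" "l \<in> {1..k}" "l \<noteq> k - i"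
  obtains j where "j \<in> {1..k}" "j \<noteq> xlo k i" "xmv k i j = l"
proof (cases "i = 0")
  case True
  then show ?thesis using assms that[of "Suc l"] by (auto simp: xlo_def xmv_def)
next
  case False
  show ?thesis
  proof (cases "l = Suc (k - i)")
    case True
    then show ?thesis using assms False that[of "k - i"] by (auto simp: xlo_def xmv_def)
  next
    case l: False
    then show ?thesis using assms False that[of l] by (auto simp: xlo_def xmv_def)
  qed
qed

text \<open>The content of V' for one family y of block elements: a letter x_i carries
  \<open>y j\<close> to the block it moves j to, absorbs on its right the block missing from its
  image, and absorbs on its left the block missing from its domain.\<close>

definition actrel :: "nat \<Rightarrow> (nat \<Rightarrow> gen list) \<Rightarrow> gen list rel" where
  "actrel k y = (\<lambda>(i, j). (xg i @ y (xmv k i j), y j @ xg i)) ` {(i, j). i < k \<and> j \<in> {1..k} \<and> j \<noteq> xlo k i} \<union>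
     (\<lambda>i. (xg i @ y (k - i), xg i)) ` {..<k} \<union> (\<lambda>i. (y (xlo k i) @ xg i, xg i)) ` {..<k}"

lemma actrel_moveI:
  "i < k \<Longrightarrow> j \<in> {1..k} \<Longrightarrow> j \<noteq> xlo k i \<Longrightarrow> l = xmv k i j \<Longrightarrow> (xg i @ y l, y j @ xg i) \<in> actrel k y"
  by (auto simp: actrel_def)

lemma actrel_missI: "i < k \<Longrightarrow> l = k - i \<Longrightarrow> (xg i @ y l, xg i) \<in> actrel k y"
  by (auto simp: actrel_def)

lemma actrel_killI: "i < k \<Longrightarrow> j = xlo k i \<Longrightarrow> (y j @ xg i, xg i) \<in> actrel k y"
  by (auto simp: actrel_def)

lemma relV'_subset:
  assumes k: "k \<ge> 2"
  shows "relV' k m \<subseteq> actrel k (eword k m) \<union> actrel k (gword m)" (is "_ \<subseteq> ?E \<union> ?G")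
proof -
  have e1: "eword k m 1 = dp k m @ dp 1 (m-1)" by (simp add: eword_def prv_def)
  have eS: "eword k m (Suc j) = dp j m @ dp (Suc j) (m-1)" if "1 \<le> j" for j
    using that by (simp add: eword_def prv_def)
  have "relV'1 k m \<subseteq> ?E \<union> ?G"
  proof -
    have "(eword k m 1 @ xg 0, xg 0) \<in> ?E" "(gword m 1 @ xg 0, xg 0) \<in> ?G"
      using k by (intro actrel_killI; auto simp: xlo_def)+
    then show ?thesis unfolding relV'1_def e1 gword_def by simp
  qed
  moreover have "relV'2 k m \<subseteq> ?E \<union> ?G"
  proof -
    have "(xg 0 @ eword k m 1, eword k m (Suc 1) @ xg 0) \<in> ?E"
      using k by (intro actrel_moveI; auto simp: xlo_def xmv_def)+
    moreover have "(xg 0 @ eword k m (Suc i), eword k m (Suc (Suc i)) @ xg 0) \<in> ?E" if "1 \<le> i" "i \<le> k-2" for i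
      using k that by (intro actrel_moveI; auto simp: xlo_def xmv_def)+
    moreover have "(xg 0 @ gword m i, gword m (i+1) @ xg 0) \<in> ?G" if "1 \<le> i" "i \<le> k-1" for i
      using k that by (intro actrel_moveI; auto simp: xlo_def xmv_def)+
    ultimately show ?thesis unfolding relV'2_def by (auto simp: e1[simplified] eS gword_def numeral_2_eq_2)
  qed
  moreover have "relV'3 k m \<subseteq> ?E \<union> ?G"
  proof -
    have E: "(xg i @ eword k m (k - i), xg i) \<in> ?E" if "i \<le> k-1" for i
      using k that by (intro actrel_missI) auto
    have "(xg i @ dp (k-i-1) m @ dp (k-i) (m-1), xg i) \<in> ?E" if "i \<le> k-2" for i
    proof -
      have "k - i \<noteq> 1" using k that by arith
      then show ?thesis using E[of i] that by (simp add: eword_def prv_def)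
    qed
    moreover have "(xg (k-1) @ dp k m @ dp 1 (m-1), xg (k-1)) \<in> ?E"
      using E[of "k-1"] k e1 by simp
    moreover have "(xg i @ dp (k-i) ((m-1)^2), xg i) \<in> ?G" if "i \<le> k-1" for i
      using k that actrel_missI[of i k "k - i" "gword m"] by (simp add: gword_def)
    ultimately show ?thesis unfolding relV'3_def by blast
  qed
  moreover have "relV'4 k m \<subseteq> ?E \<union> ?G"
  proof -
    have "(eword k m (Suc i) @ xg (k-i), xg (k-i)) \<in> ?E" "(gword m (Suc i) @ xg (k-i), xg (k-i)) \<in> ?G"
      if "1 \<le> i" "i \<le> k-1" for i
      using k that by (intro actrel_killI; auto simp: xlo_def)+
    then show ?thesis unfolding relV'4_def by (auto simp: eS gword_def)
  qed
  moreover have "relV'5 k m \<subseteq> ?E \<union> ?G"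
  proof -
    have E: "(xg i @ eword k m (Suc (k-i)), eword k m (k-i) @ xg i) \<in> ?E"
      and G: "(xg i @ gword m (Suc (k-i)), gword m (k-i) @ xg i) \<in> ?G"
      if "1 \<le> i" "i \<le> k-1" for i
      using k that by (intro actrel_moveI; auto simp: xlo_def xmv_def)+
    have "(xg i @ dp (k-i) m @ dp (k-i+1) (m-1), dp (k-i-1) m @ dp (k-i) (m-1) @ xg i) \<in> ?E"
      if "1 \<le> i" "i \<le> k-2" for i
    proof -
      have "k - i \<noteq> 1" using k that by arith
      then have "eword k m (k - i) = dp (k-i-1) m @ dp (k-i) (m-1)" by (simp add: eword_def prv_def)
      then show ?thesis using E[of i] that k by (simp add: eS)
    qed
    moreover have "(xg (k-1) @ dp 1 m @ dp 2 (m-1), dp k m @ dp 1 (m-1) @ xg (k-1)) \<in> ?E"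
      using E[of "k-1"] k eS[of 1] e1 by (simp add: numeral_2_eq_2)
    ultimately show ?thesis unfolding relV'5_def using G by (auto simp: gword_def)
  qed
  moreover have "relV'6 k m \<subseteq> ?E \<union> ?G"
  proof -
    have "(xg i @ eword k m j, eword k m j @ xg i) \<in> ?E" "(xg i @ gword m j, gword m j @ xg i) \<in> ?G"
      if "1 \<le> i" "i \<le> k-1" "1 \<le> j" "j \<le> k" "j \<noteq> k - i" "j \<noteq> Suc (k - i)" for i j
      using k that by (intro actrel_moveI; auto simp: xlo_def xmv_def)+
    note H = this
    have "(xg i @ dp k m @ dp 1 (m-1), dp k m @ dp 1 (m-1) @ xg i) \<in> ?E" if "1 \<le> i" "i \<le> k-2" for i
      using H(1)[of i 1] that k e1 by simp
    moreover have "(xg i @ dp j m @ dp (j+1) (m-1), dp j m @ dp (j+1) (m-1) @ xg i) \<in> ?E"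
      if "1 \<le> i" "i \<le> k-1" "1 \<le> j" "j \<le> k-1" "j \<notin> {k-i-1, k-i}" for i j
      using H(1)[of i "Suc j"] that k eS[of j] by auto
    moreover have "(xg i @ dp j ((m-1)^2), dp j ((m-1)^2) @ xg i) \<in> ?G"
      if "1 \<le> i" "i \<le> k-1" "1 \<le> j" "j \<le> k" "j \<notin> {k-i, k-i+1}" for i j
      using H(2)[of i j] that by (auto simp: gword_def)
    ultimately show ?thesis unfolding relV'6_def by blast
  qed
  ultimately show ?thesis unfolding relV'_def by blast
qed

lemma relV'_supset:
  assumes k: "k \<ge> 2"
  shows "actrel k (eword k m) \<union> actrel k (gword m) \<subseteq> relV' k m"
proof -
  have e1: "eword k m 1 = dp k m @ dp 1 (m-1)" by (simp add: eword_def prv_def)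
  have eS: "eword k m j = dp (j-1) m @ dp j (m-1)" if "2 \<le> j" for j
    using that by (simp add: eword_def prv_def)
  have E1: "(xg i @ eword k m (xmv k i j), eword k m j @ xg i) \<in> relV' k m"
    and G1: "(xg i @ gword m (xmv k i j), gword m j @ xg i) \<in> relV' k m"
    if i: "i < k" and j: "1 \<le> j" "j \<le> k" "j \<noteq> xlo k i" for i j
  proof -
    \<comment> \<open>The cases are those that V' writes differently for e: whether x_i is x_0,
      moves block j or fixes it, and whether e_1, spelled with d_k and d_1, occurs.\<close>
    have "i = 0 \<and> j = 2 \<or> i = 0 \<and> 3 \<le> j \<or> i = k - 1 \<and> 1 \<le> i \<and> j = 1 \<or> 1 \<le> i \<and> i \<le> k - 2 \<and> j = k - i
      \<or> 1 \<le> i \<and> j = 1 \<and> j \<noteq> k - i \<or> 1 \<le> i \<and> 2 \<le> j \<and> j \<noteq> k - i \<and> j \<noteq> Suc (k - i)"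
      using j i k unfolding xlo_def by (cases "i = 0"; simp; arith)
    then consider "i = 0" "j = 2" | "i = 0" "3 \<le> j" | "i = k - 1" "1 \<le> i" "j = 1"
      | "1 \<le> i" "i \<le> k - 2" "j = k - i"
      | "1 \<le> i" "j = 1" "j \<noteq> k - i" | "1 \<le> i" "2 \<le> j" "j \<noteq> k - i" "j \<noteq> Suc (k - i)"
      by blast
    then show "(xg i @ eword k m (xmv k i j), eword k m j @ xg i) \<in> relV' k m"
    proof cases
      case 1
      then have "(xg i @ eword k m (xmv k i j), eword k m j @ xg i) \<in> relV'2 k m"
        unfolding relV'2_def by (simp add: xmv_def eS e1[simplified])
      then show ?thesis by (simp add: relV'_def)
    next
      case 2
      then have *: "j = (j - 2) + 2" "1 \<le> j - 2" "j - 2 \<le> k - 2" using j by auto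
      have "(xg 0 @ dp (j-2) m @ dp ((j-2)+1) (m-1), dp ((j-2)+1) m @ dp ((j-2)+2) (m-1) @ xg 0) \<in> relV'2 k m"
        unfolding relV'2_def using *(2,3) by blast
      moreover have "(j-2)+1 = j - 1" "(j-2)+2 = j" "j - 1 - 1 = j - 2" using 2 by auto
      ultimately have "(xg i @ eword k m (xmv k i j), eword k m j @ xg i) \<in> relV'2 k m"
        using 2 by (simp add: xmv_def eS)
      then show ?thesis by (simp add: relV'_def)
    next
      case 3
      then have "k - i = 1" "xmv k i j = 2" using k by (auto simp: xmv_def)
      then have "(xg i @ eword k m (xmv k i j), eword k m j @ xg i) \<in> relV'5 k m"
        unfolding relV'5_def using 3 by (simp add: eS e1[simplified])
      then show ?thesis by (simp add: relV'_def)
    next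
      case 4
      then have "2 \<le> k - i" "xmv k i j = k - i + 1" using k by (auto simp: xmv_def)
      moreover have "(xg i @ dp (k-i) m @ dp (k-i+1) (m-1), dp (k-i-1) m @ dp (k-i) (m-1) @ xg i) \<in> relV'5 k m"
        unfolding relV'5_def using 4 by blast
      ultimately have "(xg i @ eword k m (xmv k i j), eword k m j @ xg i) \<in> relV'5 k m"
        using 4 by (simp add: eS)
      then show ?thesis by (simp add: relV'_def)
    next
      case 5
      then have "xmv k i j = 1" "i \<le> k - 2" using i by (auto simp: xmv_def)
      then have "(xg i @ eword k m (xmv k i j), eword k m j @ xg i) \<in> relV'6 k m"
        unfolding relV'6_def using 5 by (simp add: e1[simplified])
      then show ?thesis by (simp add: relV'_def)
    next
      case 6
      then have *: "xmv k i j = j" "j - 1 + 1 = j" by (auto simp: xmv_def)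
      have "(xg i @ dp (j-1) m @ dp (j-1+1) (m-1), dp (j-1) m @ dp (j-1+1) (m-1) @ xg i) \<in> relV'6 k m"
      proof -
        have "1 \<le> i" "i \<le> k - 1" "1 \<le> j - 1" "j - 1 \<le> k - 1" using 6 i j by auto
        moreover have "j - 1 \<notin> {k - i - 1, k - i}" using 6 i by auto
        ultimately show ?thesis unfolding relV'6_def by blast
      qed
      then have "(xg i @ eword k m (xmv k i j), eword k m j @ xg i) \<in> relV'6 k m"
        using * 6 by (simp add: eS)
      then show ?thesis by (simp add: relV'_def)
    qed
    have "i = 0 \<and> 2 \<le> j \<or> 1 \<le> i \<and> j = k - i \<or> 1 \<le> i \<and> j \<noteq> k - i \<and> j \<noteq> Suc (k - i)"
      using j unfolding xlo_def by (cases "i = 0"; simp; arith)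
    then consider "i = 0" "2 \<le> j" | "1 \<le> i" "j = k - i" | "1 \<le> i" "j \<noteq> k - i" "j \<noteq> Suc (k - i)"
      by blast
    then show "(xg i @ gword m (xmv k i j), gword m j @ xg i) \<in> relV' k m"
    proof cases
      case 1
      then have "(xg 0 @ dp (j-1) ((m-1)^2), dp (j-1+1) ((m-1)^2) @ xg 0) \<in> relV'2 k m"
      proof -
        have "1 \<le> j - 1" "j - 1 \<le> k - 1" using 1 j by auto
        then show ?thesis unfolding relV'2_def by blast
      qed
      then show ?thesis using 1 by (simp add: relV'_def gword_def xmv_def)
    next
      case 2
      then have "(xg i @ dp (k-i+1) ((m-1)^2), dp (k-i) ((m-1)^2) @ xg i) \<in> relV'5 k m"
      proof -
        have "i \<le> k - 1" using i by simp
        then show ?thesis unfolding relV'5_def using 2 by blast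
      qed
      then show ?thesis using 2 by (simp add: relV'_def gword_def xmv_def)
    next
      case 3
      then have "(xg i @ dp j ((m-1)^2), dp j ((m-1)^2) @ xg i) \<in> relV'6 k m"
      proof -
        have "i \<le> k - 1" "j \<notin> {k - i, k - i + 1}" using 3 i by auto
        then show ?thesis unfolding relV'6_def using 3 j by blast
      qed
      then show ?thesis using 3 by (simp add: relV'_def gword_def xmv_def)
    qed
  qed
  have E2: "(xg i @ eword k m (k - i), xg i) \<in> relV' k m"
    and G2: "(xg i @ gword m (k - i), xg i) \<in> relV' k m" if i: "i < k" for i
  proof -
    have "(xg i @ eword k m (k - i), xg i) \<in> relV'3 k m"
    proof (cases "i = k - 1")
      case True
      then have "k - i = 1" using k by simp
      then show ?thesis unfolding relV'3_def using True by (simp add: e1[simplified])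
    next
      case False
      then have "i \<le> k - 2" "2 \<le> k - i" using i by auto
      then show ?thesis unfolding relV'3_def by (auto simp: eS)
    qed
    then show "(xg i @ eword k m (k - i), xg i) \<in> relV' k m" by (simp add: relV'_def)
    have "(xg i @ gword m (k - i), xg i) \<in> relV'3 k m"
    proof -
      have "i \<le> k - 1" using i by simp
      then show ?thesis unfolding relV'3_def gword_def by blast
    qed
    then show "(xg i @ gword m (k - i), xg i) \<in> relV' k m" by (simp add: relV'_def)
  qed
  have E3: "(eword k m (xlo k i) @ xg i, xg i) \<in> relV' k m"
    and G3: "(gword m (xlo k i) @ xg i, xg i) \<in> relV' k m" if i: "i < k" for i
  proof -
    have "(eword k m (xlo k i) @ xg i, xg i) \<in> relV'1 k m \<union> relV'4 k m \<and>
        (gword m (xlo k i) @ xg i, xg i) \<in> relV'1 k m \<union> relV'4 k m"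
    proof (cases "i = 0")
      case True
      then show ?thesis by (simp add: relV'1_def xlo_def e1[simplified] gword_def)
    next
      case False
      define a where "a = k - i"
      have a: "1 \<le> a" "a \<le> k - 1" "i = k - a" using False i by (auto simp: a_def)
      have "(dp a m @ dp (a+1) (m-1) @ xg (k-a), xg (k-a)) \<in> relV'4 k m"
        "(dp (a+1) ((m-1)^2) @ xg (k-a), xg (k-a)) \<in> relV'4 k m"
        unfolding relV'4_def using a(1,2) by blast+
      then show ?thesis using a False by (simp add: xlo_def eS gword_def flip: a_def)
    qed
    then show "(eword k m (xlo k i) @ xg i, xg i) \<in> relV' k m"
      "(gword m (xlo k i) @ xg i, xg i) \<in> relV' k m" by (auto simp: relV'_def)
  qed
  show ?thesis
    unfolding actrel_def using E1 G1 E2 G2 E3 G3 by auto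
qed

lemma relV'_eq: "k \<ge> 2 \<Longrightarrow> relV' k m = actrel k (eword k m) \<union> actrel k (gword m)"
  using relV'_subset relV'_supset by blast

section \<open>Splitting d_i by its two coprime orders\<close>

lemma exponent_arith:
  assumes "m \<ge> (2::nat)"
  shows "(m-1)^2 = 1 + m * (m-2)" "(m-1)^2 * m = m * (m-1) * (m-1)"
    "(m-1)^2 * (m-1) = m - 1 + m * (m-1) * (m-2)" "(m-1)^2 + m = 1 + m * (m-1)"
proof -
  obtain n where m: "m = n + 2" using assms le_Suc_ex by (metis add.commute)
  show "(m-1)^2 = 1 + m * (m-2)" "(m-1)^2 * m = m * (m-1) * (m-1)"
    "(m-1)^2 * (m-1) = m - 1 + m * (m-1) * (m-2)" "(m-1)^2 + m = 1 + m * (m-1)"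
    by (simp_all add: m power2_eq_square algebra_simps)
qed

text \<open>Modulo m(m-1) the exponents (m-1)^2 and m are complementary idempotents, with sum 1 +
  m(m-1).\<close>

lemma power_decomposition:
  fixes d :: "'a::monoid_mult"
  assumes m: "m \<ge> 2" and d: "d ^ (m * (m-1)) = 1"
  shows "(d ^ (m-1)^2) ^ m = 1" "(d ^ m) ^ (m-1) = 1" "(d ^ (m-1)^2) ^ (m-1) = d ^ (m-1)"
    "d ^ (m-1)^2 * d ^ m = d"
proof -
  have "(d ^ (m-1)^2) ^ m = (d ^ (m * (m-1))) ^ (m-1)"
    unfolding power_mult[symmetric] exponent_arith(2)[OF m] ..
  then show "(d ^ (m-1)^2) ^ m = 1" using d by simp
  show "(d ^ m) ^ (m-1) = 1" using d by (simp add: power_mult)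
  have "(d ^ (m-1)^2) ^ (m-1) = d ^ (m-1) * (d ^ (m * (m-1))) ^ (m-2)"
    unfolding power_mult[symmetric] exponent_arith(3)[OF m] power_add ..
  then show "(d ^ (m-1)^2) ^ (m-1) = d ^ (m-1)" using d by simp
  have "d ^ (m-1)^2 * d ^ m = d ^ 1 * d ^ (m * (m-1))"
    unfolding power_add[symmetric] exponent_arith(4)[OF m] ..
  then show "d ^ (m-1)^2 * d ^ m = d" using d by simp
qed

section \<open>The model on pairs of a block and a position\<close>

text \<open>The permutation of the positions in block b; \<open>adj 0 * rot m\<close> is the cycle
  of length m-1 that fixes position 1.\<close>

definition dval :: "nat \<Rightarrow> nat \<Rightarrow> nat \<Rightarrow> gen \<Rightarrow> nat endo" where
  "dval k m b a = (case a of
     Dgen i \<Rightarrow> if b = i then rot m else if b = nxt k i then adj 0 * rot m else 1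
   | Xgen i \<Rightarrow> 1)"

definition gstep :: "nat \<Rightarrow> nat \<Rightarrow> gen \<Rightarrow> nat \<times> nat \<rightharpoonup> nat \<times> nat" where
  "gstep k m a = (\<lambda>(b, r). case a of
     Dgen i \<Rightarrow> Some (b, app (dval k m b a) r)
   | Xgen i \<Rightarrow> map_option (\<lambda>c. (c, r)) (xstep k i b))"

text \<open>Words act on all pairs of numbers, not only on the n genuine points, so relations can be
  checked as equations between functions.\<close>

primrec run :: "nat \<Rightarrow> nat \<Rightarrow> gen list \<Rightarrow> nat \<times> nat \<rightharpoonup> nat \<times> nat" where
  "run k m [] = Some"
| "run k m (a # w) = run k m w \<circ>\<^sub>m gstep k m a"

lemma map_comp_Some_left [simp]: "Some \<circ>\<^sub>m f = f"
  by (rule ext) (simp add: map_comp_def split: option.splits)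

lemma map_comp_Some_right [simp]: "f \<circ>\<^sub>m Some = f"
  by (rule ext) (simp add: map_comp_def)

lemma map_comp_assoc: "(h \<circ>\<^sub>m g) \<circ>\<^sub>m f = h \<circ>\<^sub>m (g \<circ>\<^sub>m f)"
  by (rule ext) (simp add: map_comp_def split: option.splits)

lemma run_append: "run k m (u @ v) = run k m v \<circ>\<^sub>m run k m u"
  by (induction u) (simp_all add: map_comp_assoc)

primrec bmap :: "nat \<Rightarrow> nat list \<Rightarrow> nat \<rightharpoonup> nat" where
  "bmap k [] = Some"
| "bmap k (i # is) = bmap k is \<circ>\<^sub>m xstep k i"

lemma bmap_append: "bmap k (u @ v) = bmap k v \<circ>\<^sub>m bmap k u"
  by (induction u) (simp_all add: map_comp_assoc)

lemma run_Xgen: "run k m (map Xgen is) (b, r) = map_option (\<lambda>c. (c, r)) (bmap k is b)"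
  by (induction "is" arbitrary: b) (auto simp: gstep_def map_comp_def split: option.splits)

lemma run_Dgen:
  "\<forall>a\<in>set w. \<exists>i. a = Dgen i \<Longrightarrow> run k m w (b, r) = Some (b, app (word_val (dval k m b) w) r)"
  by (induction w arbitrary: r) (auto simp: gstep_def map_comp_def)

lemma nxt_neq: "k \<ge> 2 \<Longrightarrow> nxt k i \<noteq> i"
  by (auto simp: nxt_def)

lemma nxt_inj: "i \<in> {1..k} \<Longrightarrow> j \<in> {1..k} \<Longrightarrow> nxt k i = nxt k j \<longleftrightarrow> i = j"
  by (auto simp: nxt_def)

lemma conj_power:
  fixes h :: "'a::monoid_mult"
  assumes "h * h' = 1" "h' * h = 1"
  shows "(h * x * h') ^ n = h * x ^ n * h'"
proof (induction n)
  case (Suc n)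
  have "(h * x * h') ^ Suc n = h * x * (h' * h) * x ^ n * h'" using Suc by (simp add: mult.assoc)
  then show ?case using assms by (simp add: mult.assoc)
qed (simp add: assms)

lemma relV_cases:
  assumes k2: "k \<ge> 2" and uv: "(u, v) \<in> relV k m"
  obtains (1) j where "(u, v) = (eword k m j ^^^ 2, [])" "j \<in> {1..k}"
    | (2) j where "(u, v) = (dp j (m*(m-1)), [])" "j \<in> {1..k}"
    | (3) j where "(u, v) = ((gword m j @ eword k m j) ^^^ (m-1), [])" "j \<in> {1..k}"
    | (4) j where "(u, v) = ((dp (prv k j) m @ dp j ((m-1)^2*(m-2)) @ dp (prv k j) m) ^^^ 3, [])" "j \<in> {1..k}"
    | (5) j t where "(u, v) = (V5lhs m t (prv k j) j, [])" "j \<in> {1..k}" "t \<in> {2..m-2}"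
    | (6) i j where "(u, v) = (dp i m @ dp j m, dp j m @ dp i m)" "1 \<le> i" "i < j" "j \<le> k"
    | (7) i j where "(u, v) = (gword m i @ gword m j, gword m j @ gword m i)" "1 \<le> i" "i < j" "j \<le> k"
    | (8) i j where "(u, v) = (gword m i @ dp (prv k j) m, dp (prv k j) m @ gword m i)"
        "i \<in> {1..k}" "j \<in> {1..k}" "i \<noteq> j"
proof -
  consider "(u, v) \<in> relV1 k m" | "(u, v) \<in> relV2 k m" | "(u, v) \<in> relV3 k m"
    | "(u, v) \<in> relV4 k m" | "(u, v) \<in> relV5 k m" | "(u, v) \<in> relV6 k m"
    using uv unfolding relV_def by blast
  then show thesis
  proof cases
    case 1
    then show thesis using that(1) unfolding relV1_eq[OF k2] by blast
  next
    case 2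
    then show thesis using that(2) unfolding relV2_eq by blast
  next
    case 3
    then show thesis using that(3) unfolding relV3_eq[OF k2] by blast
  next
    case 4
    then show thesis using that(4) unfolding relV4_eq[OF k2] by blast
  next
    case 5
    then obtain j t where "(u, v) = (V5lhs m t (prv k j) j, [])" "j \<in> {1..k}" "t \<in> {2..m-2}"
      unfolding relV5_eq[OF k2] by auto
    then show thesis by (rule that(5))
  next
    case 6
    then consider
      p where "(u, v) = (case p of (i, j) \<Rightarrow> (dp i m @ dp j m, dp j m @ dp i m))"
        "p \<in> {(i, j). 1 \<le> i \<and> i < j \<and> j \<le> k}"
      | p where "(u, v) = (case p of (i, j) \<Rightarrow> (gword m i @ gword m j, gword m j @ gword m i))"
        "p \<in> {(i, j). 1 \<le> i \<and> i < j \<and> j \<le> k}"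
      | p where "(u, v) = (case p of (i, j) \<Rightarrow> (gword m i @ dp (prv k j) m, dp (prv k j) m @ gword m i))"
        "p \<in> {(i, j). i \<in> {1..k} \<and> j \<in> {1..k} \<and> i \<noteq> j \<and> i \<noteq> prv k j}"
      unfolding relV6_eq[OF k2] by (elim UnE imageE)
    then show thesis
    proof cases
      case 1
      then show thesis using that(6)[of "fst p" "snd p"] unfolding case_prod_beta mem_Collect_eq by blast
    next
      case 2
      then show thesis using that(7)[of "fst p" "snd p"] unfolding case_prod_beta mem_Collect_eq by blast
    next
      case 3
      then show thesis using that(8)[of "fst p" "snd p"] unfolding case_prod_beta mem_Collect_eq by blast
    qed
  qed
qed

locale sizes =
  fixes k m :: nat
  assumes k2: "k \<ge> 2" and m2: "m \<ge> 2"
begin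

interpretation moore "adj 0" "rot m" m by (rule moore_adj_rot[OF m2])

lemma coord_dp:
  "word_val (dval k m b) (dp i (m*(m-1))) = 1"
  "word_val (dval k m b) (dp i m) = (if b = nxt k i then adj 0 * rot m else 1)"
  "word_val (dval k m b) (dp i (m-1)) = (if b = i then rot m ^ (m-1) else 1)"
  "word_val (dval k m b) (dp i ((m-1)^2 * n)) = (if b = i then rot m ^ n else 1)"
proof -
  have C: "(adj 0 * rot m) ^ m = adj 0 * rot m"
    using eg m2 power_Suc[of "adj 0 * rot m" "m - 1"] by simp
  have "rot m ^ (1 + m * (m-2)) = rot m * (rot m ^ m) ^ (m-2)" by (simp add: power_mult)
  then have R: "rot m ^ (m-1)^2 = rot m" using gm exponent_arith(1)[OF m2] by simp
  have C2: "(adj 0 * rot m) ^ (m-1)^2 = 1" using eg by (simp add: power2_eq_square power_mult)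
  show "word_val (dval k m b) (dp i m) = (if b = nxt k i then adj 0 * rot m else 1)"
    using C gm nxt_neq[OF k2] by (auto simp: dval_def)
  show "word_val (dval k m b) (dp i (m*(m-1))) = 1"
    using C eg gm by (simp add: dval_def power_mult)
  show "word_val (dval k m b) (dp i (m-1)) = (if b = i then rot m ^ (m-1) else 1)"
    using eg by (simp add: dval_def)
  show "word_val (dval k m b) (dp i ((m-1)^2 * n)) = (if b = i then rot m ^ n else 1)"
    using R C2 by (simp add: dval_def power_mult)
qed

lemma coord_gword: "word_val (dval k m b) (gword m j) = (if b = j then rot m else 1)"
  using coord_dp(4)[where b = b and i = j and n = 1] by (simp add: gword_def)

text \<open>The two factors act nontrivially only in block j, where \<open>rot m ^ (m - 1)\<close>
  cancels the rotation in \<open>adj 0 * rot m\<close>.\<close>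

lemma coord_eword: "j \<in> {1..k} \<Longrightarrow> word_val (dval k m b) (eword k m j) = (if b = j then adj 0 else 1)"
proof -
  assume j: "j \<in> {1..k}"
  have "rot m * rot m ^ (m-1) = 1" using gm m2 power_Suc[of "rot m" "m - 1"] by simp
  then show ?thesis
    unfolding eword_def word_val_simps(3) coord_dp nxt_prv[OF j] by (simp add: mult.assoc)
qed

text \<open>Letters d_i leave the block unchanged, so everything is checked in one block b. There
  each relation is one of Moore's for \<open>adj 0\<close> and \<open>rot m\<close>, or one of the
  two factors to be exchanged is 1.\<close>

lemma run_relV:
  assumes "(u, v) \<in> relV k m"
  shows "run k m u = run k m v"
proof -
  note cases = relV_cases[OF k2 assms]
  have "\<forall>a\<in>set u \<union> set v. \<exists>i. a = Dgen i"
    by (cases rule: cases) (auto simp: eword_def gword_def V5lhs_def set_word_power split: if_splits)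
  moreover have "word_val (dval k m b) u = word_val (dval k m b) v" for b
  proof -
    let ?w = "word_val (dval k m b)"
    show ?thesis
    proof (cases rule: cases)
      case 1
      then show ?thesis using e2 by (simp add: coord_eword power2_eq_square)
    next
      case (2 j)
      then have "u = dp j (m*(m-1))" "v = []" by simp_all
      then show ?thesis by (simp only: coord_dp(1) word_val_simps(1))
    next
      case (3 j)
      have "rot m * adj 0 = adj 0 * (adj 0 * rot m) * adj 0" using e2 by (simp flip: mult.assoc)
      then have "(rot m * adj 0) ^ (m-1) = 1" using conj_power[OF e2 e2] eg e2 by simp
      then show ?thesis using 3 by (simp add: coord_eword coord_gword)
    next
      case (4 j)
      \<comment> \<open>V4 and V5 are written with the product \<open>adj 0 * rot m\<close> in place
        of the transposition; its rotation is to be merged into the following power, raising each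
        exponent by one.\<close>
      have "m - 1 = Suc (m-2)" using m2 by simp
      then have "rot m * rot m ^ (m-2) = rot m ^ (m-1)" by simp
      then have "adj 0 * rot m * (rot m ^ (m-2) * (adj 0 * rot m)) = adj 0 * rot m ^ (m-1) * adj 0 * rot m"
        by (simp add: mult.assoc) (simp flip: mult.assoc)
      then have "(adj 0 * rot m * (rot m ^ (m-2) * (adj 0 * rot m))) ^ 3 = 1" using e3 by simp
      moreover have "?w u = ((if b = j then adj 0 * rot m else 1) * ((if b = j then rot m ^ (m-2) else 1)
          * (if b = j then adj 0 * rot m else 1))) ^ 3"
        using 4 nxt_prv[OF 4(2)] by (simp only: prod.inject word_val_simps(3,5) coord_dp)
      ultimately show ?thesis using 4 by simp
    next
      case (5 j t)
      have "m - t = Suc (m-t-1)" "t = Suc (t-1)" using 5 by auto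
      then have r: "rot m * rot m ^ (m-t-1) = rot m ^ (m-t)" "rot m * rot m ^ (t-1) = rot m ^ t"
        using power_Suc by metis+
      have "adj 0 * rot m * (rot m ^ (m-t-1) * (adj 0 * rot m * rot m ^ (t-1)))
          = adj 0 * (rot m * rot m ^ (m-t-1)) * adj 0 * (rot m * rot m ^ (t-1))"
        by (simp only: mult.assoc)
      then have "(adj 0 * rot m * (rot m ^ (m-t-1) * (adj 0 * rot m * rot m ^ (t-1)))) ^ 2 = 1"
        using ej[of t] 5 unfolding r by simp
      moreover have "?w u = ((if b = j then adj 0 * rot m else 1) * ((if b = j then rot m ^ (m-t-1) else 1)
          * ((if b = j then adj 0 * rot m else 1) * (if b = j then rot m ^ (t-1) else 1)))) ^ 2"
        using 5 nxt_prv[OF 5(2)] by (simp only: prod.inject V5lhs_def word_val_simps(3,5) coord_dp)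
      ultimately show ?thesis using 5 by simp
    next
      case (6 i j)
      let ?c = "\<lambda>i. if b = nxt k i then adj 0 * rot m else 1"
      have "?w u = ?c i * ?c j" "?w v = ?c j * ?c i"
        using 6 by (simp_all only: prod.inject word_val_simps(3,5) coord_dp)
      moreover have "nxt k i \<noteq> nxt k j" using 6 nxt_inj[of i k j] by auto
      ultimately show ?thesis by simp
    next
      case (7 i j)
      then show ?thesis by (simp add: coord_gword)
    next
      case (8 i j)
      have "?w u = (if b = i then rot m else 1) * (if b = j then adj 0 * rot m else 1)"
        "?w v = (if b = j then adj 0 * rot m else 1) * (if b = i then rot m else 1)"
        using 8 nxt_prv[OF 8(3)] by (simp_all only: prod.inject word_val_simps(3,5) coord_dp coord_gword)
      then show ?thesis using 8 by simp
    qed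
  qed
  ultimately show ?thesis by (intro ext) (auto simp: run_Dgen split: prod.splits)
qed

text \<open>Serves e and g together: it only matters that \<open>y j\<close> acts by a fixed
  permutation in block j and trivially elsewhere.\<close>

lemma run_actrel:
  assumes y: "\<And>b j. j \<in> {1..k} \<Longrightarrow> word_val (dval k m b) (y j) = (if b = j then Y else 1)"
    and D: "\<And>j. \<forall>a\<in>set (y j). \<exists>i. a = Dgen i"
    and uv: "(u, v) \<in> actrel k y"
  shows "run k m u = run k m v"
proof (rule ext)
  fix p :: "nat \<times> nat"
  obtain b r where p: "p = (b, r)" by fastforce
  have yr: "run k m (y j) (b, r) = Some (b, if b = j then app Y r else r)" if "j \<in> {1..k}" for j b r
    using run_Dgen[OF D] y[OF that] by simp
  have xr: "run k m (xg i) (b, r) = (if b \<in> {1..k} \<and> b \<noteq> xlo k i then Some (xmv k i b, r) else None)"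
    if "i < k" for i b r
    using xstep_eq[OF that k2] by (simp add: gstep_def)
  consider i j where "u = xg i @ y (xmv k i j)" "v = y j @ xg i" "i < k" "j \<in> {1..k}" "j \<noteq> xlo k i"
    | i where "u = xg i @ y (k - i)" "v = xg i" "i < k"
    | i where "u = y (xlo k i) @ xg i" "v = xg i" "i < k"
    using uv by (auto simp: actrel_def)
  then show "run k m u p = run k m v p"
  proof cases
    case 1
    have "xmv k i j \<in> {1..k}" using xmv_range 1 by blast
    then show ?thesis
      unfolding p 1(1,2) run_append using 1 xmv_inj[of i k b j]
      by (auto simp add: map_comp_def xr yr simp del: run.simps)
  next
    case 2
    have "k - i \<in> {1..k}" using 2 by auto
    then show ?thesis
      unfolding p 2(1,2) run_append using 2 xmv_range[of i k b]
      by (auto simp add: map_comp_def xr yr simp del: run.simps)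
  next
    case 3
    have "xlo k i \<in> {1..k}" using xlo_range 3 by blast
    then show ?thesis
      unfolding p 3(1,2) run_append using 3
      by (auto simp add: map_comp_def xr yr simp del: run.simps)
  qed
qed

lemma run_relV':
  assumes "(u, v) \<in> relV' k m"
  shows "run k m u = run k m v"
proof -
  have "\<forall>a\<in>set (eword k m j). \<exists>i. a = Dgen i" "\<forall>a\<in>set (gword m j). \<exists>i. a = Dgen i" for j
    by (auto simp: eword_def gword_def)
  then show ?thesis
    using assms run_actrel[OF coord_eword] run_actrel[OF coord_gword] unfolding relV'_eq[OF k2] by blast
qed

end

section \<open>The relations W hold for maps of blocks\<close>

text \<open>In terms of \<open>up\<close> the run starts with the highest block, k-i, whose move
  makes room for the next lower one; the place k-i+1 must be empty at the start.\<close>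

lemma bmap_upt:
  assumes "1 \<le> i" "i < j" "j \<le> k"
  shows "bmap k [i..<j] b = (if b \<in> {k-j+1..k-i} then Some (Suc b)
     else if b = Suc (k-i) \<or> b \<notin> {1..k} then None else Some b)"
proof -
  have "Suc i \<le> j" using assms by simp
  then show ?thesis using assms(3)
  proof (induction j rule: dec_induct)
    case base
    then have "{k - Suc i + 1..k - i} = {k - i}" by auto
    then show ?case using assms(1) base by (auto simp: xstep_def up_def)
  next
    case (step n)
    have "bmap k [i..<Suc n] b = (case bmap k [i..<n] b of None \<Rightarrow> None | Some c \<Rightarrow> up k (k - n) c)"
      using step assms(1) by (simp add: bmap_append xstep_def map_comp_def[of "up k (k - n)"])
    also have "bmap k [i..<n] b = (if b \<in> {k-n+1..k-i} then Some (Suc b)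
       else if b = Suc (k-i) \<or> b \<notin> {1..k} then None else Some b)"
      using step by simp
    finally show ?case using step assms(1) by (auto simp: up_def split: option.split)
  qed
qed

text \<open>The word in X that W uses as a generalized inverse of x_i, that is, the word of
  \<open>z (k - i)\<close>.\<close>

definition zlist :: "nat \<Rightarrow> nat \<Rightarrow> nat list" where
  "zlist k i = [Suc i..<k] @ [0..<i]"

lemma bmap_zlist:
  assumes "1 \<le> i" "i < k"
  shows "bmap k (zlist k i) = down k (k - i)"
proof (rule ext)
  fix b
  have z: "zlist k i = [Suc i..<k] @ 0 # [1..<i]"
    using assms by (simp add: zlist_def upt_conv_Cons)
  define L where "L = bmap k [Suc i..<k]"
  define R where "R = bmap k [1..<i]"
  \<comment> \<open>If \<open>Suc i = k\<close> the run is empty, and block k-i = 1 survives it, to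
    be dropped by the following \<open>shift\<close>.\<close>
  have L: "b \<in> {1..k} \<Longrightarrow> L b = (if b < k - i then Some (Suc b) else if b = k - i \<and> Suc i < k then None else Some b)" for b
  proof (cases "Suc i < k")
    case True
    then have "k - i = Suc (k - Suc i)" by simp
    then show "b \<in> {1..k} \<Longrightarrow> ?thesis" using bmap_upt[of "Suc i" k k b] True assms by (auto simp: L_def)
  next
    case False
    then have "k - i = 1" using assms by simp
    then show "b \<in> {1..k} \<Longrightarrow> ?thesis" using False by (auto simp: L_def)
  qed
  have R: "b \<in> {1..<k} \<Longrightarrow> R b = (if k - i < b then Some (Suc b) else Some b)" for b
  proof (cases "1 < i")
    case True
    then show "b \<in> {1..<k} \<Longrightarrow> ?thesis" using bmap_upt[of 1 i k b] assms by (auto simp: R_def)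
  next
    case False
    then show "b \<in> {1..<k} \<Longrightarrow> ?thesis" using assms by (auto simp: R_def)
  qed
  have B: "bmap k (zlist k i) b = (case L b of None \<Rightarrow> None | Some c \<Rightarrow> (case shift k k c of None \<Rightarrow> None | Some d \<Rightarrow> R d))"
    unfolding z bmap_append by (simp add: map_comp_def xstep_def L_def R_def split: option.splits)
  consider "b \<notin> {1..k}" | "b \<in> {1..k}" "b < k - i" | "b \<in> {1..k}" "b = k - i" | "b \<in> {1..k}" "k - i < b" by linarith
  then show "bmap k (zlist k i) b = down k (k - i) b"
  proof cases
    case 1
    have "L b = None \<or> L b = Some b"
    proof (cases "Suc i < k")
      case True
      then show ?thesis using bmap_upt[of "Suc i" k k b] 1 by (auto simp: L_def)
    qed (simp add: L_def)
    then show ?thesis using 1 assms B by (auto simp: down_def shift_def)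
  next
    case 2
    then show ?thesis using assms unfolding B by (auto simp: L R shift_def down_def)
  next
    case 3
    then show ?thesis using assms unfolding B by (auto simp: L R shift_def down_def)
  next
    case 4
    have "1 \<le> k - i" using assms by simp
    then have "b - 1 \<in> {1..<k}" using 4 by auto
    from R[OF this] show ?thesis using 4 assms unfolding B by (auto simp: L shift_def down_def)
  qed
qed

lemma relW_bmap:
  assumes k: "k \<ge> 2" and uv: "(u, v) \<in> relW k"
  shows "\<exists>is js. u = map Xgen is \<and> v = map Xgen js \<and> bmap k is = bmap k js"
proof -
  note S = xstep_def shift_def up_def map_comp_def
  have A1: "bmap k [i, 0] = bmap k [0, i+1]" if "1 \<le> i" "i \<le> k-2" for i
    using that k by (intro ext) (auto simp: S)
  have A2: "bmap k [j, i] = bmap k [i, j]" if "2 \<le> i+1" "i+1 < j" "j \<le> k-1" for i j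
    using that k by (intro ext) (auto simp: S)
  have A3: "bmap k [0, 0, 1] = bmap k [0, 0]" "bmap k [0, 0] = bmap k [k-1, 0, 0]"
    using k by (intro ext; auto simp: S)+
  have A4: "bmap k [i+1, i, i+1] = bmap k [i+1, i]" "bmap k [i+1, i] = bmap k [i, i+1, i]"
    if "1 \<le> i" "i \<le> k-2" for i
    using that k by (intro ext; auto simp: S)+
  have U: "bmap k [i] = up k (k-i)" if "1 \<le> i" for i using that by (simp add: xstep_def)
  have A6: "bmap k ([i..<k] @ [0..<i] @ [i]) = bmap k [i]" if "i \<le> k-1" for i
  proof (cases "i = 0")
    case True
    have "[i..<k] @ [0..<i] @ [i] = [0] @ [1..<k] @ [0]" using k True by (simp add: upt_conv_Cons)
    moreover have "bmap k ([0] @ [1..<k] @ [0]) b = bmap k [0] b" for b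
      using k by (auto simp: bmap_append map_comp_def bmap_upt xstep_def shift_def)
    ultimately show ?thesis using True by auto
  next
    case False
    then have E: "[i..<k] @ [0..<i] @ [i] = [i] @ zlist k i @ [i]" and i: "1 \<le> i" "i < k"
      using that k by (simp_all add: zlist_def upt_conv_Cons)
    have "bmap k ([i..<k] @ [0..<i] @ [i]) = up k (k-i) \<circ>\<^sub>m down k (k-i) \<circ>\<^sub>m up k (k-i)"
      unfolding E bmap_append U[OF i(1)] bmap_zlist[OF i] map_comp_assoc ..
    also have "\<dots> = up k (k-i)" using False that k by (intro ext) (auto simp: up_def down_def map_comp_def)
    finally show ?thesis using U[of i] False by simp
  qed
  have A7: "bmap k ([i+1..<k] @ [0..<i] @ [i, i]) = bmap k [i, i]" if "1 \<le> i" "i \<le> k-1" for i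
  proof -
    have E: "[i+1..<k] @ [0..<i] @ [i, i] = zlist k i @ [i] @ [i]" and i: "1 \<le> i" "i < k"
      using that k by (simp_all add: zlist_def)
    have "bmap k ([i+1..<k] @ [0..<i] @ [i, i]) = up k (k-i) \<circ>\<^sub>m up k (k-i) \<circ>\<^sub>m down k (k-i)"
      unfolding E bmap_append U[OF i(1)] bmap_zlist[OF i] map_comp_assoc ..
    also have "\<dots> = up k (k-i) \<circ>\<^sub>m up k (k-i)" using that k by (intro ext) (auto simp: up_def down_def map_comp_def)
    also have "\<dots> = bmap k ([i] @ [i])" using U[OF that(1)] by (simp only: bmap_append)
    finally show ?thesis by simp
  qed
  let ?E = "{(map Xgen is, map Xgen js) | is js. bmap k is = bmap k js}"
  have X: "(u, v) \<in> ?E" if "u = map Xgen is" "v = map Xgen js" "bmap k is = bmap k js" for u v "is" js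
    using that by blast
  have "relW k \<subseteq> ?E"
    unfolding relW_def
    apply (intro Un_least subsetI)
    subgoal using X[OF _ _ A1] by (elim CollectE exE conjE) (simp del: bmap.simps)
    subgoal using X[OF _ _ A2] by (elim CollectE exE conjE) (simp del: bmap.simps)
    subgoal using X[OF _ _ A3(1)] X[OF _ _ A3(2)] by (elim insertE emptyE) (simp_all del: bmap.simps)
    subgoal using X[OF _ _ A4(1)] by (elim CollectE exE conjE) (simp del: bmap.simps)
    subgoal using X[OF _ _ A4(2)] by (elim CollectE exE conjE) (simp del: bmap.simps)
    subgoal using X[OF _ _ A6] by (elim CollectE exE conjE) (simp del: bmap.simps)
    subgoal using X[OF _ _ A7] by (elim CollectE exE conjE) (simp del: bmap.simps)
    done
  then show ?thesis using uv by blast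
qed

lemma (in sizes) run_rels:
  assumes "(u, v) \<in> rels k m"
  shows "run k m u = run k m v"
proof -
  consider "(u, v) \<in> relV k m" | "(u, v) \<in> relW k" | "(u, v) \<in> relV' k m"
    using assms unfolding rels_def by blast
  then show ?thesis
  proof cases
    case 2
    then obtain "is" js where uv: "u = map Xgen is" "v = map Xgen js" "bmap k is = bmap k js"
      using relW_bmap[OF k2] by blast
    show ?thesis
    proof (rule ext)
      fix p show "run k m u p = run k m v p" unfolding uv(1,2) by (cases p) (simp add: run_Xgen uv(3))
    qed
  qed (simp_all add: run_relV run_relV')
qed

section \<open>Completeness of the relations\<close>

text \<open>An arbitrary assignment satisfying the relations: in the end the class action of the
  presented monoid, and once the trivial one.\<close>

locale rels_model = sizes k m for k m +
  fixes \<nu> :: "gen \<Rightarrow> 'a::monoid_mult"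
  assumes rels: "(u, v) \<in> rels k m \<Longrightarrow> word_val \<nu> u = word_val \<nu> v"
begin

abbreviation d :: "nat \<Rightarrow> 'a" where "d i \<equiv> \<nu> (Dgen i)"

abbreviation x :: "nat \<Rightarrow> 'a" where "x i \<equiv> \<nu> (Xgen i)"

definition e :: "nat \<Rightarrow> 'a" where "e j = word_val \<nu> (eword k m j)"

definition g :: "nat \<Rightarrow> 'a" where "g j = word_val \<nu> (gword m j)"

lemma V: "(u, v) \<in> relV k m \<Longrightarrow> word_val \<nu> u = word_val \<nu> v"
  and W: "(u, v) \<in> relW k \<Longrightarrow> word_val \<nu> u = word_val \<nu> v"
  and V': "(u, v) \<in> relV' k m \<Longrightarrow> word_val \<nu> u = word_val \<nu> v"
  using rels unfolding rels_def by blast+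

lemma d_power: assumes "j \<in> {1..k}" shows "d j ^ (m*(m-1)) = 1"
proof -
  have "(dp j (m*(m-1)), []) \<in> relV k m"
    unfolding relV_def relV2_eq using assms by blast
  from V[OF this] show ?thesis by simp
qed

lemmas d_decomp = power_decomposition[OF m2 d_power]

lemma g_eq: "g j = d j ^ (m-1)^2"
  by (simp add: g_def gword_def)

lemma e_eq: "j \<in> {1..k} \<Longrightarrow> e j = d (prv k j) ^ m * g j ^ (m-1)"
  using d_decomp(3)[of j] by (simp add: g_eq e_def eword_def)

lemma e_g: "j \<in> {1..k} \<Longrightarrow> e j * g j = d (prv k j) ^ m"
proof -
  assume j: "j \<in> {1..k}"
  have "g j ^ (m-1) * g j = g j ^ m" using m2 power_Suc2[of "g j" "m-1"] by simp
  then show ?thesis using d_decomp(1)[OF j] by (simp add: e_eq[OF j] mult.assoc g_eq)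
qed

lemma d_eq: "j \<in> {1..k} \<Longrightarrow> d j = g j * (e (nxt k j) * g (nxt k j))"
proof -
  assume j: "j \<in> {1..k}"
  then have n: "nxt k j \<in> {1..k}" "prv k (nxt k j) = j" by (auto simp: nxt_def prv_def)
  show ?thesis unfolding e_g[OF n(1)] n(2) g_eq[of j] using d_decomp(4)[OF j] by simp
qed

text \<open>V4 and V5 are stated with c = d_i^m, i the preceding block. Since c is the product of
  e_j and g_j, each e_j is c times the inverse of g_j, and this inverse lowers the following power
  of g_j by one: Moore's words become those of V.\<close>

lemma moore_e_g:
  assumes j: "j \<in> {1..k}"
  shows "moore (e j) (g j) m"
proof -
  let ?c = "d (prv k j) ^ m"
  have gm: "g j ^ m = 1" using d_decomp(1)[OF j] by (simp add: g_eq)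
  have gq: "word_val \<nu> (dp j ((m-1)^2 * n)) = g j ^ n" for n by (simp add: g_eq power_mult)
  have cq: "word_val \<nu> (dp (prv k j) m) = ?c" by simp
  have e: "e j = ?c * g j ^ (m-1)" by (rule e_eq[OF j])
  have red: "g j ^ (m-1) * (g j ^ Suc n * y) = g j ^ n * y" for n y
  proof -
    have "m - 1 + Suc n = m + n" using m2 by simp
    then have "g j ^ (m-1) * g j ^ Suc n = g j ^ n" unfolding power_add[symmetric] by (simp add: power_add gm)
    then show ?thesis by (simp flip: mult.assoc)
  qed
  have red1: "g j ^ (m-1) * g j = 1" using red[of 0 1] by simp
  show ?thesis
  proof
    show "m \<ge> 2" by (rule m2)
    show "g j ^ m = 1" by (rule gm)
    show "e j * e j = 1"
      using V[of "eword k m j ^^^ 2" "[]"] j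
      by (simp add: relV_def relV1_eq[OF k2] e_def power2_eq_square)
    show "(e j * g j) ^ (m-1) = 1"
      using d_decomp(2)[OF prv_range[OF j]] by (simp add: e_g[OF j])
    have "(?c * g j ^ (m-2) * ?c) ^ 3 = 1"
    proof -
      have "((dp (prv k j) m @ dp j ((m-1)^2*(m-2)) @ dp (prv k j) m) ^^^ 3, []) \<in> relV k m"
        using j unfolding relV_def relV4_eq[OF k2] by blast
      from V[OF this] show ?thesis unfolding word_val_simps(1,3,5) gq cq mult.assoc .
    qed
    moreover have "e j * g j ^ (m-1) * e j * g j = ?c * g j ^ (m-2) * ?c"
    proof -
      have "m - 1 = Suc (m-2)" using m2 by simp
      then have "g j ^ (m-1) * (g j ^ (m-1) * y) = g j ^ (m-2) * y" for y using red[of "m-2" y] by simp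
      then show ?thesis unfolding e using red1 by (simp add: mult.assoc)
    qed
    ultimately show "(e j * g j ^ (m-1) * e j * g j) ^ 3 = 1" by simp
    fix t assume t: "2 \<le> t" "t \<le> m - 2"
    have "(?c * g j ^ (m-t-1) * ?c * g j ^ (t-1)) ^ 2 = 1"
    proof -
      have "(V5lhs m t (prv k j) j, []) \<in> relV5 k m"
        unfolding relV5_eq[OF k2] using j t by (intro image_eqI[of _ _ "(j, t)"]) auto
      then have "word_val \<nu> (V5lhs m t (prv k j) j) = 1" using V[of _ "[]"] by (simp add: relV_def)
      then show ?thesis unfolding V5lhs_def word_val_simps(1,3,5) gq cq mult.assoc .
    qed
    moreover have "e j * g j ^ (m-t) * e j * g j ^ t = ?c * g j ^ (m-t-1) * ?c * g j ^ (t-1)"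
    proof -
      have "m - t = Suc (m-t-1)" "t = Suc (t-1)" using t by auto
      then have "g j ^ (m-1) * (g j ^ (m-t) * y) = g j ^ (m-t-1) * y"
        "g j ^ (m-1) * g j ^ t = g j ^ (t-1)" for y
        using red[of "m-t-1" y] red[of "t-1" 1] by auto
      then show ?thesis unfolding e by (simp only: mult.assoc)
    qed
    ultimately show "(e j * g j ^ (m-t) * e j * g j ^ t) ^ 2 = 1" by simp
  qed
qed

definition gv :: "nat \<Rightarrow> bool \<Rightarrow> 'a" where "gv j b = (if b then e j else g j)"

abbreviation \<pi> :: "nat \<Rightarrow> bool list \<Rightarrow> 'a" where "\<pi> j u \<equiv> word_val (gv j) u"

lemma \<pi>_faithful:
  assumes j: "j \<in> {1..k}" and "word_val (perm_val m) u = word_val (perm_val m) v"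
  shows "\<pi> j u = \<pi> j v"
proof -
  interpret M: moore "e j" "g j" m by (rule moore_e_g[OF j])
  have "M.val = gv j" by (rule ext) (simp add: M.val_def gv_def)
  then show ?thesis using M.moore_faithful[OF assms(2)] by simp
qed

lemma commute_power:
  fixes a b :: 'a
  assumes "a * b = b * a"
  shows "a * b ^ n = b ^ n * a"
  using assms by (metis power_commuting_commutes)

text \<open>V6 is about the g_i and the powers d_i^m, of which every e_j is a product. The one pair
  absent from V6, with i = \<open>prv k j\<close>, consists of powers of the same generator.\<close>

lemma coords_commute:
  assumes i: "i \<in> {1..k}" and j: "j \<in> {1..k}" and ij: "i \<noteq> j"
  shows "\<pi> i u * \<pi> j v = \<pi> j v * \<pi> i u"
proof -
  define c where "c j = d (prv k j) ^ m" for j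
  have cc: "d i ^ m * d j ^ m = d j ^ m * d i ^ m" if "i \<in> {1..k}" "j \<in> {1..k}" for i j
  proof -
    have *: "d i ^ m * d j ^ m = d j ^ m * d i ^ m" if "1 \<le> i" "i < j" "j \<le> k" for i j
    proof -
      have "(dp i m @ dp j m, dp j m @ dp i m) \<in> relV k m"
        using that unfolding relV_def relV6_def by blast
      from V[OF this] show ?thesis by simp
    qed
    consider "i < j" | "j < i" | "i = j" by linarith
    then show ?thesis using *[of i j] *[of j i] that by cases auto
  qed
  have gg: "g i * g j = g j * g i" if "i \<in> {1..k}" "j \<in> {1..k}" for i j
  proof -
    have *: "g i * g j = g j * g i" if "1 \<le> i" "i < j" "j \<le> k" for i j
    proof -
      have "(gword m i @ gword m j, gword m j @ gword m i) \<in> relV k m"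
        using that unfolding relV_def relV6_def gword_def by blast
      from V[OF this] show ?thesis by (simp add: g_def)
    qed
    consider "i < j" | "j < i" | "i = j" by linarith
    then show ?thesis using *[of i j] *[of j i] that by cases auto
  qed
  have gc: "g i * c j = c j * g i" if "i \<in> {1..k}" "j \<in> {1..k}" "i \<noteq> j" for i j
  proof (cases "i = prv k j")
    case True
    then show ?thesis by (simp add: c_def g_eq add.commute flip: power_add)
  next
    case False
    have "(gword m i @ dp (prv k j) m, dp (prv k j) m @ gword m i) \<in> relV6 k m"
      unfolding relV6_eq[OF k2] using that False by (intro UnI2 image_eqI[of _ _ "(i, j)"]) auto
    then have "(gword m i @ dp (prv k j) m, dp (prv k j) m @ gword m i) \<in> relV k m"
      by (simp add: relV_def)
    from V[OF this] show ?thesis by (simp add: g_def c_def)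
  qed
  have E: "e j = c j * g j ^ (m-1)" if "j \<in> {1..k}" for j
    using e_eq[OF that] by (simp add: c_def)
  have ge: "g i * e j = e j * g i" if "i \<in> {1..k}" "j \<in> {1..k}" "i \<noteq> j" for i j
    unfolding E[OF that(2)] using gc[OF that] commute_power[OF gg[OF that(1,2)], of "m-1"]
    by (metis mult.assoc)
  have ce: "c i * e j = e j * c i" if "i \<in> {1..k}" "j \<in> {1..k}" "i \<noteq> j" for i j
    unfolding E[OF that(2)]
    using cc[OF prv_range[OF that(1)] prv_range[OF that(2)]]
      commute_power[OF gc[OF that(2,1) that(3)[symmetric], symmetric], of "m-1"]
    by (metis mult.assoc c_def)
  have ee: "e i * e j = e j * e i" if "i \<in> {1..k}" "j \<in> {1..k}" "i \<noteq> j" for i j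
    unfolding E[OF that(1)]
    using ce[OF that] commute_power[OF ge[OF that, symmetric], of "m-1"]
    by (metis mult.assoc)
  have "gv i a * gv j b = gv j b * gv i a" for a b
    using gg[OF i j] ge[OF i j ij] ge[OF j i ij[symmetric]] ee[OF i j ij] by (auto simp: gv_def)
  then show ?thesis by (metis word_val_commute)
qed

lemma x_move:
  assumes "i < k" "j \<in> {1..k}" "j \<noteq> xlo k i"
  shows "x i * \<pi> (xmv k i j) u = \<pi> j u * x i"
proof -
  have "x i * e (xmv k i j) = e j * x i" "x i * g (xmv k i j) = g j * x i"
    using actrel_moveI[OF assms refl] V' unfolding relV'_eq[OF k2] e_def g_def by force+
  then have *: "x i * gv (xmv k i j) b = gv j b * x i" for b by (simp add: gv_def)
  show ?thesis
  proof (induction u)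
    case (Cons b u)
    have "x i * \<pi> (xmv k i j) (b # u) = x i * gv (xmv k i j) b * \<pi> (xmv k i j) u" by (simp add: mult.assoc)
    also have "\<dots> = gv j b * (x i * \<pi> (xmv k i j) u)" unfolding * by (simp add: mult.assoc)
    finally show ?case using Cons by (simp add: mult.assoc)
  qed simp
qed

lemma x_miss:
  assumes "i < k"
  shows "x i * \<pi> (k - i) u = x i"
proof -
  have "x i * e (k - i) = x i" "x i * g (k - i) = x i"
    using actrel_missI[OF assms refl] V' unfolding relV'_eq[OF k2] e_def g_def by force+
  then have *: "x i * gv (k - i) b = x i" for b by (simp add: gv_def)
  show ?thesis by (induction u) (simp_all add: * flip: mult.assoc)
qed

lemma x_kill:
  assumes "i < k"
  shows "\<pi> (xlo k i) u * x i = x i"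
proof -
  have "e (xlo k i) * x i = x i" "g (xlo k i) * x i = x i"
    using actrel_killI[OF assms refl] V' unfolding relV'_eq[OF k2] e_def g_def by force+
  then have *: "gv (xlo k i) b * x i = x i" for b by (simp add: gv_def)
  show ?thesis by (induction u) (simp_all add: * mult.assoc)
qed

sublocale X: poi_monoid k "x 0" "\<lambda>a. x (k - a)"
proof
  have word: "word_val \<nu> (map Xgen is) = word_val x is" for "is"
    by (simp add: word_val_def comp_def)
  have W': "word_val x is = word_val x js" if "(map Xgen is, map Xgen js) \<in> relW k" for "is" js
    using W[OF that] unfolding word .
  \<comment> \<open>Descending in a means ascending in the index k-a of x.\<close>
  have desc: "desc (\<lambda>a. x (k - a)) n r = word_val x [Suc (k-n)..<Suc (k-r)]" if "r \<le> n" "n \<le> k" for n r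
    using that
  proof (induction n rule: dec_induct)
    case (step n)
    have "[Suc (k - Suc n)..<Suc (k-r)] = (k - n) # [Suc (k-n)..<Suc (k-r)]"
      using step by (simp add: upt_conv_Cons Suc_diff_Suc del: upt_Suc)
    then show ?case using step by (simp add: desc_Suc del: upt_Suc)
  qed simp
  show "k \<ge> 2" by (rule k2)
  show "x (k - Suc a) * x 0 = x 0 * x (k - a)" if "1 \<le> a" "Suc a < k" for a
  proof -
    define i where "i = k - Suc a"
    have i: "1 \<le> i" "i \<le> k-2" "k - a = i+1" using that by (auto simp: i_def)
    have "(map Xgen [i, 0], map Xgen [0, i+1]) \<in> relW k"
      unfolding relW_def using i by auto
    from W'[OF this] show ?thesis by (simp add: i(3) flip: i_def)
  qed
  show "x (k - a) * x (k - b) = x (k - b) * x (k - a)" if "1 \<le> a" "a + 2 \<le> b" "b < k" for a b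
  proof -
    define i where "i = k - b"
    define j where "j = k - a"
    have ij: "2 \<le> i+1" "i+1 < j" "j \<le> k-1" using that by (auto simp: i_def j_def)
    have "(map Xgen [j, i], map Xgen [i, j]) \<in> relW k"
      unfolding relW_def using ij by auto
    from W'[OF this] show ?thesis by (simp flip: i_def j_def)
  qed
  have "(map Xgen [0, 0, 1], map Xgen [0, 0]) \<in> relW k" "(map Xgen [0, 0], map Xgen [k-1, 0, 0]) \<in> relW k"
    unfolding relW_def by auto
  from this[THEN W'] show "x 0 * x 0 * x (k - (k - 1)) = x 0 * x 0" "x (k - 1) * (x 0 * x 0) = x 0 * x 0"
    using k2 by (auto simp: mult.assoc)
  show "x (k - a) * x (k - Suc a) * x (k - a) = x (k - a) * x (k - Suc a)"
    "x (k - Suc a) * x (k - a) * x (k - Suc a) = x (k - a) * x (k - Suc a)" if "1 \<le> a" "Suc a < k" for a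
  proof -
    define i where "i = k - Suc a"
    have i: "1 \<le> i" "i \<le> k-2" "k - a = i+1" using that by (auto simp: i_def)
    have "(map Xgen [i+1, i, i+1], map Xgen [i+1, i]) \<in> relW k" "(map Xgen [i+1, i], map Xgen [i, i+1, i]) \<in> relW k"
      unfolding relW_def using i by auto
    from this[THEN W'] show "x (k - a) * x (k - Suc a) * x (k - a) = x (k - a) * x (k - Suc a)"
      "x (k - Suc a) * x (k - a) * x (k - Suc a) = x (k - a) * x (k - Suc a)"
      by (simp_all add: i(3) mult.assoc flip: i_def)
  qed
  have zl: "desc (\<lambda>a. x (k - a)) a 1 * x 0 * desc (\<lambda>a. x (k - a)) k (Suc a) = word_val x ([Suc i..<k] @ [0..<i])"
    if "1 \<le> i" "i < k" "a = k - i" for a i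
  proof -
    have "[0..<i] = 0 # [1..<i]" using that by (simp add: upt_conv_Cons)
    moreover have "Suc (k - Suc a) = i" "Suc (k - a) = Suc i" "Suc (k - 1) = k" using that by auto
    ultimately show ?thesis using desc[of 1 a] desc[of "Suc a" k] that by (simp add: mult.assoc)
  qed
  show "x (k - a) * (desc (\<lambda>a. x (k - a)) a 1 * x 0 * desc (\<lambda>a. x (k - a)) k (Suc a)) * x (k - a) = x (k - a)"
    if "1 \<le> a" "a < k" for a
  proof -
    define i where "i = k - a"
    have i: "1 \<le> i" "i < k" "a = k - i" using that by (auto simp: i_def)
    have "(map Xgen ([i..<k] @ [0..<i] @ [i]), map Xgen [i]) \<in> relW k"
      unfolding relW_def using i by auto
    from W'[OF this] have "word_val x ([i..<k] @ [0..<i] @ [i]) = x i" by simp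
    moreover have "[i..<k] = i # [Suc i..<k]" using i by (simp add: upt_conv_Cons)
    ultimately show ?thesis unfolding zl[OF i] by (simp add: mult.assoc flip: i_def)
  qed
  show "x 0 * desc (\<lambda>a. x (k - a)) k 1 * x 0 = x 0"
  proof -
    have "(map Xgen ([0..<k] @ [0..<0] @ [0]), map Xgen [0]) \<in> relW k"
      unfolding relW_def by auto
    from W'[OF this] have "word_val x ([0..<k] @ [0]) = x 0" by simp
    moreover have "[0..<k] = 0 # [1..<k]" using k2 by (simp add: upt_conv_Cons)
    ultimately show ?thesis using desc[of 1 k] k2 by (simp add: mult.assoc)
  qed
  show "desc (\<lambda>a. x (k - a)) a 1 * x 0 * desc (\<lambda>a. x (k - a)) k (Suc a) * (x (k - a) * x (k - a)) = x (k - a) * x (k - a)"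
    if "1 \<le> a" "a < k" for a
  proof -
    define i where "i = k - a"
    have i: "1 \<le> i" "i < k" "a = k - i" using that by (auto simp: i_def)
    have "(map Xgen ([i+1..<k] @ [0..<i] @ [i, i]), map Xgen [i, i]) \<in> relW k"
      unfolding relW_def using i by auto
    from W'[OF this] have "word_val x ([Suc i..<k] @ [0..<i]) * (x i * x i) = x i * x i" by (simp add: mult.assoc)
    then show ?thesis unfolding zl[OF i] by (simp flip: i_def)
  qed
qed

text \<open>The restriction to 1..k is there because the map of the empty word is
  \<open>Some\<close> on all numbers.\<close>

lemma track_word:
  "set is \<subseteq> {..<k} \<Longrightarrow> X.track (word_val x is) (bmap k is |` {1..k})"
proof (induction "is")
  case Nil
  then show ?case using X.track_one by simp
next
  case (Cons i "is")
  have i: "i < k" using Cons.prems by simp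
  have "X.track (x i) (xstep k i)"
    using X.track_D X.track_s[of "k - i"] i by (cases "i = 0") (auto simp: xstep_def)
  from X.track_mult[OF this] have "X.track (word_val x (i # is)) ((bmap k is |` {1..k}) \<circ>\<^sub>m xstep k i)"
    using Cons by simp
  moreover have "(bmap k is |` {1..k}) \<circ>\<^sub>m xstep k i = bmap k (i # is) |` {1..k}"
    using xmv_range[OF i] by (intro ext) (auto simp: map_comp_def xstep_eq[OF i k2] restrict_map_def)
  ultimately show ?case by simp
qed

end

section \<open>The block map of a word is strictly increasing\<close>

context sizes
begin

lemma xmv_mono: "i < k \<Longrightarrow> b \<in> {1..k} \<Longrightarrow> b' \<in> {1..k} \<Longrightarrow> b \<noteq> xlo k i \<Longrightarrow> b' \<noteq> xlo k i \<Longrightarrow>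
    b < b' \<Longrightarrow> xmv k i b < xmv k i b'"
  by (auto simp: xlo_def xmv_def)

lemma bmap_range:
  "set is \<subseteq> {..<k} \<Longrightarrow> b \<in> {1..k} \<Longrightarrow> bmap k is b = Some c \<Longrightarrow> c \<in> {1..k}"
proof (induction "is" arbitrary: b)
  case (Cons i "is")
  then have i: "i < k" by simp
  have b: "b \<noteq> xlo k i" "bmap k is (xmv k i b) = Some c"
    using Cons.prems(2,3) by (auto simp: xstep_eq[OF i k2] map_comp_Some_iff split: if_splits)
  have "xmv k i b \<in> {1..k}" using xmv_range[OF i Cons.prems(2) b(1)] by blast
  then show ?case using Cons.IH b(2) Cons.prems(1) by simp
qed simp

lemma bmap_mono:
  "set is \<subseteq> {..<k} \<Longrightarrow> b \<in> {1..k} \<Longrightarrow> b' \<in> {1..k} \<Longrightarrow> bmap k is b = Some c \<Longrightarrow> bmap k is b' = Some c' \<Longrightarrow>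
    b < b' \<Longrightarrow> c < c'"
proof (induction "is" arbitrary: b b')
  case (Cons i "is")
  then have i: "i < k" by simp
  have b: "b \<noteq> xlo k i" "bmap k is (xmv k i b) = Some c" "b' \<noteq> xlo k i" "bmap k is (xmv k i b') = Some c'"
    using Cons.prems by (auto simp: xstep_eq[OF i k2] map_comp_Some_iff split: if_splits)
  have "xmv k i b \<in> {1..k}" "xmv k i b' \<in> {1..k}" "xmv k i b < xmv k i b'"
    using xmv_range[OF i] xmv_mono[OF i] Cons.prems b by blast+
  then show ?case using Cons.IH[of "xmv k i b" "xmv k i b'"] b Cons.prems(1) by simp
qed simp

lemma bmap_inj:
  assumes "set is \<subseteq> {..<k}" "b \<in> {1..k}" "b' \<in> {1..k}" "bmap k is b = Some c" "bmap k is b' = Some c"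
  shows "b = b'"
  using bmap_mono[OF assms] bmap_mono[OF assms(1,3,2,5,4)] by (cases b b' rule: linorder_cases) auto

end

section \<open>Normal forms: block permutations followed by a word in X\<close>

context rels_model
begin

text \<open>An element of block j to the right of the word is carried back, letter by letter,
  towards the block that the word sends to j. If there is none, it arrives at a letter whose image
  misses its current block, and is absorbed there.\<close>

lemma word_move:
  assumes "set is \<subseteq> {..<k}" "j \<in> {1..k}"
  shows "(\<exists>l\<in>{1..k}. bmap k is l = Some j \<and> word_val x is * \<pi> j u = \<pi> l u * word_val x is) \<or>
    (\<forall>b\<in>{1..k}. bmap k is b \<noteq> Some j) \<and> word_val x is * \<pi> j u = word_val x is"
  using assms(1)
proof (induction "is")
  case Nil
  then show ?case using assms(2) by simp
next
  case (Cons i "is")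
  then have i: "i < k" and s: "set is \<subseteq> {..<k}" by auto
  have pre: "b \<noteq> xlo k i \<and> bmap k is (xmv k i b) = Some j \<and> xmv k i b \<in> {1..k} - {k - i}"
    if "b \<in> {1..k}" "bmap k (i # is) b = Some j" for b
    using that xmv_range[OF i] by (auto simp: xstep_eq[OF i k2] map_comp_Some_iff split: if_splits)
  consider l where "l \<in> {1..k}" "bmap k is l = Some j" "word_val x is * \<pi> j u = \<pi> l u * word_val x is"
    | "\<forall>b\<in>{1..k}. bmap k is b \<noteq> Some j" "word_val x is * \<pi> j u = word_val x is"
    using Cons.IH[OF s] by blast
  then show ?case
  proof cases
    case (1 l)
    have eq: "word_val x (i # is) * \<pi> j u = x i * \<pi> l u * word_val x is"
      using 1(3) by (simp add: mult.assoc)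
    show ?thesis
    proof (cases "l = k - i")
      case True
      then have "word_val x (i # is) * \<pi> j u = word_val x (i # is)"
        unfolding eq using x_miss[OF i] by simp
      moreover have "bmap k (i # is) b \<noteq> Some j" if "b \<in> {1..k}" for b
        using pre[OF that] bmap_inj[OF s _ 1(1) _ 1(2), of "xmv k i b"] True by blast
      ultimately show ?thesis by blast
    next
      case False
      then obtain l' where l': "l' \<in> {1..k}" "l' \<noteq> xlo k i" "xmv k i l' = l"
        using xmv_onto[OF i 1(1)] by blast
      have "word_val x (i # is) * \<pi> j u = \<pi> l' u * word_val x (i # is)"
        unfolding eq using x_move[OF i l'(1,2), of u] l'(3) by (simp add: mult.assoc)
      moreover have "bmap k (i # is) l' = Some j"
        using l' 1(2) by (simp add: xstep_eq[OF i k2] map_comp_Some_iff)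
      ultimately show ?thesis using l'(1) by blast
    qed
  next
    case 2
    then have "word_val x (i # is) * \<pi> j u = word_val x (i # is)" by (simp add: mult.assoc)
    moreover have "bmap k (i # is) b \<noteq> Some j" if "b \<in> {1..k}" for b
      using pre[OF that] 2(1) by blast
    ultimately show ?thesis by blast
  qed
qed

text \<open>The element is carried forward along the word up to the letter that is undefined on its
  current block.\<close>

lemma word_kill:
  "set is \<subseteq> {..<k} \<Longrightarrow> j \<in> {1..k} \<Longrightarrow> bmap k is j = None \<Longrightarrow> \<pi> j u * word_val x is = word_val x is"
proof (induction "is" arbitrary: j)
  case (Cons i "is")
  then have i: "i < k" and s: "set is \<subseteq> {..<k}" by auto
  show ?case
  proof (cases "j = xlo k i")
    case True
    then show ?thesis using x_kill[OF i, of u] by (simp flip: mult.assoc)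
  next
    case False
    then have "bmap k is (xmv k i j) = None" "xmv k i j \<in> {1..k}"
      using Cons.prems xmv_range[OF i] by (auto simp: xstep_eq[OF i k2])
    then have IH: "\<pi> (xmv k i j) u * word_val x is = word_val x is" using Cons.IH[OF s] by blast
    have "\<pi> j u * word_val x (i # is) = x i * (\<pi> (xmv k i j) u * word_val x is)"
      using x_move[OF i Cons.prems(2) False, of u] by (simp flip: mult.assoc)
    then show ?thesis unfolding IH by simp
  qed
qed simp

definition \<Phi> :: "(nat \<Rightarrow> bool list) \<Rightarrow> 'a" where "\<Phi> U = word_val (\<lambda>j. \<pi> j (U j)) [1..<Suc k]"

lemma \<Phi>_mult:
  assumes "j \<in> {1..k}"
  shows "\<Phi> U * \<pi> j v = \<Phi> (U(j := U j @ v))"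
proof -
  have "\<Phi> (U(j := U j @ v)) = word_val (\<lambda>i. \<pi> i (U i) * (if i = j then \<pi> j v else 1)) [1..<Suc k]"
    unfolding \<Phi>_def by (rule word_val_cong) auto
  also have "\<dots> = \<Phi> U * word_val (\<lambda>i. if i = j then \<pi> j v else 1) [1..<Suc k]"
    unfolding \<Phi>_def using assms by (intro word_val_mult) (auto intro: coords_commute)
  also have "word_val (\<lambda>i. if i = j then \<pi> j v else 1) [1..<Suc k] = \<pi> j v"
    using assms by (intro word_val_delta) auto
  finally show ?thesis ..
qed

text \<open>The new coordinates are described by their permutations, in terms of the block map; this
  is the form in which \<open>normal_form\<close> compares them with \<open>run\<close>.\<close>

lemma absorb:
  assumes s: "set is \<subseteq> {..<k}" and j: "j \<in> {1..k}"
  shows "\<exists>U'. \<Phi> U * word_val x is * \<pi> j v = \<Phi> U' * word_val x is \<and>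
    (\<forall>b\<in>{1..k}. word_val (perm_val m) (U' b) =
      word_val (perm_val m) (U b) * (if bmap k is b = Some j then word_val (perm_val m) v else 1))"
proof -
  consider l where "l \<in> {1..k}" "bmap k is l = Some j" "word_val x is * \<pi> j v = \<pi> l v * word_val x is"
    | "\<forall>b\<in>{1..k}. bmap k is b \<noteq> Some j" "word_val x is * \<pi> j v = word_val x is"
    using word_move[OF assms, of v] by blast
  then show ?thesis
  proof cases
    case (1 l)
    have "\<Phi> U * word_val x is * \<pi> j v = \<Phi> U * \<pi> l v * word_val x is"
      using 1(3) by (simp add: mult.assoc)
    also have "\<dots> = \<Phi> (U(l := U l @ v)) * word_val x is" unfolding \<Phi>_mult[OF 1(1)] ..
    finally have "\<Phi> U * word_val x is * \<pi> j v = \<Phi> (U(l := U l @ v)) * word_val x is" .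
    moreover have "bmap k is b = Some j \<longleftrightarrow> b = l" if "b \<in> {1..k}" for b
      using bmap_inj[OF s that 1(1) _ 1(2)] 1(2) by blast
    ultimately show ?thesis by (intro exI[of _ "U(l := U l @ v)"]) auto
  next
    case 2
    then show ?thesis by (intro exI[of _ U]) (simp add: mult.assoc)
  qed
qed

text \<open>The same U and the same word in X describe both the value in the unknown model and the
  action \<open>run\<close>. This is what lets equality of actions be turned into equality of
  values.\<close>

lemma normal_form:
  assumes "w \<in> lists (gens k)"
  shows "\<exists>U is. set is \<subseteq> {..<k} \<and> word_val \<nu> w = \<Phi> U * word_val x is \<and>
    (\<forall>b\<in>{1..k}. \<forall>r. run k m w (b, r) =
      map_option (\<lambda>c. (c, app (word_val (perm_val m) (U b)) r)) (bmap k is b))"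
  using assms
proof (induction w rule: rev_induct)
  case Nil
  have "\<Phi> (\<lambda>_. []) = 1" unfolding \<Phi>_def by (rule word_val_trivial) simp
  then show ?case by (intro exI[of _ "\<lambda>_. []"] exI[of _ "[]"]) simp
next
  case (snoc a w)
  then obtain U "is" where IH: "set is \<subseteq> {..<k}" "word_val \<nu> w = \<Phi> U * word_val x is"
    "\<And>b r. b \<in> {1..k} \<Longrightarrow> run k m w (b, r) =
      map_option (\<lambda>c. (c, app (word_val (perm_val m) (U b)) r)) (bmap k is b)" by auto
  have a: "a \<in> gens k" using snoc.prems by simp
  show ?case
  proof (cases a)
    case (Xgen i)
    then have i: "i < k" using a k2 by (simp add: Xgen_in_gens)
    have "run k m (w @ [a]) (b, r) =
        map_option (\<lambda>c. (c, app (word_val (perm_val m) (U b)) r)) (bmap k (is @ [i]) b)"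
      if "b \<in> {1..k}" for b r
      unfolding run_append bmap_append Xgen using IH(3)[OF that]
      by (cases "bmap k is b") (auto simp: map_comp_def gstep_def split: option.splits)
    then show ?thesis using IH(1,2) i Xgen
      by (intro exI[of _ U] exI[of _ "is @ [i]"]) (simp add: mult.assoc)
  next
    case (Dgen i)
    then have i: "i \<in> {1..k}" "nxt k i \<in> {1..k}" using a by (auto simp: Dgen_in_gens nxt_def)
    \<comment> \<open>By \<open>d_eq\<close> the letter is g_i times a product e g in the next
      block; the two parts are pushed to the left one after the other.\<close>
    obtain U1 where U1: "\<Phi> U * word_val x is * \<pi> i [False] = \<Phi> U1 * word_val x is"
      "\<And>b. b \<in> {1..k} \<Longrightarrow> word_val (perm_val m) (U1 b) = word_val (perm_val m) (U b) *
        (if bmap k is b = Some i then word_val (perm_val m) [False] else 1)"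
      using absorb[OF IH(1) i(1)] by blast
    obtain U2 where U2: "\<Phi> U1 * word_val x is * \<pi> (nxt k i) [True, False] = \<Phi> U2 * word_val x is"
      "\<And>b. b \<in> {1..k} \<Longrightarrow> word_val (perm_val m) (U2 b) = word_val (perm_val m) (U1 b) *
        (if bmap k is b = Some (nxt k i) then word_val (perm_val m) [True, False] else 1)"
      using absorb[OF IH(1) i(2)] by blast
    have "word_val \<nu> (w @ [a]) = \<Phi> U * word_val x is * \<pi> i [False] * \<pi> (nxt k i) [True, False]"
      using IH(2) d_eq[OF i(1)] Dgen by (simp add: gv_def mult.assoc)
    then have "word_val \<nu> (w @ [a]) = \<Phi> U2 * word_val x is" unfolding U1(1) U2(1) .
    moreover have "run k m (w @ [a]) (b, r) =
        map_option (\<lambda>c. (c, app (word_val (perm_val m) (U2 b)) r)) (bmap k is b)"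
      if "b \<in> {1..k}" for b r
    proof (cases "bmap k is b")
      case None
      then show ?thesis using IH(3)[OF that] by (simp add: run_append map_comp_def)
    next
      case (Some c)
      have "run k m (w @ [a]) (b, r) = Some (c, app (dval k m c a) (app (word_val (perm_val m) (U b)) r))"
        using IH(3)[OF that, of r] Some Dgen by (simp add: run_append map_comp_def gstep_def)
      moreover have "word_val (perm_val m) (U2 b) = word_val (perm_val m) (U b) * dval k m c a"
        using U1(2)[OF that] U2(2)[OF that] Some Dgen nxt_neq[OF k2, of i]
        by (auto simp: dval_def perm_val_def mult.assoc)
      ultimately show ?thesis using Some by simp
    qed
    ultimately show ?thesis using IH(1) by blast
  qed
qed

text \<open>Since \<open>run\<close> shows the coordinates only on the domain of the block map, the
  remaining ones have to be erased, by \<open>word_kill\<close>, before two normal forms can be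
  compared.\<close>

lemma \<Phi>_cong_dom:
  assumes s: "set is \<subseteq> {..<k}"
    and eq: "\<And>b. b \<in> {1..k} \<Longrightarrow> bmap k is b \<noteq> None \<Longrightarrow> \<pi> b (U b) = \<pi> b (U' b)"
  shows "\<Phi> U * word_val x is = \<Phi> U' * word_val x is"
proof -
  let ?V = "\<lambda>U j. if bmap k is j = None then [] else U j"
  have *: "\<Phi> U * word_val x is = word_val (\<lambda>j. \<pi> j (?V U j)) [1..<Suc k] * word_val x is" for U
  proof -
    have "word_val (\<lambda>j. \<pi> j (U j)) L * word_val x is = word_val (\<lambda>j. \<pi> j (?V U j)) L * word_val x is"
      if "set L \<subseteq> {1..k}" "distinct L" for L
      using that
    proof (induction L)
      case (Cons j L)
      let ?w = "word_val (\<lambda>j. \<pi> j (?V U j)) L"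
      have j: "j \<in> {1..k}" using Cons.prems by simp
      have IH: "word_val (\<lambda>j. \<pi> j (U j)) L * word_val x is = ?w * word_val x is" using Cons by simp
      have 1: "word_val (\<lambda>j. \<pi> j (U j)) (j # L) * word_val x is = \<pi> j (U j) * (?w * word_val x is)"
        unfolding IH[symmetric] by (simp add: mult.assoc)
      show ?case
      proof (cases "bmap k is j = None")
        case True
        have "?w * \<pi> j (U j) = \<pi> j (U j) * ?w"
          using Cons.prems j by (intro word_val_commute coords_commute) auto
        then have "\<pi> j (U j) * (?w * word_val x is) = ?w * (\<pi> j (U j) * word_val x is)"
          by (simp flip: mult.assoc)
        also have "\<dots> = ?w * word_val x is" unfolding word_kill[OF s j True] ..
        finally show ?thesis unfolding 1 using True by simp
      next
        case False
        then show ?thesis unfolding 1 by (auto simp: mult.assoc)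
      qed
    qed simp
    from this[of "[1..<Suc k]"] show ?thesis unfolding \<Phi>_def by (simp only: set_upt atLeastLessThanSuc_atLeastAtMost order_refl distinct_upt)
  qed
  have "word_val (\<lambda>j. \<pi> j (?V U j)) [1..<Suc k] = word_val (\<lambda>j. \<pi> j (?V U' j)) [1..<Suc k]"
    by (rule word_val_cong) (auto simp: eq)
  then show ?thesis unfolding *[of U] *[of U'] by simp
qed

text \<open>The action determines the block map, hence the word in X by
  \<open>X.track_unique\<close>, and in each block of the domain a permutation, hence the coordinate
  by Moore's theorem.\<close>

theorem complete:
  assumes w: "w \<in> lists (gens k)" "w' \<in> lists (gens k)"
    and eq: "\<And>b r. b \<in> {1..k} \<Longrightarrow> r < m \<Longrightarrow> run k m w (b, r) = run k m w' (b, r)"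
  shows "word_val \<nu> w = word_val \<nu> w'"
proof -
  obtain U "is" where N: "set is \<subseteq> {..<k}" "word_val \<nu> w = \<Phi> U * word_val x is"
    "\<And>b r. b \<in> {1..k} \<Longrightarrow> run k m w (b, r) =
      map_option (\<lambda>c. (c, app (word_val (perm_val m) (U b)) r)) (bmap k is b)"
    using normal_form[OF w(1)] by blast
  obtain U' js where N': "set js \<subseteq> {..<k}" "word_val \<nu> w' = \<Phi> U' * word_val x js"
    "\<And>b r. b \<in> {1..k} \<Longrightarrow> run k m w' (b, r) =
      map_option (\<lambda>c. (c, app (word_val (perm_val m) (U' b)) r)) (bmap k js b)"
    using normal_form[OF w(2)] by blast
  have E: "map_option (\<lambda>c. (c, app (word_val (perm_val m) (U b)) r)) (bmap k is b) =
      map_option (\<lambda>c. (c, app (word_val (perm_val m) (U' b)) r)) (bmap k js b)"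
    if "b \<in> {1..k}" "r < m" for b r
    using eq[OF that] N(3)[OF that(1)] N'(3)[OF that(1)] by simp
  have B: "bmap k is b = bmap k js b" if "b \<in> {1..k}" for b
    \<comment> \<open>The block component does not depend on the position, so position 0 may be
      used.\<close>
    using E[OF that, of 0] m2 by (cases "bmap k is b"; cases "bmap k js b") auto
  have "bmap k is |` {1..k} = bmap k js |` {1..k}"
    using B by (intro ext) (simp add: restrict_map_def)
  then have X: "word_val x is = word_val x js"
    using X.track_unique[OF track_word[OF N(1)]] track_word[OF N'(1)] by simp
  have "\<pi> b (U b) = \<pi> b (U' b)" if b: "b \<in> {1..k}" "bmap k is b \<noteq> None" for b
  proof (rule \<pi>_faithful[OF b(1)], rule endo_eqI)
    fix r
    show "app (word_val (perm_val m) (U b)) r = app (word_val (perm_val m) (U' b)) r"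
    proof (cases "r < m")
      case True
      then show ?thesis using E[OF b(1) True] B[OF b(1)] b(2) by auto
    next
      case False
      then have "r \<notin> {..<m}" by simp
      then show ?thesis using perm_val_permutes[OF m2] by (metis permutes_not_in)
    qed
  qed
  then have "\<Phi> U * word_val x is = \<Phi> U' * word_val x is" by (rule \<Phi>_cong_dom[OF N(1)])
  then show ?thesis using N(2) N'(2) X by simp
qed

end

section \<open>Surjectivity\<close>

definition order_inj :: "nat \<Rightarrow> (nat \<rightharpoonup> nat) \<Rightarrow> bool" where
  "order_inj k f \<longleftrightarrow> dom f \<subseteq> {1..k} \<and> ran f \<subseteq> {1..k} \<and>
     (\<forall>b b' c c'. f b = Some c \<longrightarrow> f b' = Some c' \<longrightarrow> b < b' \<longrightarrow> c < c')"

lemma order_injD: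
  assumes "order_inj k f" "f b = Some c"
  shows "b \<in> {1..k}" "c \<in> {1..k}" "f b' = Some c' \<Longrightarrow> b < b' \<longleftrightarrow> c < c'" "f b' = Some c' \<Longrightarrow> b = b' \<longleftrightarrow> c = c'"
proof -
  have 1: "\<And>b b' c c'. f b = Some c \<Longrightarrow> f b' = Some c' \<Longrightarrow> b < b' \<Longrightarrow> c < c'"
    using assms by (auto simp: order_inj_def)
  show "b \<in> {1..k}" "c \<in> {1..k}" using assms by (auto simp: order_inj_def ran_def)
  show "b < b' \<longleftrightarrow> c < c'" "b = b' \<longleftrightarrow> c = c'" if "f b' = Some c'"
    using 1[OF assms(2) that] 1[OF that assms(2)] assms(2) that
    by (cases b b' rule: linorder_cases; auto)+
qed

section \<open>Every order-preserving partial injection of the chain comes from a word\<close>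

context sizes
begin

definition realized :: "(nat \<rightharpoonup> nat) \<Rightarrow> bool" where
  "realized f \<longleftrightarrow> (\<exists>is. set is \<subseteq> {..<k} \<and> bmap k is |` {1..k} = f)"

lemma realized_comp:
  assumes "realized f" "realized g"
  shows "realized (g \<circ>\<^sub>m f)"
proof -
  obtain u v where u: "set u \<subseteq> {..<k}" "bmap k u |` {1..k} = f"
    and v: "set v \<subseteq> {..<k}" "bmap k v |` {1..k} = g" using assms by (auto simp: realized_def)
  have "bmap k (u @ v) |` {1..k} = g \<circ>\<^sub>m f"
  proof (rule ext)
    fix b
    show "(bmap k (u @ v) |` {1..k}) b = (g \<circ>\<^sub>m f) b"
    proof (cases "b \<in> {1..k} \<and> bmap k u b \<noteq> None")
      case True
      then obtain c where c: "bmap k u b = Some c" by auto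
      then have "c \<in> {1..k}" using bmap_range[OF u(1)] True by blast
      then show ?thesis using True c unfolding u(2)[symmetric] v(2)[symmetric] by (simp add: bmap_append)
    next
      case False
      then show ?thesis unfolding u(2)[symmetric] by (auto simp: bmap_append map_comp_def restrict_map_def)
    qed
  qed
  then show ?thesis unfolding realized_def using u v by (intro exI[of _ "u @ v"]) auto
qed

lemma realized_up: "1 \<le> a \<Longrightarrow> a < k \<Longrightarrow> realized (up k a)"
  unfolding realized_def
  by (intro exI[of _ "[k - a]"]) (auto simp: xstep_def up_def restrict_map_def intro!: ext)

lemma realized_down: "1 \<le> a \<Longrightarrow> a < k \<Longrightarrow> realized (down k a)"
proof -
  assume a: "1 \<le> a" "a < k"
  then have "bmap k (zlist k (k - a)) = down k a" using bmap_zlist[of "k - a" k] by simp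
  moreover have "down k a |` {1..k} = down k a" using a by (auto simp: down_def restrict_map_def intro!: ext)
  moreover have "set (zlist k (k - a)) \<subseteq> {..<k}" using a by (auto simp: zlist_def)
  ultimately show ?thesis unfolding realized_def by (intro exI[of _ "zlist k (k - a)"]) simp
qed

lemma realized_restriction:
  assumes "A \<subseteq> {1..k}"
  shows "realized (Some |` A)"
proof -
  have single: "realized (Some |` ({1..k} - {j}))" if j: "j \<in> {1..k}" for j
  \<comment> \<open>A point above 1 is removed by raising and lowering its lower neighbour; the
    point 1 has none and is removed by lowering 2 and raising it again.\<close>
  proof (cases "j = 1")
    case True
    have "up k 1 \<circ>\<^sub>m down k 1 = Some |` ({1..k} - {j})"
      using k2 True by (auto simp: up_def down_def map_comp_def restrict_map_def intro!: ext)
    then show ?thesis using realized_comp[OF realized_down[of 1] realized_up[of 1]] k2 by simp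
  next
    case False
    have "down k (j - 1) \<circ>\<^sub>m up k (j - 1) = Some |` ({1..k} - {j})"
      using j False by (auto simp: up_def down_def map_comp_def restrict_map_def intro!: ext)
    moreover have "1 \<le> j - 1" "j - 1 < k" using j False by auto
    ultimately show ?thesis using realized_comp realized_up realized_down by metis
  qed
  have "realized (Some |` ({1..k} - B))" if "finite B" "B \<subseteq> {1..k}" for B
    using that
  proof (induction B rule: finite_induct)
    case empty
    show ?case unfolding realized_def by (intro exI[of _ "[]"]) simp
  next
    case (insert j B)
    have "(Some |` ({1..k} - {j})) \<circ>\<^sub>m (Some |` ({1..k} - B)) = Some |` ({1..k} - insert j B)"
      by (auto simp: map_comp_def restrict_map_def intro!: ext)
    then show ?case using realized_comp[OF insert.IH single[of j]] insert.prems by auto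
  qed
  from this[of "{1..k} - A"] show ?thesis using assms by (simp add: double_diff)
qed

text \<open>Send b to n instead of c and let g make the move from n to c afterwards;
  \<open>lo\<close> and \<open>hi\<close> place n strictly between the images of the points below
  and above b, so the intermediate map stays increasing.\<close>

lemma realized_step:
  assumes f: "order_inj k f" and b: "f b = Some c" and n: "n \<noteq> c" "n \<in> {1..k}"
    and lo: "\<And>b' c'. f b' = Some c' \<Longrightarrow> b' < b \<Longrightarrow> c' < n"
    and hi: "\<And>b' c'. f b' = Some c' \<Longrightarrow> b < b' \<Longrightarrow> n < c'"
    and g: "realized g" "g n = Some c"
    and fix': "\<And>y. y \<in> {1..k} \<Longrightarrow> y \<noteq> n \<Longrightarrow> y \<noteq> c \<Longrightarrow> g y = Some y"
    and IH: "order_inj k (f(b \<mapsto> n)) \<Longrightarrow> realized (f(b \<mapsto> n))"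
  shows "realized f"
proof -
  have bk: "b \<in> {1..k}" using order_injD[OF f b] by blast
  have "order_inj k (f(b \<mapsto> n))"
  proof -
    have "c1 < c2" if "(f(b \<mapsto> n)) b1 = Some c1" "(f(b \<mapsto> n)) b2 = Some c2" "b1 < b2" for b1 b2 c1 c2
      using that lo hi order_injD(3)[OF f] by (auto split: if_splits)
    moreover have "dom (f(b \<mapsto> n)) \<subseteq> {1..k}" "ran (f(b \<mapsto> n)) \<subseteq> {1..k}"
      using f bk n(2) by (auto simp: order_inj_def ran_def)
    ultimately show ?thesis unfolding order_inj_def by blast
  qed
  then have "realized (g \<circ>\<^sub>m f(b \<mapsto> n))" using IH realized_comp g(1) by blast
  moreover have "g \<circ>\<^sub>m f(b \<mapsto> n) = f"
  proof (rule ext)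
    fix b'
    show "(g \<circ>\<^sub>m f(b \<mapsto> n)) b' = f b'"
    proof (cases "b' = b \<or> f b' = None")
      case True
      then show ?thesis using b g(2) by (auto simp: map_comp_def)
    next
      case False
      then obtain c' where c': "f b' = Some c'" "b' \<noteq> b" by auto
      have "c' \<noteq> n" using lo[OF c'(1)] hi[OF c'(1)] c'(2) by (cases b b' rule: linorder_cases) auto
      moreover have "c' \<noteq> c" using order_injD(4)[OF f c'(1) b] c'(2) by blast
      ultimately show ?thesis using c' fix'[of c'] order_injD(2)[OF f c'(1)] by (simp add: map_comp_def)
    qed
  qed
  ultimately show ?thesis by simp
qed

text \<open>Induction on the total displacement. The lowest point that moves up makes its last step
  last: the points below it do not end above their starts, so the place just below its target is
  free. If no point moves up, the highest one that moves down is treated likewise.\<close>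

lemma realized_order_inj:
  "order_inj k f \<Longrightarrow> realized f"
proof (induction "\<Sum>b\<in>dom f. (the (f b) - b) + (b - the (f b))" arbitrary: f rule: less_induct)
  case less
  let ?\<mu> = "\<lambda>f. \<Sum>b\<in>dom f. (the (f b) - b) + (b - the (f b))"
  note f = less.prems
  have fin: "finite (dom f)" using f finite_subset by (auto simp: order_inj_def)
  have dec: "?\<mu> (f(b \<mapsto> n)) < ?\<mu> f"
    if "f b = Some c" "(n - b) + (b - n) < (c - b) + (b - c)" for b c n
  proof -
    have d: "dom (f(b \<mapsto> n)) = dom f" using that by auto
    show ?thesis unfolding d using fin that by (intro sum_strict_mono_ex1) (auto simp: domI)
  qed
  show ?case
  proof (cases "\<forall>b c. f b = Some c \<longrightarrow> b = c")
    case True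
    then have "f = Some |` dom f" by (intro ext) (auto simp: restrict_map_def dom_def split: option.splits)
    then show ?thesis using realized_restriction[of "dom f"] f by (simp add: order_inj_def)
  next
    case False
    show ?thesis
    proof (cases "\<exists>b c. f b = Some c \<and> b < c")
      case True
      let ?S = "{b. \<exists>c. f b = Some c \<and> b < c}"
      have "?S \<subseteq> dom f" by auto
      then have S: "finite ?S" "?S \<noteq> {}" using fin finite_subset True by auto
      define b where "b = Min ?S"
      have "b \<in> ?S" unfolding b_def using S by (rule Min_in)
      then obtain c where c: "f b = Some c" "b < c" by auto
      have min: "c' \<le> b'" if "f b' = Some c'" "b' < b" for b' c'
        using Min_le[OF S(1), of b'] that by (fastforce simp: b_def[symmetric])
      obtain a where a: "c = Suc a" using c by (cases c) auto
      have bk: "b \<in> {1..k}" "c \<in> {1..k}" using order_injD[OF f c(1)] by auto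
      show ?thesis
      proof (rule realized_step[OF f c(1)])
        show "a \<noteq> c" "a \<in> {1..k}" using a c bk by auto
        show "c' < a" if "f b' = Some c'" "b' < b" for b' c'
          using min[OF that] that(2) a c(2) by simp
        show "a < c'" if "f b' = Some c'" "b < b'" for b' c'
          using order_injD(3)[OF f c(1) that(1)] that(2) a by simp
        show "realized (up k a)" using a c bk by (intro realized_up) auto
        show "up k a a = Some c" by (simp add: up_def a)
        show "up k a y = Some y" if "y \<in> {1..k}" "y \<noteq> a" "y \<noteq> c" for y using that by (auto simp: up_def a)
        show "realized (f(b \<mapsto> a))" if "order_inj k (f(b \<mapsto> a))"
          using less.hyps[OF dec[OF c(1), of a] that] a c(2) by simp
      qed
    next
      case nle: False
      then have "\<exists>b c. f b = Some c \<and> c < b" using False by (metis linorder_neqE_nat)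
      let ?S = "{b. \<exists>c. f b = Some c \<and> c < b}"
      have "?S \<subseteq> dom f" by auto
      then have S: "finite ?S" "?S \<noteq> {}" using fin finite_subset \<open>\<exists>b c. f b = Some c \<and> c < b\<close> by auto
      define b where "b = Max ?S"
      have "b \<in> ?S" unfolding b_def using S by (rule Max_in)
      then obtain c where c: "f b = Some c" "c < b" by auto
      have max: "b' \<le> c'" if "f b' = Some c'" "b < b'" for b' c'
        using Max_ge[OF S(1), of b'] that by (fastforce simp: b_def[symmetric])
      have bk: "b \<in> {1..k}" "c \<in> {1..k}" using order_injD[OF f c(1)] by auto
      show ?thesis
      proof (rule realized_step[OF f c(1)])
        show "Suc c \<noteq> c" "Suc c \<in> {1..k}" using c bk by auto
        show "c' < Suc c" if "f b' = Some c'" "b' < b" for b' c'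
          using order_injD(3)[OF f that(1) c(1)] that(2) by simp
        show "Suc c < c'" if "f b' = Some c'" "b < b'" for b' c'
          using max[OF that] that(2) c(2) by simp
        show "realized (down k c)" using c bk by (intro realized_down) auto
        show "down k c (Suc c) = Some c" by (simp add: down_def)
        show "down k c y = Some y" if "y \<in> {1..k}" "y \<noteq> Suc c" "y \<noteq> c" for y using that by (auto simp: down_def)
        show "realized (f(b \<mapsto> Suc c))" if "order_inj k (f(b \<mapsto> Suc c))"
          using less.hyps[OF dec[OF c(1), of "Suc c"] that] c(2) by simp
      qed
    qed
  qed
qed

lemma dword_exists:
  assumes "\<And>b. b \<in> {1..k} \<Longrightarrow> s b permutes {..<m}"
  obtains w where "w \<in> lists (gens k)" "\<And>b r. b \<in> {1..k} \<Longrightarrow> run k m w (b, r) = Some (b, s b r)"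
proof -
  have "\<exists>u. b \<in> {1..k} \<longrightarrow> word_val (perm_val m) u = Endo (s b)" for b
    using permutes_word[OF m2 assms] by blast
  then obtain U where U: "\<And>b. b \<in> {1..k} \<Longrightarrow> word_val (perm_val m) (U b) = Endo (s b)"
    by metis
  define cw where "cw j = concat (map (\<lambda>c. if c then eword k m j else gword m j) (U j))" for j
  have cw: "word_val (dval k m b) (cw j) = (if b = j then word_val (perm_val m) (U j) else 1)"
    if "j \<in> {1..k}" for b j
  proof -
    have "word_val (dval k m b) (concat (map (\<lambda>c. if c then eword k m j else gword m j) u)) =
        (if b = j then word_val (perm_val m) u else 1)" for u
    proof (induction u)
      case (Cons c u)
      have "perm_val m True = adj 0" "perm_val m False = rot m" by (simp_all add: perm_val_def)
      then show ?case using Cons by (cases c) (simp_all add: coord_eword[OF that] coord_gword)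
    qed simp
    then show ?thesis by (simp add: cw_def)
  qed
  define w where "w = concat (map cw [1..<Suc k])"
  have wc: "word_val \<nu> (concat (map cw L)) = word_val (\<lambda>j. word_val \<nu> (cw j)) L" for \<nu> :: "gen \<Rightarrow> nat endo" and L
    by (induction L) auto
  have "word_val (dval k m b) w = Endo (s b)" if "b \<in> {1..k}" for b
  proof -
    have "word_val (dval k m b) w = word_val (\<lambda>j. if j = b then Endo (s b) else 1) [1..<Suc k]"
      unfolding w_def wc using U that by (intro word_val_cong) (auto simp: cw)
    also have "\<dots> = Endo (s b)" using that by (intro word_val_delta) auto
    finally show ?thesis .
  qed
  moreover have D: "\<forall>a\<in>set w. \<exists>i\<in>{1..k}. a = Dgen i"
    using prv_range by (auto simp: w_def cw_def eword_def gword_def split: if_splits)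
  ultimately have "run k m w (b, r) = Some (b, s b r)" if "b \<in> {1..k}" for b r
    using that by (subst run_Dgen) auto
  moreover have "w \<in> lists (gens k)" using D by (auto simp: gens_def)
  ultimately show ?thesis using that by blast
qed

section \<open>The action on points\<close>

text \<open>Blocks are numbered from 1, positions inside a block from 0.\<close>

definition enc :: "nat \<times> nat \<Rightarrow> nat" where "enc p = (fst p - 1) * m + snd p + 1"

definition dec :: "nat \<Rightarrow> nat \<times> nat" where "dec y = ((y - 1) div m + 1, (y - 1) mod m)"

definition pts :: "(nat \<times> nat) set" where "pts = {1..k} \<times> {..<m}"

lemma enc_range: "p \<in> pts \<Longrightarrow> enc p \<in> {1..k*m}"
proof -
  assume "p \<in> pts"
  then obtain b r where p: "p = (Suc b, r)" "b < k" "r < m"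
    unfolding pts_def by (cases p) (auto elim!: less_natE simp: Suc_le_eq intro: Suc_pred[symmetric])
  have "b * m + r < Suc b * m" using p by simp
  also have "\<dots> \<le> k * m" using p by (intro mult_le_mono1) simp
  finally show ?thesis using p by (simp add: enc_def)
qed

lemma dec_enc: "p \<in> pts \<Longrightarrow> dec (enc p) = p"
  using m2 by (cases p) (auto simp: pts_def dec_def enc_def)

lemma enc_dec: "y \<in> {1..k*m} \<Longrightarrow> enc (dec y) = y"
  by (simp add: dec_def enc_def)

lemma dec_range: "y \<in> {1..k*m} \<Longrightarrow> dec y \<in> pts"
  using block_index_eq[of y k m] m2 by (auto simp: dec_def pts_def)

lemma block_index_enc: "(b, r) \<in> pts \<Longrightarrow> block_index k m (enc (b, r)) = b"
  using block_index_eq(1)[OF enc_range] dec_enc by (force simp: dec_def)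

lemma block_eq: "b \<in> {1..k} \<Longrightarrow> block m b = (\<lambda>r. enc (b, r)) ` {..<m}"
proof (intro equalityI subsetI)
  fix y assume b: "b \<in> {1..k}" and y: "y \<in> block m b"
  have "y \<in> {1..k*m}"
  proof -
    have "y \<le> b * m" "1 \<le> y" using y by (auto simp: block_def)
    moreover have "b * m \<le> k * m" using b by (intro mult_le_mono1) simp
    ultimately show ?thesis unfolding atLeastAtMost_iff by (blast intro: le_trans)
  qed
  moreover have "fst (dec y) = b" using y by (simp add: block_iff dec_def)
  ultimately show "y \<in> (\<lambda>r. enc (b, r)) ` {..<m}"
    using enc_dec[of y] dec_range[of y] by (intro image_eqI[of _ _ "snd (dec y)"]) (auto simp: pts_def)
next
  fix y assume b: "b \<in> {1..k}" and "y \<in> (\<lambda>r. enc (b, r)) ` {..<m}"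
  then obtain r where "y = enc (b, r)" "r < m" by auto
  then show "y \<in> block m b"
    using block_index_eq(3)[OF enc_range] block_index_enc b by (force simp: pts_def)
qed

text \<open>Words in the d_i are defined on all pairs under \<open>run\<close>; cutting off at k*m
  puts the domain inside the set of points.\<close>

definition act :: "(nat \<times> nat \<rightharpoonup> nat \<times> nat) \<Rightarrow> nat \<rightharpoonup> nat" where
  "act p y = (if y \<in> {1..k*m} then map_option enc (p (dec y)) else None)"

lemma act_enc: "q \<in> pts \<Longrightarrow> act p (enc q) = map_option enc (p q)"
  using enc_range by (simp add: act_def dec_enc)

lemma act_outside: "y \<notin> {1..k*m} \<Longrightarrow> act p y = None"
  unfolding act_def by (rule if_not_P)

lemma point_cases:
  obtains "y \<notin> {1..k*m}" | b r where "b \<in> {1..k}" "r < m" "y = enc (b, r)"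
proof (cases "y \<in> {1..k*m}")
  case True
  have "fst (dec y) \<in> {1..k}" "snd (dec y) < m" "y = enc (fst (dec y), snd (dec y))"
    using enc_dec[OF True] dec_range[OF True] by (auto simp: pts_def)
  then show ?thesis by (rule that(2))
qed (use that(1) in blast)

lemma act_wreath_in_POI:
  assumes f: "order_inj k f" and s: "\<And>b. b \<in> {1..k} \<Longrightarrow> s b permutes {..<m}"
    and p: "\<And>b r. b \<in> {1..k} \<Longrightarrow> r < m \<Longrightarrow> p (b, r) = map_option (\<lambda>c. (c, s b r)) (f b)"
  shows "act p \<in> carrier (POI k m)"
proof -
  let ?\<alpha> = "act p"
  have sm: "s b r < m" if "b \<in> {1..k}" "r < m" for b r
    using permutes_in_image[OF s[OF that(1)], of r] that by simp
  have \<alpha>: "?\<alpha> (enc (b, r)) = map_option (\<lambda>c. enc (c, s b r)) (f b)" if "b \<in> {1..k}" "r < m" for b r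
    using act_enc[of "(b, r)" p] p[OF that] that by (simp add: pts_def option.map_comp comp_def)
  have dE: "\<exists>b r c. b \<in> {1..k} \<and> r < m \<and> y = enc (b, r) \<and> f b = Some c \<and> c \<in> {1..k} \<and> ?\<alpha> y = Some (enc (c, s b r))"
    if yd: "y \<in> dom ?\<alpha>" for y
  proof (cases y rule: point_cases)
    case 1
    then show ?thesis using yd act_outside[OF 1] by (simp add: domIff)
  next
    case (2 b r)
    then obtain c where "f b = Some c" using yd \<alpha>[of b r] by (cases "f b") auto
    then show ?thesis using 2 \<alpha>[of b r] order_injD(2)[OF f, of b c] by auto
  qed
  have bi: "block_index k m (enc (b, r)) = b" if "b \<in> {1..k}" "r < m" for b r
    using that by (intro block_index_enc) (simp add: pts_def)
  have "dom ?\<alpha> \<subseteq> {1..k*m}" using act_outside[of _ p] by (metis domIff subsetI)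
  moreover have "ran ?\<alpha> \<subseteq> {1..k*m}"
  proof
    fix z assume "z \<in> ran ?\<alpha>"
    then obtain y where y: "?\<alpha> y = Some z" by (auto simp: ran_def)
    then obtain b r c where "b \<in> {1..k}" "r < m" "c \<in> {1..k}" "z = enc (c, s b r)" using dE[of y] by auto
    then show "z \<in> {1..k*m}" using enc_range[of "(c, s b r)"] sm by (simp add: pts_def)
  qed
  moreover have "inj_on ?\<alpha> (dom ?\<alpha>)"
  proof (rule inj_onI)
    fix y z assume y: "y \<in> dom ?\<alpha>" and z: "z \<in> dom ?\<alpha>" and eq: "?\<alpha> y = ?\<alpha> z"
    obtain b r c where 1: "b \<in> {1..k}" "r < m" "y = enc (b, r)" "f b = Some c" "c \<in> {1..k}" "?\<alpha> y = Some (enc (c, s b r))"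
      using dE[OF y] by blast
    obtain b' r' c' where 2: "b' \<in> {1..k}" "r' < m" "z = enc (b', r')" "f b' = Some c'" "c' \<in> {1..k}" "?\<alpha> z = Some (enc (c', s b' r'))"
      using dE[OF z] by blast
    have "enc (c, s b r) = enc (c', s b' r')" using eq 1(6) 2(6) by simp
    moreover have "dec (enc (c, s b r)) = (c, s b r)"
      using 1 sm by (intro dec_enc) (simp add: pts_def)
    moreover have "dec (enc (c', s b' r')) = (c', s b' r')"
      using 2 sm by (intro dec_enc) (simp add: pts_def)
    ultimately have "(c, s b r) = (c', s b' r')" by metis
    then have cc: "c = c'" "s b r = s b' r'" by simp_all
    then have "b = b'" using order_injD(4)[OF f 1(4) 2(4)] by simp
    moreover have "r = r'"
      using cc(2) permutes_inj[OF s[OF 1(1)]] unfolding \<open>b = b'\<close>[symmetric] by (simp add: inj_eq)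
    ultimately show "y = z" using 1(3) 2(3) by simp
  qed
  moreover have "block_stable k m ?\<alpha>"
    unfolding block_stable_def
  proof
    fix y assume "y \<in> dom ?\<alpha>"
    then obtain b r c where 1: "b \<in> {1..k}" "r < m" "y = enc (b, r)" "f b = Some c" "c \<in> {1..k}" "?\<alpha> y = Some (enc (c, s b r))"
      using dE by blast
    have b: "block_index k m y = b" "block_index k m (the (?\<alpha> y)) = c"
      using 1 bi[of b r] bi[of c "s b r"] sm by auto
    have A: "?\<alpha> (enc (b, r)) = Some (enc (c, s b r))" if "r < m" for r using \<alpha>[OF 1(1) that] 1(4) by simp
    have "(\<lambda>y. the (?\<alpha> y)) ` block m b = (\<lambda>r. enc (c, r)) ` s b ` {..<m}"
      unfolding block_eq[OF 1(1)] image_image using A by (intro image_cong) auto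
    also have "\<dots> = block m c" unfolding permutes_image[OF s[OF 1(1)]] block_eq[OF 1(5)] ..
    finally show "block m (block_index k m y) \<subseteq> dom ?\<alpha> \<and>
        (\<lambda>y. the (?\<alpha> y)) ` block m (block_index k m y) = block m (block_index k m (the (?\<alpha> y)))"
      using A block_eq[OF 1(1)] unfolding b by auto
  qed
  moreover have "block_order_preserving k m ?\<alpha>"
    unfolding block_order_preserving_def
  proof (intro ballI impI)
    fix y z assume y: "y \<in> dom ?\<alpha>" and z: "z \<in> dom ?\<alpha>" and le: "block_index k m y \<le> block_index k m z"
    obtain b r c where 1: "b \<in> {1..k}" "r < m" "y = enc (b, r)" "f b = Some c" "c \<in> {1..k}" "?\<alpha> y = Some (enc (c, s b r))"
      using dE[OF y] by blast
    obtain b' r' c' where 2: "b' \<in> {1..k}" "r' < m" "z = enc (b', r')" "f b' = Some c'" "c' \<in> {1..k}" "?\<alpha> z = Some (enc (c', s b' r'))"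
      using dE[OF z] by blast
    have "b \<le> b'" using le 1 2 bi by simp
    then have "c \<le> c'" using order_injD(3)[OF f 2(4) 1(4)] by (simp add: not_less[symmetric])
    then show "block_index k m (the (?\<alpha> y)) \<le> block_index k m (the (?\<alpha> z))"
      using 1 2 bi sm by simp
  qed
  ultimately show ?thesis by (simp add: POI_def)
qed

text \<open>Stability makes the domain a union of blocks, each mapped onto a block. Order
  preservation is only weak on blocks; injectivity makes f strict, because two blocks with the same
  target would both fill it.\<close>

lemma POI_wreath:
  assumes \<alpha>: "\<alpha> \<in> carrier (POI k m)"
  obtains f s where "order_inj k f" "\<And>b. b \<in> {1..k} \<Longrightarrow> s b permutes {..<m}"
    "\<And>b r. b \<in> {1..k} \<Longrightarrow> r < m \<Longrightarrow> \<alpha> (enc (b, r)) = map_option (\<lambda>c. enc (c, s b r)) (f b)"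
proof -
  have sub: "dom \<alpha> \<subseteq> {1..k*m}" "ran \<alpha> \<subseteq> {1..k*m}" and inj: "inj_on \<alpha> (dom \<alpha>)"
    and ord: "block_order_preserving k m \<alpha>" using \<alpha> by (auto simp: POI_def)
  have bi: "block_index k m (enc (b, r)) = b" if "b \<in> {1..k}" "r < m" for b r
    using that by (intro block_index_enc) (simp add: pts_def)
  define f where "f b = (if b \<in> {1..k} then map_option (\<lambda>y. block_index k m y) (\<alpha> (enc (b, 0))) else None)" for b
  \<comment> \<open>Off the domain of f the identity is taken, so that a permutation results for
    every b.\<close>
  define s where "s b r = (if f b \<noteq> None \<and> r < m then snd (dec (the (\<alpha> (enc (b, r))))) else r)" for b r
  have key: "c \<in> {1..k} \<and> (\<lambda>r. the (\<alpha> (enc (b, r)))) ` {..<m} = block m c \<and>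
      (\<forall>r<m. \<alpha> (enc (b, r)) = Some (enc (c, s b r)) \<and> s b r < m)" if fb: "f b = Some c" for b c
  proof -
    have b: "b \<in> {1..k}" using fb by (auto simp: f_def split: if_splits)
    then obtain y where y: "\<alpha> (enc (b, 0)) = Some y" "c = block_index k m y" using fb by (auto simp: f_def)
    have m0: "0 < m" using m2 by simp
    have d: "enc (b, 0) \<in> dom \<alpha>" using y by blast
    have img: "block m b \<subseteq> dom \<alpha>" "(\<lambda>y. the (\<alpha> y)) ` block m b = block m c"
      using block_image[OF \<alpha> d] y unfolding bi[OF b m0] by auto
    have "y \<in> {1..k*m}" using sub(2) y(1) by (auto simp: ran_def)
    then have c: "c \<in> {1..k}" using block_index_eq(2) y(2) by blast
    have I: "(\<lambda>r. the (\<alpha> (enc (b, r)))) ` {..<m} = block m c"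
      using img(2) unfolding block_eq[OF b] image_image .
    have "\<alpha> (enc (b, r)) = Some (enc (c, s b r)) \<and> s b r < m" if r: "r < m" for r
    proof -
      have "enc (b, r) \<in> dom \<alpha>" using img(1) r unfolding block_eq[OF b] by blast
      then obtain z where z: "\<alpha> (enc (b, r)) = Some z" by blast
      then have "z \<in> block m c" using I r by (metis imageI lessThan_iff option.sel)
      then obtain r' where r': "z = enc (c, r')" "r' < m" unfolding block_eq[OF c] by auto
      then have "s b r = r'" using z fb r dec_enc[of "(c, r')"] c by (simp add: s_def pts_def)
      then show ?thesis using z r' by simp
    qed
    then show ?thesis using c I by blast
  qed
  have s: "s b permutes {..<m}" for b
  proof (cases "f b")
    case None
    then have "s b = id" by (auto simp: s_def fun_eq_iff)
    then show ?thesis by (simp add: permutes_id)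
  next
    case (Some c)
    note K = key[OF Some]
    have "s b ` {..<m} = {..<m}"
    proof
      show "s b ` {..<m} \<subseteq> {..<m}" using K by auto
      show "{..<m} \<subseteq> s b ` {..<m}"
      proof
        fix t assume t: "t \<in> {..<m}"
        then have "enc (c, t) \<in> (\<lambda>r. the (\<alpha> (enc (b, r)))) ` {..<m}" using K block_eq[of c] by auto
        then obtain r where r: "r < m" "enc (c, t) = enc (c, s b r)" using K by auto
        then have "t = s b r"
          using dec_enc[of "(c, t)"] dec_enc[of "(c, s b r)"] K t by (simp add: pts_def)
        then show "t \<in> s b ` {..<m}" using r(1) by blast
      qed
    qed
    then have "bij_betw (s b) {..<m} {..<m}" by (simp add: bij_betw_def eq_card_imp_inj_on)
    then show ?thesis by (rule bij_imp_permutes) (simp add: s_def)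
  qed
  have "order_inj k f"
    unfolding order_inj_def
  proof (intro conjI allI impI)
    show "dom f \<subseteq> {1..k}" by (auto simp: f_def split: if_splits)
    show "ran f \<subseteq> {1..k}" using key by (auto simp: ran_def)
    fix b b' c c' assume fb: "f b = Some c" and fb': "f b' = Some c'" and less: "b < b'"
    have b: "b \<in> {1..k}" "b' \<in> {1..k}" using fb fb' by (auto simp: f_def split: if_splits)
    have m0: "0 < m" using m2 by simp
    have v: "\<alpha> (enc (b, 0)) = Some (enc (c, s b 0))" "\<alpha> (enc (b', 0)) = Some (enc (c', s b' 0))"
      "s b 0 < m" "s b' 0 < m" "c \<in> {1..k}" "c' \<in> {1..k}"
      using key[OF fb] key[OF fb'] m0 by auto
    have "block_index k m (enc (b, 0)) \<le> block_index k m (enc (b', 0))" using bi b m0 less by simp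
    then have "block_index k m (the (\<alpha> (enc (b, 0)))) \<le> block_index k m (the (\<alpha> (enc (b', 0))))"
      using ord v unfolding block_order_preserving_def by blast
    then have "c \<le> c'" using v bi by simp
    moreover have "c \<noteq> c'"
    proof
      assume "c = c'"
      then have "enc (c', s b' 0) \<in> (\<lambda>r. the (\<alpha> (enc (b, r)))) ` {..<m}"
        using key[OF fb] v block_eq[of c'] by auto
      then obtain r where r: "r < m" "\<alpha> (enc (b, r)) = \<alpha> (enc (b', 0))" using key[OF fb] v by auto
      then have "enc (b, r) = enc (b', 0)" using inj_onD[OF inj r(2)] v key[OF fb] by (simp add: domIff)
      then have "b = b'" using bi[OF b(1) r(1)] bi[OF b(2) m0] by simp
      then show False using less by simp
    qed
    ultimately show "c < c'" by simp
  qed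
  moreover have "\<alpha> (enc (b, r)) = map_option (\<lambda>c. enc (c, s b r)) (f b)" if b: "b \<in> {1..k}" and r: "r < m" for b r
  proof (cases "f b")
    case None
    have "\<alpha> (enc (b, r)) = None"
    proof (rule ccontr)
      assume "\<alpha> (enc (b, r)) \<noteq> None"
      then have "enc (b, r) \<in> dom \<alpha>" by blast
      from block_image(1)[OF \<alpha> this] have "block m b \<subseteq> dom \<alpha>" unfolding bi[OF b r] .
      moreover have "enc (b, 0) \<in> block m b"
        unfolding block_eq[OF b] using m2 by (intro image_eqI[of _ _ 0]) auto
      ultimately have "enc (b, 0) \<in> dom \<alpha>" by blast
      then show False using None b by (auto simp: f_def)
    qed
    then show ?thesis using None by simp
  next
    case (Some c)
    then show ?thesis using key[OF Some] r by simp
  qed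
  ultimately show ?thesis using that s by blast
qed

text \<open>\<open>act\<close> forgets everything outside \<open>pts\<close>, so the first map must
  not lead out of it.\<close>

lemma act_comp:
  assumes "\<And>q q'. q \<in> pts \<Longrightarrow> p q = Some q' \<Longrightarrow> q' \<in> pts"
  shows "act (p' \<circ>\<^sub>m p) = act p' \<circ>\<^sub>m act p"
proof (rule ext)
  fix y
  show "act (p' \<circ>\<^sub>m p) y = (act p' \<circ>\<^sub>m act p) y"
  proof (cases y rule: point_cases)
    case 1
    then show ?thesis by (simp add: act_outside map_comp_def)
  next
    case (2 b r)
    then have q: "(b, r) \<in> pts" by (simp add: pts_def)
    show ?thesis
    proof (cases "p (b, r)")
      case None
      then show ?thesis using act_enc[OF q] 2 by (simp add: map_comp_def)
    next
      case (Some q')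
      then show ?thesis using act_enc[OF q] act_enc[OF assms[OF q Some]] 2 by (simp add: map_comp_def)
    qed
  qed
qed

lemma run_range: "w \<in> lists (gens k) \<Longrightarrow> q \<in> pts \<Longrightarrow> run k m w q = Some q' \<Longrightarrow> q' \<in> pts"
proof (induction w arbitrary: q)
  case (Cons a w)
  obtain q1 where q1: "gstep k m a q = Some q1" "run k m w q1 = Some q'"
    using Cons.prems(3) by (auto simp: map_comp_Some_iff)
  obtain b r where q: "q = (b, r)" "b \<in> {1..k}" "r < m" using Cons.prems(2) by (auto simp: pts_def)
  have "q1 \<in> pts"
  proof (cases a)
    case (Dgen i)
    have "word_val (dval k m b) [a] = word_val (perm_val m)
        (if b = i then [False] else if b = nxt k i then [True, False] else [])"
      using Dgen by (auto simp: dval_def perm_val_def)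
    then have "app (dval k m b a) permutes {..<m}" using perm_val_permutes[OF m2] by (metis word_val_simps(1,2) mult_1_right)
    then have "app (dval k m b a) r < m" using q(3) permutes_in_image by (metis lessThan_iff)
    then show ?thesis using q1(1) q Dgen by (auto simp: gstep_def pts_def)
  next
    case (Xgen i)
    then have i: "i < k" using Cons.prems(1) k2 by (simp add: Xgen_in_gens)
    then show ?thesis using q1(1) q Xgen xmv_range[OF i, of b]
      by (auto simp: gstep_def pts_def xstep_eq[OF i k2] split: if_splits)
  qed
  then show ?case using Cons.IH q1(2) Cons.prems(1) by simp
qed simp

definition \<phi> :: "gen list \<Rightarrow> nat \<rightharpoonup> nat" where "\<phi> w = act (run k m w)"

lemma \<phi>_eqD:
  assumes "\<phi> w = \<phi> w'" "w \<in> lists (gens k)" "w' \<in> lists (gens k)" "q \<in> pts"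
  shows "run k m w q = run k m w' q"
proof -
  have E: "map_option enc (run k m w q) = map_option enc (run k m w' q)"
    using act_enc[OF assms(4)] assms(1) by (metis \<phi>_def)
  show ?thesis
  proof (cases "run k m w q")
    case None
    then have "map_option enc (run k m w' q) = None" using E by simp
    then show ?thesis using None by simp
  next
    case (Some a)
    then have "map_option enc (run k m w' q) = Some (enc a)" using E by simp
    then obtain a' where a': "run k m w' q = Some a'" "enc a' = enc a" by auto
    have "dec (enc a) = a" "dec (enc a') = a'"
      using dec_enc run_range assms(2-4) Some a'(1) by blast+
    then show ?thesis using Some a' by simp
  qed
qed

lemma \<phi>_in_POI:
  assumes w: "w \<in> lists (gens k)"
  shows "\<phi> w \<in> carrier (POI k m)"
proof -
  \<comment> \<open>In the trivial model the relations hold automatically, and of the normal form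
    only its statement about \<open>run\<close> remains.\<close>
  interpret T: rels_model k m "\<lambda>_. 1 :: nat endo"
    by unfold_locales (simp add: word_val_trivial)
  obtain U "is" where N: "set is \<subseteq> {..<k}" "\<And>b r. b \<in> {1..k} \<Longrightarrow> run k m w (b, r) =
      map_option (\<lambda>c. (c, app (word_val (perm_val m) (U b)) r)) (bmap k is b)"
    using T.normal_form[OF w] by blast
  have "order_inj k (bmap k is |` {1..k})"
    unfolding order_inj_def
  proof (intro conjI allI impI)
    have R: "(bmap k is |` {1..k}) b = Some c \<longleftrightarrow> b \<in> {1..k} \<and> bmap k is b = Some c" for b c
      by (auto simp: restrict_map_def)
    show "dom (bmap k is |` {1..k}) \<subseteq> {1..k}" using R by blast
    show "ran (bmap k is |` {1..k}) \<subseteq> {1..k}"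
      using R bmap_range[OF N(1)] unfolding ran_def by blast
    show "c < c'" if "(bmap k is |` {1..k}) b = Some c" "(bmap k is |` {1..k}) b' = Some c'" "b < b'" for b b' c c'
      using that bmap_mono[OF N(1)] unfolding R by blast
  qed
  then show ?thesis
    unfolding \<phi>_def
  proof (rule act_wreath_in_POI[where s = "\<lambda>b. app (word_val (perm_val m) (U b))"])
    show "app (word_val (perm_val m) (U b)) permutes {..<m}" for b by (rule perm_val_permutes[OF m2])
    show "run k m w (b, r) = map_option (\<lambda>c. (c, app (word_val (perm_val m) (U b)) r)) ((bmap k is |` {1..k}) b)"
      if "b \<in> {1..k}" for b r
      using N(2)[OF that] restrict_in[OF that] by metis
  qed
qed

lemma \<phi>_onto:
  assumes "\<alpha> \<in> carrier (POI k m)"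
  shows "\<exists>w\<in>lists (gens k). \<phi> w = \<alpha>"
proof -
  obtain f s where fs: "order_inj k f" "\<And>b. b \<in> {1..k} \<Longrightarrow> s b permutes {..<m}"
    "\<And>b r. b \<in> {1..k} \<Longrightarrow> r < m \<Longrightarrow> \<alpha> (enc (b, r)) = map_option (\<lambda>c. enc (c, s b r)) (f b)"
    using POI_wreath[OF assms] by blast
  obtain w where w: "w \<in> lists (gens k)" "\<And>b r. b \<in> {1..k} \<Longrightarrow> run k m w (b, r) = Some (b, s b r)"
    using dword_exists[of s] fs(2) by blast
  obtain "is" where is': "set is \<subseteq> {..<k}" "bmap k is |` {1..k} = f"
    using realized_order_inj[OF fs(1)] by (auto simp: realized_def)
  let ?w = "w @ map Xgen is"
  have "\<phi> ?w y = \<alpha> y" for y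
  proof (cases y rule: point_cases)
    case 1
    have "dom \<alpha> \<subseteq> {1..k*m}" using assms by (simp add: POI_def)
    then have "\<alpha> y = None" using 1 by blast
    then show ?thesis using act_outside[OF 1] by (simp add: \<phi>_def)
  next
    case (2 b r)
    have "bmap k is b = f b" using is'(2) 2(1) by (metis restrict_in)
    then have "run k m ?w (b, r) = map_option (\<lambda>c. (c, s b r)) (f b)"
      using w(2)[OF 2(1)] by (simp add: run_append run_Xgen)
    then show ?thesis
      using fs(3)[OF 2(1,2)] act_enc[of "(b, r)"] 2 by (simp add: \<phi>_def pts_def option.map_comp comp_def)
  qed
  moreover have "?w \<in> lists (gens k)" using w(1) is'(1) k2 by (auto simp: Xgen_in_gens subset_iff)
  ultimately show ?thesis by blast
qed

theorem POI_presentation: "POI k m \<cong> presented_monoid (gens k) (rels k m)"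
proof (rule presented_monoid_iso[where h = \<phi>])
  show "Group.monoid (POI k m)" by (rule monoid_POI)
  show "rels k m \<subseteq> lists (gens k) \<times> lists (gens k)"
    using rels_subset[OF k2] by (simp add: free_monoid_def)
  show "\<phi> (u @ v) = \<phi> u \<otimes>\<^bsub>POI k m\<^esub> \<phi> v" if "u \<in> lists (gens k)" for u v
    using act_comp[OF run_range[OF that]] by (simp add: \<phi>_def run_append POI_def)
  show "\<phi> [] = \<one>\<^bsub>POI k m\<^esub>"
    using enc_dec by (auto simp: \<phi>_def act_def POI_def restrict_map_def)
  show "\<phi> ` lists (gens k) = carrier (POI k m)"
    using \<phi>_in_POI \<phi>_onto by blast
  show "\<phi> u = \<phi> v" if "(u, v) \<in> rels k m" for u v
    using run_rels[OF that] by (simp add: \<phi>_def)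
  fix \<nu> :: "gen \<Rightarrow> gen list set endo" and u v
  assume R: "\<And>a b. (a, b) \<in> rels k m \<Longrightarrow> word_val \<nu> a = word_val \<nu> b"
    and uv: "u \<in> lists (gens k)" "v \<in> lists (gens k)" "\<phi> u = \<phi> v"
  interpret rels_model k m \<nu> by unfold_locales (rule R)
  show "word_val \<nu> u = word_val \<nu> v"
    using uv \<phi>_eqD[OF uv(3,1,2)] by (intro complete) (auto simp: pts_def)
qed

end

section \<open>The number of relations\<close>

lemma finite_pairs: "finite {(i, j). 1 \<le> i \<and> i < j \<and> j \<le> (n::nat)}"
  by (rule finite_subset[of _ "{..n} \<times> {..n}"]) auto

lemma card_pairs: "2 * card {(i, j). 1 \<le> i \<and> i < j \<and> j \<le> n} = n * (n - 1 :: nat)"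
proof (induction n)
  case 0
  have "{(i, j). 1 \<le> i \<and> i < j \<and> j \<le> (0::nat)} = {}" by auto
  then show ?case by (simp only: card.empty)
next
  case (Suc n)
  let ?A = "{(i, j). 1 \<le> i \<and> i < j \<and> j \<le> n}" and ?B = "(\<lambda>i. (i, Suc n)) ` {1..n}"
  have "{(i, j). 1 \<le> i \<and> i < j \<and> j \<le> Suc n} = ?A \<union> ?B" by (auto simp: le_Suc_eq)
  moreover have "card (?A \<union> ?B) = card ?A + card ?B"
    using finite_pairs by (intro card_Un_disjoint) auto
  moreover have "card ?B = n" by (subst card_image) (auto simp: inj_on_def)
  ultimately have "card {(i, j). 1 \<le> i \<and> i < j \<and> j \<le> Suc n} = card ?A + n" by (simp only:)
  then show ?case using Suc by (cases n) auto
qed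

text \<open>All cardinalities below are read off the first letter, the last letter and the length of the
  left-hand sides.\<close>

definition wkey :: "'a list \<Rightarrow> 'a \<times> 'a \<times> nat" where "wkey u = (hd u, last u, length u)"

lemma wkey_simps: "u \<noteq> [] \<Longrightarrow> v \<noteq> [] \<Longrightarrow> wkey (u @ v) = (hd u, last v, length u + length v)"
  by (simp add: wkey_def)

lemma word_power_props:
  assumes "n > 0" "w \<noteq> []"
  shows "w ^^^ n \<noteq> []" "hd (w ^^^ n) = hd w" "last (w ^^^ n) = last w" "length (w ^^^ n) = n * length w"
proof -
  have *: "w ^^^ Suc n \<noteq> [] \<and> hd (w ^^^ Suc n) = hd w \<and> last (w ^^^ Suc n) = last w \<and>
      length (w ^^^ Suc n) = Suc n * length w" for n
    by (induction n) (use assms(2) in \<open>auto simp: word_power_def\<close>)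
  obtain n' where "n = Suc n'" using assms(1) gr0_implies_Suc by blast
  then show "w ^^^ n \<noteq> []" "hd (w ^^^ n) = hd w" "last (w ^^^ n) = last w" "length (w ^^^ n) = n * length w"
    using * by auto
qed

lemma hd_last_dp: "n > 0 \<Longrightarrow> hd (dp i n) = Dgen i" "n > 0 \<Longrightarrow> last (dp i n) = Dgen i"
  "n > 0 \<Longrightarrow> dp i n \<noteq> []"
  by (cases n; simp)+

lemma eword_props:
  assumes "m \<ge> 2"
  shows "eword k m j \<noteq> []" "hd (eword k m j) = Dgen (prv k j)" "last (eword k m j) = Dgen j"
    "length (eword k m j) = 2 * m - 1"
  using assms hd_last_dp[of m "prv k j"] hd_last_dp[of "m-1" j] by (auto simp: eword_def)

lemma gword_props:
  assumes "m \<ge> 2"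
  shows "gword m j \<noteq> []" "hd (gword m j) = Dgen j" "last (gword m j) = Dgen j"
    "length (gword m j) = (m-1)^2"
  using assms hd_last_dp[of "(m-1)^2" j] by (auto simp: gword_def)

lemma inj_on_key: "(\<And>a b. a \<in> A \<Longrightarrow> b \<in> A \<Longrightarrow> wkey (fst (F a)) = wkey (fst (F b)) \<Longrightarrow> a = b) \<Longrightarrow> inj_on F A"
  by (metis inj_onI)

lemma replicate_prefix_eq:
  assumes "replicate a y @ z # u = replicate b y @ z # v" "y \<noteq> z"
  shows "a = b"
proof -
  have "takeWhile ((=) y) (replicate a y @ z # u) = replicate a y" for a u
    using assms(2) by (induction a) auto
  then show ?thesis using assms(1) by (metis length_replicate)
qed

section \<open>The size of V\<close>

context
  fixes k m :: nat
  assumes k2: "k \<ge> 2" and m2: "m \<ge> 2"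
begin

lemma prv_eq_iff: "i \<in> {1..k} \<Longrightarrow> j \<in> {1..k} \<Longrightarrow> prv k i = prv k j \<longleftrightarrow> i = j"
  using prv_inj[of k] by (auto dest: inj_onD)

lemma q_pos: "(m-1)^2 > 0"
  using m2 by simp

lemma m_pos: "m > 0" "m - 1 > 0"
  using m2 by auto

lemma V1_key: "wkey (eword k m j ^^^ 2) = (Dgen (prv k j), Dgen j, 2 * (2 * m - 1))"
  using word_power_props[of 2 "eword k m j"] eword_props[OF m2] by (simp add: wkey_def)

lemma V2_key: "wkey (dp j (m*(m-1))) = (Dgen j, Dgen j, m*(m-1))"
  using hd_last_dp[of "m*(m-1)" j] m2 by (simp add: wkey_def)

lemma V3_key: "wkey ((gword m j @ eword k m j) ^^^ (m-1)) = (Dgen j, Dgen j, (m-1) * ((m-1)^2 + (2*m-1)))"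
  using word_power_props[of "m-1" "gword m j @ eword k m j"] m2 eword_props[OF m2] gword_props[OF m2]
  by (simp add: wkey_def)

lemma V4_key: "wkey ((dp j m @ dp l ((m-1)^2*(m-2)) @ dp j m) ^^^ 3) =
    (Dgen j, Dgen j, 3 * (2*m + (m-1)^2*(m-2)))"
  using word_power_props[of 3 "dp j m @ dp l ((m-1)^2*(m-2)) @ dp j m"] hd_last_dp[of m j] m2
  by (simp add: wkey_def)

lemma V5_key:
  assumes "t \<in> {2..m-2}"
  shows "wkey (V5lhs m t i j) = (Dgen i, Dgen j, 2 * (2*m + (m-1)^2*(m-2)))"
proof -
  have t: "(m-1)^2*(t-1) > 0" and s: "m - t - 1 + (t - 1) = m - 2" using assms m2 by auto
  let ?w = "dp i m @ dp j ((m-1)^2*(m-t-1)) @ dp i m @ dp j ((m-1)^2*(t-1))"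
  have "length ?w = 2*m + (m-1)^2*(m - t - 1 + (t - 1))" by (simp add: distrib_left)
  then have "length ?w = 2*m + (m-1)^2*(m-2)" unfolding s .
  moreover have "hd ?w = Dgen i" "last ?w = Dgen j" "?w \<noteq> []"
    using hd_last_dp[of m i] hd_last_dp[OF t, of j] m2 by auto
  ultimately show ?thesis
    unfolding V5lhs_def wkey_def using word_power_props[of 2 ?w] by simp
qed

text \<open>The key does not see t. The length of the first run of d_j does, and the letter d_i
  after it marks its end.\<close>

lemma V5_inj:
  assumes "t \<in> {2..m-2}" "t' \<in> {2..m-2}" "V5lhs m t i j = V5lhs m t' i j" "i \<noteq> j"
  shows "t = t'"
proof -
  obtain n where n: "m = Suc n" using m2 by (cases m) auto
  define R where "R t = dp i n @ dp j ((m-1)^2*(t-1)) @ dp i m @ dp j ((m-1)^2*(m-t-1)) @ dp i m @ dp j ((m-1)^2*(t-1))" for t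
  have E: "V5lhs m t i j = dp i m @ (dp j ((m-1)^2*(m-t-1)) @ Dgen i # R t)" for t
  proof -
    have "dp i m = Dgen i # dp i n" by (simp add: n)
    then show ?thesis by (simp add: V5lhs_def R_def word_power_def numeral_2_eq_2)
  qed
  have "dp j ((m-1)^2*(m-t-1)) @ Dgen i # R t = dp j ((m-1)^2*(m-t'-1)) @ Dgen i # R t'"
    using assms(3) unfolding E by (simp only: same_append_eq)
  then have "(m-1)^2*(m-t-1) = (m-1)^2*(m-t'-1)"
    using replicate_prefix_eq[of _ "Dgen j" "Dgen i"] assms(4) by blast
  then have "m - t - 1 = m - t' - 1" using q_pos by simp
  then show ?thesis using assms(1,2) by auto
qed

text \<open>These separate the families of V and the two halves of V'. With m = n + 2 the equations
  excluded at the end would mean n^2 + n = 1 and n^2 = 2.\<close>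

lemma lengths:
  "m*(m-1) < (m-1) * ((m-1)^2 + (2*m-1))"
  "(m-1) * ((m-1)^2 + (2*m-1)) < 3 * (2*m + (m-1)^2*(m-2))"
  "2 * (2*m-1) < 2 * (2*m + (m-1)^2*(m-2))"
  "m \<noteq> (m-1)^2" "2*m - 1 \<noteq> (m-1)^2"
proof -
  obtain n where m: "m = n + 2" using m2 le_Suc_ex by (metis add.commute)
  show "m*(m-1) < (m-1) * ((m-1)^2 + (2*m-1))"
    "(m-1) * ((m-1)^2 + (2*m-1)) < 3 * (2*m + (m-1)^2*(m-2))"
    "2 * (2*m-1) < 2 * (2*m + (m-1)^2*(m-2))"
    by (simp_all add: m power2_eq_square algebra_simps)
  show "m \<noteq> (m-1)^2"
    by (cases "n = 0"; cases "n = 1") (auto simp: m power2_eq_square algebra_simps)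
  show "2*m - 1 \<noteq> (m-1)^2"
  proof -
    have "n * n \<noteq> 2"
    proof (cases "n \<le> 1")
      case True
      then show ?thesis by (cases n) auto
    next
      case False
      then have "2 * 2 \<le> n * n" by (intro mult_le_mono) auto
      then show ?thesis by simp
    qed
    then show ?thesis by (auto simp: m power2_eq_square algebra_simps)
  qed
qed

text \<open>The left-hand sides in V1 and V5 begin and end with different letters, those in V2, V3
  and V4 with the same one; within either group the lengths differ.\<close>

lemma card_relV_1_5: "card (relV1 k m \<union> relV2 k m \<union> relV3 k m \<union> relV4 k m \<union> relV5 k m) = 4 * k + k * (m - 3)"
proof -
  have neq: "prv k j \<noteq> j" "j \<noteq> prv k j" if "j \<in> {1..k}" for j using prv_neq[OF k2 that] by auto
  define same where "same p \<longleftrightarrow> hd (fst p) = last (fst p)" for p :: "gen list \<times> gen list"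
  define L1 L2 L3 L4 L5 where L_defs: "L1 = 2 * (2*m-1)" "L2 = m*(m-1)" "L3 = (m-1) * ((m-1)^2 + (2*m-1))"
    "L4 = 3 * (2*m + (m-1)^2*(m-2))" "L5 = 2 * (2*m + (m-1)^2*(m-2))"
  have L: "L2 \<noteq> L3" "L2 \<noteq> L4" "L3 \<noteq> L4" "L1 \<noteq> L5" using lengths(1-3) unfolding L_defs by linarith+
  have key: "wkey (fst p) = (x, y, l) \<Longrightarrow> (same p \<longleftrightarrow> x = y) \<and> length (fst p) = l" for p x y l
    by (auto simp: wkey_def same_def)
  have K1: "\<not> same p \<and> length (fst p) = L1" if p: "p \<in> relV1 k m" for p
  proof -
    obtain j where "j \<in> {1..k}" "p = (eword k m j ^^^ 2, [])" using p unfolding relV1_eq[OF k2] by blast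
    then show ?thesis using key[of p "Dgen (prv k j)" "Dgen j" L1] V1_key[of j] neq(1)[of j] by (simp add: L_defs)
  qed
  have K2: "same p \<and> length (fst p) = L2" if p: "p \<in> relV2 k m" for p
  proof -
    obtain j where "p = (dp j (m*(m-1)), [])" using p unfolding relV2_eq by blast
    then show ?thesis using key[of p "Dgen j" "Dgen j" L2] V2_key[of j] by (simp add: L_defs)
  qed
  have K3: "same p \<and> length (fst p) = L3" if p: "p \<in> relV3 k m" for p
  proof -
    obtain j where "p = ((gword m j @ eword k m j) ^^^ (m-1), [])" using p unfolding relV3_eq[OF k2] by blast
    then show ?thesis using key[of p "Dgen j" "Dgen j" L3] V3_key[of j] by (simp add: L_defs)
  qed
  have K4: "same p \<and> length (fst p) = L4" if p: "p \<in> relV4 k m" for p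
  proof -
    obtain j where "p = ((dp (prv k j) m @ dp j ((m-1)^2*(m-2)) @ dp (prv k j) m) ^^^ 3, [])"
      using p unfolding relV4_eq[OF k2] by blast
    then show ?thesis using key[of p "Dgen (prv k j)" "Dgen (prv k j)" L4] V4_key[of "prv k j" j] by (simp add: L_defs)
  qed
  have K5: "\<not> same p \<and> length (fst p) = L5" if p: "p \<in> relV5 k m" for p
  proof -
    obtain j t where "j \<in> {1..k}" "t \<in> {2..m-2}" "p = (V5lhs m t (prv k j) j, [])"
      using p unfolding relV5_eq[OF k2] by auto
    then show ?thesis using key[of p "Dgen (prv k j)" "Dgen j" L5] V5_key[of t "prv k j" j] neq(1)[of j] by (simp add: L_defs)
  qed
  have c1: "card (relV1 k m) = k" unfolding relV1_eq[OF k2]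
    by (subst card_image; (intro inj_on_key)?) (auto simp del: One_nat_def simp: V1_key)
  have c2: "card (relV2 k m) = k" unfolding relV2_eq
    by (subst card_image; (intro inj_on_key)?) (auto simp del: One_nat_def simp: V2_key)
  have c3: "card (relV3 k m) = k" unfolding relV3_eq[OF k2]
    by (subst card_image; (intro inj_on_key)?) (auto simp del: One_nat_def simp: V3_key)
  have c4: "card (relV4 k m) = k" unfolding relV4_eq[OF k2]
    by (subst card_image; (intro inj_on_key)?) (auto simp del: One_nat_def simp: V4_key prv_eq_iff)
  have c5: "card (relV5 k m) = k * (m - 3)" unfolding relV5_eq[OF k2]
  proof (subst card_image)
    show "inj_on (\<lambda>(j, t). (V5lhs m t (prv k j) j, [])) ({1..k} \<times> {2..m-2})"
    proof (rule inj_onI)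
      fix a b assume a: "a \<in> {1..k} \<times> {2..m-2}" and b: "b \<in> {1..k} \<times> {2..m-2}"
        and eq: "(case a of (j, t) \<Rightarrow> (V5lhs m t (prv k j) j, [])) = (case b of (j, t) \<Rightarrow> (V5lhs m t (prv k j) j, []))"
      obtain j t j' t' where ab: "a = (j, t)" "b = (j', t')" by fastforce
      have e: "V5lhs m t (prv k j) j = V5lhs m t' (prv k j') j'" using eq by (simp add: ab)
      have "wkey (V5lhs m t (prv k j) j) = wkey (V5lhs m t' (prv k j') j')" using e by simp
      then have "j = j'" using a b by (simp add: ab V5_key del: One_nat_def)
      then show "a = b" using V5_inj[of t t' "prv k j" j] e a b prv_neq[OF k2, of j] by (simp add: ab)
    qed
    \<comment> \<open>For m = 2 the range of t is empty, and the truncated difference is 0 as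
      well.\<close>
    show "card ({1..k} \<times> {2..m-2}) = k * (m-3)" by simp
  qed
  have fin: "finite (relV1 k m)" "finite (relV2 k m)" "finite (relV3 k m)" "finite (relV4 k m)" "finite (relV5 k m)"
    unfolding relV1_eq[OF k2] relV2_eq relV3_eq[OF k2] relV4_eq[OF k2] relV5_eq[OF k2] by auto
  have "relV1 k m \<inter> relV2 k m = {}"
    using K1 K2 by blast
  moreover have "p \<notin> relV3 k m" if "p \<in> relV1 k m \<union> relV2 k m" for p
    using that K1[of p] K2[of p] K3[of p] L by auto
  then have "(relV1 k m \<union> relV2 k m) \<inter> relV3 k m = {}" by blast
  moreover have "p \<notin> relV4 k m" if "p \<in> relV1 k m \<union> relV2 k m \<union> relV3 k m" for p
    using that K1[of p] K2[of p] K3[of p] K4[of p] L by auto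
  then have "(relV1 k m \<union> relV2 k m \<union> relV3 k m) \<inter> relV4 k m = {}" by blast
  moreover have "p \<notin> relV5 k m" if "p \<in> relV1 k m \<union> relV2 k m \<union> relV3 k m \<union> relV4 k m" for p
    using that K1[of p] K2[of p] K3[of p] K4[of p] K5[of p] L by auto
  then have "(relV1 k m \<union> relV2 k m \<union> relV3 k m \<union> relV4 k m) \<inter> relV5 k m = {}" by blast
  ultimately show ?thesis using c1 c2 c3 c4 c5 fin by (simp add: card_Un_disjoint)
qed

lemma card_relV6: "card (relV6 k m) = k * (k - 1) + k * (k - 2)"
proof -
  let ?P = "{(i, j). 1 \<le> i \<and> i < j \<and> j \<le> k}"
  let ?Q = "{(i, j). i \<in> {1..k} \<and> j \<in> {1..k} \<and> i \<noteq> j \<and> i \<noteq> prv k j}"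
  define A where "A = (\<lambda>(i, j). (dp i m @ dp j m, dp j m @ dp i m)) ` ?P"
  define B where "B = (\<lambda>(i, j). (gword m i @ gword m j, gword m j @ gword m i)) ` ?P"
  define C where "C = (\<lambda>(i, j). (gword m i @ dp (prv k j) m, dp (prv k j) m @ gword m i)) ` ?Q"
  have V6: "relV6 k m = A \<union> B \<union> C" unfolding relV6_eq[OF k2] A_def B_def C_def ..
  have kA: "wkey (dp i m @ dp j m) = (Dgen i, Dgen j, m + m)" for i j
    using hd_last_dp[of m] m_pos by (simp add: wkey_simps)
  have kB: "wkey (gword m i @ gword m j) = (Dgen i, Dgen j, (m-1)^2 + (m-1)^2)" for i j
    using gword_props[OF m2] by (simp add: wkey_simps)
  have kC: "wkey (gword m i @ dp j m) = (Dgen i, Dgen j, (m-1)^2 + m)" for i j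
    using gword_props[OF m2] hd_last_dp[of m] m_pos by (simp add: wkey_simps)
  have finQ: "finite ?Q" by (rule finite_subset[of _ "{1..k} \<times> {1..k}"]) auto
  have fin: "finite A" "finite B" "finite C" using finite_pairs finQ by (auto simp: A_def B_def C_def)
  have cA: "card A = card ?P" unfolding A_def
    by (intro card_image inj_on_key) (auto simp: kA)
  have cB: "card B = card ?P" unfolding B_def
    by (intro card_image inj_on_key) (auto simp del: One_nat_def simp: kB)
  have cC: "card C = card ?Q" unfolding C_def
    by (intro card_image inj_on_key) (auto simp del: One_nat_def simp: kC prv_eq_iff)
  have cQ: "card ?Q = k * (k - 2)"
  proof -
    \<comment> \<open>For given j exactly j and its cyclic predecessor are excluded, and these
      differ as k >= 2.\<close>
    have "?Q = prod.swap ` (SIGMA j:{1..k}. {1..k} - {j, prv k j})" by (auto simp: image_iff)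
    then have "card ?Q = card (SIGMA j:{1..k}. {1..k} - {j, prv k j})"
      by (simp only: card_image[OF inj_on_subset[OF inj_swap subset_UNIV]])
    also have "\<dots> = (\<Sum>j\<in>{1..k}. card ({1..k} - {j, prv k j}))" by simp
    also have "\<dots> = (\<Sum>j\<in>{1..k}. k - 2)"
    proof (rule sum.cong)
      fix j assume j: "j \<in> {1..k}"
      then have "{j, prv k j} \<subseteq> {1..k}" using prv_range[OF j] by auto
      moreover have "card {j, prv k j} = 2" using prv_neq[OF k2 j] by auto
      ultimately show "card ({1..k} - {j, prv k j}) = k - 2" by (simp add: card_Diff_subset)
    qed simp
    finally show ?thesis by simp
  qed
  have lA: "length (fst p) = m + m" if "p \<in> A" for p using that by (auto simp: A_def)
  have lB: "length (fst p) = (m-1)^2 + (m-1)^2" if "p \<in> B" for p using that by (auto simp: B_def gword_def)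
  have lC: "length (fst p) = (m-1)^2 + m" if "p \<in> C" for p using that by (auto simp: C_def gword_def)
  have "p \<notin> B" if "p \<in> A" for p using that lA[of p] lB[of p] lengths(4) by auto
  then have "A \<inter> B = {}" by blast
  moreover have "p \<notin> C" if "p \<in> A \<union> B" for p using that lA[of p] lB[of p] lC[of p] lengths(4) by auto
  then have "(A \<union> B) \<inter> C = {}" by blast
  ultimately have "card (relV6 k m) = card ?P + card ?P + card ?Q"
    unfolding V6 using fin cA cB cC by (simp add: card_Un_disjoint)
  then show ?thesis using card_pairs[of k] cQ by simp
qed

lemma card_relV: "finite (relV k m)" "card (relV k m) = 4 * k + k * (m - 3) + k * (k - 1) + k * (k - 2)"
proof -
  let ?A = "relV1 k m \<union> relV2 k m \<union> relV3 k m \<union> relV4 k m \<union> relV5 k m"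
  have finA: "finite ?A"
    unfolding relV1_eq[OF k2] relV2_eq relV3_eq[OF k2] relV4_eq[OF k2] relV5_eq[OF k2] by auto
  have "finite {(i, j). i \<in> {1..k} \<and> j \<in> {1..k} \<and> i \<noteq> j \<and> i \<noteq> prv k j}"
    by (rule finite_subset[of _ "{1..k} \<times> {1..k}"]) auto
  then have fin6: "finite (relV6 k m)"
    unfolding relV6_eq[OF k2] using finite_pairs by simp
  have "snd p = []" if "p \<in> ?A" for p
    using that unfolding relV1_eq[OF k2] relV2_eq relV3_eq[OF k2] relV4_eq[OF k2] relV5_eq[OF k2] by auto
  moreover have "snd p \<noteq> []" if "p \<in> relV6 k m" for p
    using that m2 unfolding relV6_def by auto
  ultimately have "?A \<inter> relV6 k m = {}" by blast
  then have "card (?A \<union> relV6 k m) = card ?A + card (relV6 k m)" by (rule card_Un_disjoint[OF finA fin6])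
  then show "card (relV k m) = 4 * k + k * (m - 3) + k * (k - 1) + k * (k - 2)"
    unfolding relV_def card_relV_1_5 card_relV6 by simp
  show "finite (relV k m)" unfolding relV_def using finA fin6 by simp
qed

section \<open>The size of V'\<close>

text \<open>In the relations that move a block the right-hand side is longer than one letter; the
  other two kinds differ in the first letter of the left-hand side. The relations for e and those
  for g differ in length, as 2m-1 is never (m-1)^2.\<close>

lemma card_relV': "finite (relV' k m)" "card (relV' k m) = 2 * (k * (k + 1))"
proof -
  have act: "finite (actrel k y) \<and> card (actrel k y) = k * (k + 1) \<and> (\<forall>p\<in>actrel k y. length (fst p) = Suc n)"
    if y: "\<And>j. y j \<noteq> []" "\<And>j. last (y j) = Dgen j" "\<And>j. \<exists>i. hd (y j) = Dgen i" "\<And>j. length (y j) = n"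
    for y :: "nat \<Rightarrow> gen list" and n
  proof -
    let ?P = "{(i, j). i < k \<and> j \<in> {1..k} \<and> j \<noteq> xlo k i}"
    define A where "A = (\<lambda>(i, j). (xg i @ y (xmv k i j), y j @ xg i)) ` ?P"
    define B where "B = (\<lambda>i. (xg i @ y (k - i), xg i)) ` {..<k}"
    define C where "C = (\<lambda>i. (y (xlo k i) @ xg i, xg i)) ` {..<k}"
    have kl: "wkey (xg i @ y j) = (Xgen i, Dgen j, Suc n)" for i j
      using wkey_simps[of "xg i" "y j"] y by simp
    have kr: "last (y j @ xg i) = Xgen i" for i j by simp
    have P: "?P = (SIGMA i:{..<k}. {1..k} - {xlo k i})" by auto
    have "card ?P = (\<Sum>i\<in>{..<k}. card ({1..k} - {xlo k i}))" unfolding P by simp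
    also have "\<dots> = (\<Sum>i\<in>{..<k}. k - 1)" using xlo_range[of _ k] by (intro sum.cong) auto
    finally have cP: "card ?P = k * (k - 1)" by simp
    have finP: "finite ?P" unfolding P by simp
    have fin: "finite A" "finite B" "finite C" using finP by (auto simp: A_def B_def C_def)
    have cA: "card A = k * (k - 1)" unfolding A_def cP[symmetric]
    proof (intro card_image inj_on_key)
      fix a b assume "a \<in> ?P" "b \<in> ?P"
        and eq: "wkey (fst (case a of (i, j) \<Rightarrow> (xg i @ y (xmv k i j), y j @ xg i)))
          = wkey (fst (case b of (i, j) \<Rightarrow> (xg i @ y (xmv k i j), y j @ xg i)))"
      then obtain i j i' j' where ab: "a = (i, j)" "b = (i', j')" "i < k" "j \<in> {1..k}" "j \<noteq> xlo k i"
        "j' \<in> {1..k}" "j' \<noteq> xlo k i'" by blast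
      have "i = i'" "xmv k i j = xmv k i' j'" using eq unfolding ab(1,2) prod.case fst_conv kl by auto
      then show "a = b" using xmv_inj[of i k j j'] ab by auto
    qed
    have cB: "card B = k" unfolding B_def
    proof (subst card_image)
      show "inj_on (\<lambda>i. (xg i @ y (k - i), xg i)) {..<k}" by (auto simp: inj_on_def)
    qed simp
    have cC: "card C = k" unfolding C_def
    proof (subst card_image)
      show "inj_on (\<lambda>i. (y (xlo k i) @ xg i, xg i)) {..<k}" by (auto simp: inj_on_def)
    qed simp
    have pA: "length (snd p) \<noteq> 1" if "p \<in> A" for p using that y(1) by (auto simp: A_def)
    have pB: "length (snd p) = 1 \<and> (\<exists>i. hd (fst p) = Xgen i)" if "p \<in> B" for p
      using that by (auto simp: B_def)
    have pC: "length (snd p) = 1 \<and> (\<nexists>i. hd (fst p) = Xgen i)" if p: "p \<in> C" for p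
    proof -
      obtain i where i: "p = (y (xlo k i) @ xg i, xg i)" using p by (auto simp: C_def)
      obtain l where "hd (y (xlo k i)) = Dgen l" using y(3) by blast
      then show ?thesis using y(1) by (simp add: i)
    qed
    have "A \<inter> B = {}" using pA pB by blast
    moreover have "(A \<union> B) \<inter> C = {}" using pA pB pC by blast
    moreover have "actrel k y = A \<union> B \<union> C" by (simp add: actrel_def A_def B_def C_def)
    ultimately have "card (actrel k y) = k * (k - 1) + k + k" "finite (actrel k y)"
      using fin cA cB cC by (simp_all add: card_Un_disjoint)
    moreover have "k * (k - 1) + k + k = k * (k + 1)" using k2 by (cases k) auto
    moreover have "\<forall>p\<in>actrel k y. length (fst p) = Suc n" by (auto simp: actrel_def y(4))
    ultimately show ?thesis by simp
  qed
  have E: "finite (actrel k (eword k m)) \<and> card (actrel k (eword k m)) = k * (k + 1) \<and>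
      (\<forall>p\<in>actrel k (eword k m). length (fst p) = Suc (2*m-1))"
    using eword_props[OF m2] by (intro act) auto
  have G: "finite (actrel k (gword m)) \<and> card (actrel k (gword m)) = k * (k + 1) \<and>
      (\<forall>p\<in>actrel k (gword m). length (fst p) = Suc ((m-1)^2))"
    using gword_props[OF m2] by (intro act) auto
  have "p \<notin> actrel k (gword m)" if p: "p \<in> actrel k (eword k m)" for p
  proof
    assume "p \<in> actrel k (gword m)"
    then have "Suc (2*m-1) = Suc ((m-1)^2)" using E G p by metis
    then show False using lengths(5) by simp
  qed
  then have "actrel k (eword k m) \<inter> actrel k (gword m) = {}" by blast
  then show "card (relV' k m) = 2 * (k * (k + 1))"
    unfolding relV'_eq[OF k2] using E G by (simp add: card_Un_disjoint)
  show "finite (relV' k m)" unfolding relV'_eq[OF k2] using E G by simp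
qed

section \<open>The size of W\<close>

definition wrel :: "(nat list \<times> nat list) set" where
  "wrel =
     (\<lambda>i. ([i, 0], [0, i+1])) ` {1..k-2} \<union>
     (\<lambda>(i, j). ([j+1, i], [i, j+1])) ` {(i, j). 1 \<le> i \<and> i < j \<and> j \<le> k-2} \<union>
     {([0, 0, 1], [0, 0]), ([0, 0], [k-1, 0, 0])} \<union>
     (\<lambda>i. ([i+1, i, i+1], [i+1, i])) ` {1..k-2} \<union>
     (\<lambda>i. ([i+1, i], [i, i+1, i])) ` {1..k-2} \<union>
     (\<lambda>i. ([i..<k] @ [0..<i] @ [i], [i])) ` {..k-1} \<union>
     (\<lambda>i. ([i+1..<k] @ [0..<i] @ [i, i], [i, i])) ` {1..k-1}"

lemma relW_eq: "relW k = map_prod (map Xgen) (map Xgen) ` wrel"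
proof -
  have 2: "{(xg j @ xg i, xg i @ xg j) | i j. 2 \<le> i+1 \<and> i+1 < j \<and> j \<le> k-1} =
      (\<lambda>(i, j). (xg (j+1) @ xg i, xg i @ xg (j+1))) ` {(i, j). 1 \<le> i \<and> i < j \<and> j \<le> k-2}" (is "?L = ?R")
  proof (intro equalityI subsetI)
    fix p assume "p \<in> ?L"
    then obtain i j where p: "p = (xg j @ xg i, xg i @ xg j)" "2 \<le> i+1" "i+1 < j" "j \<le> k-1" by blast
    then have "(i, j - 1) \<in> {(i, j). 1 \<le> i \<and> i < j \<and> j \<le> k-2}" "j - 1 + 1 = j" by auto
    then show "p \<in> ?R" using p(1) by (intro image_eqI[of _ _ "(i, j - 1)"]) auto
  next
    fix p assume "p \<in> ?R"
    then obtain i j where p: "p = (xg (j+1) @ xg i, xg i @ xg (j+1))" "1 \<le> i" "i < j" "j \<le> k-2" by auto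
    then have "2 \<le> i+1" "i+1 < j+1" "j+1 \<le> k-1" using k2 by auto
    then show "p \<in> ?L" using p(1) by blast
  qed
  have 1: "{F i | i. 1 \<le> i \<and> i \<le> n} = F ` {1..n}" "{F i | i. i \<le> n} = F ` {..n}"
    for F :: "nat \<Rightarrow> gen list \<times> gen list" and n by auto
  show ?thesis
    unfolding relW_def 1 2 wrel_def image_Un image_image by (simp add: case_prod_beta)
qed

text \<open>On the left-hand sides in \<open>W\<close> the length and the outer letters only leave
  \<open>x\<^sub>0 x\<^sub>0 x\<^sub>1\<close> and \<open>x\<^sub>0 x\<^sub>1 x\<^sub>1\<close> (for \<open>k = 2\<close>) undistinguished; the right-hand sides separate these two.\<close>

lemma card_relW: "finite (relW k)" "real (card (relW k)) = 5 * (real k - 1) + real (k-2) * (real k - 3) / 2"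
proof -
  let ?K = "\<lambda>p. (length (fst p), hd (fst p), last (fst p), hd (snd p))"
  let ?S = "{1..k-2}" and ?P = "{(i, j). 1 \<le> i \<and> i < j \<and> j \<le> k-2}"
  \<comment> \<open>The first letter of the left-hand side in the last family: for i = k-1 the run
    from i+1 is empty and the word begins with x_0.\<close>
  define h where "h i = (if i + 1 < k then i + 1 else 0)" for i
  have k1: "?K ([i..<k] @ [0..<i] @ [i], [i]) = (k + 1, i, i, i)" if "i \<le> k - 1" for i
    using that k2 by (auto simp: upt_conv_Cons)
  have k2': "?K ([i+1..<k] @ [0..<i] @ [i, i], [i, i]) = (k + 1, h i, i, i)" if "1 \<le> i" "i \<le> k - 1" for i
    using that k2 by (auto simp: upt_conv_Cons h_def)
  define A1 where "A1 = (\<lambda>i::nat. (2::nat, i, 0::nat, 0::nat)) ` ?S"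
  define A2 where "A2 = (\<lambda>(i, j). (2::nat, j+1, i::nat, i)) ` ?P"
  define A3 where "A3 = {(3::nat, 0::nat, 1::nat, 0::nat), (2, 0, 0, k-1)}"
  define A4 where "A4 = (\<lambda>i::nat. (3::nat, i+1, i+1, i+1)) ` ?S"
  define A5 where "A5 = (\<lambda>i::nat. (2::nat, i+1, i, i)) ` ?S"
  define A6 where "A6 = (\<lambda>i::nat. (k+1, i, i, i)) ` {..k-1}"
  define A7 where "A7 = (\<lambda>i. (k+1, h i, i, i)) ` {1..k-1}"
  have finP: "finite ?P" by (rule finite_pairs)
  have c: "card A1 = k - 2" "card A2 = card ?P" "card A3 = 2" "card A4 = k - 2" "card A5 = k - 2"
    "card A6 = k" "card A7 = k - 1"
    using k2 unfolding A1_def A2_def A3_def A4_def A5_def A6_def A7_def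
    by (auto simp: card_image inj_on_def)
  have fin: "finite A1" "finite A2" "finite A3" "finite A4" "finite A5" "finite A6" "finite A7"
    using finP unfolding A1_def A2_def A3_def A4_def A5_def A6_def A7_def by auto
  have "A1 \<inter> A2 = {}" by (auto simp: A1_def A2_def)
  moreover have "(A1 \<union> A2) \<inter> A3 = {}" using k2 by (auto simp: A1_def A2_def A3_def)
  moreover have "(A1 \<union> A2 \<union> A3) \<inter> A4 = {}" by (auto simp: A1_def A2_def A3_def A4_def)
  moreover have "(A1 \<union> A2 \<union> A3 \<union> A4) \<inter> A5 = {}" by (auto simp: A1_def A2_def A3_def A4_def A5_def)
  moreover have "(A1 \<union> A2 \<union> A3 \<union> A4 \<union> A5) \<inter> A6 = {}"
    using k2 by (auto simp: A1_def A2_def A3_def A4_def A5_def A6_def)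
  moreover have "(A1 \<union> A2 \<union> A3 \<union> A4 \<union> A5 \<union> A6) \<inter> A7 = {}"
    using k2 by (auto simp: A1_def A2_def A3_def A4_def A5_def A6_def A7_def h_def split: if_splits)
  ultimately have cA: "card (A1 \<union> A2 \<union> A3 \<union> A4 \<union> A5 \<union> A6 \<union> A7) = 3 * (k - 2) + card ?P + 2 + k + (k - 1)"
    using fin c by (simp add: card_Un_disjoint)
  have KW: "?K ` wrel = A1 \<union> A2 \<union> A3 \<union> A4 \<union> A5 \<union> A6 \<union> A7"
  proof -
    have "?K ` (\<lambda>i. ([i..<k] @ [0..<i] @ [i], [i])) ` {..k-1} = A6"
      unfolding image_image A6_def using k1 by (intro image_cong) auto
    moreover have "?K ` (\<lambda>i. ([i+1..<k] @ [0..<i] @ [i, i], [i, i])) ` {1..k-1} = A7"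
      unfolding image_image A7_def using k2' by (intro image_cong) auto
    ultimately show ?thesis
      unfolding wrel_def image_Un A1_def A2_def A3_def A4_def A5_def
      by (simp add: image_image case_prod_beta numeral_2_eq_2 numeral_3_eq_3)
  qed
  have finW: "finite wrel" unfolding wrel_def using finP by simp
  \<comment> \<open>The distinct keys bound the cardinality from below, the number of parameters of
    each family bounds it from above, and the bounds agree.\<close>
  have "card (?K ` wrel) \<le> card wrel" by (rule card_image_le[OF finW])
  moreover have "card wrel \<le> 3 * (k - 2) + card ?P + 2 + k + (k - 1)"
  proof -
    have s: "card (F ` {1..k-2}) \<le> k - 2" for F :: "nat \<Rightarrow> nat list \<times> nat list"
      using card_image_le[of "{1..k-2}" F] by simp
    have p: "card (F ` ?P) \<le> card ?P" for F :: "nat \<times> nat \<Rightarrow> nat list \<times> nat list"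
      using card_image_le[OF finP, of F] by simp
    have l: "card (F ` {..k-1}) \<le> k" for F :: "nat \<Rightarrow> nat list \<times> nat list"
      using card_image_le[of "{..k-1}" F] k2 by simp
    have r: "card (F ` {1..k-1}) \<le> k - 1" for F :: "nat \<Rightarrow> nat list \<times> nat list"
      using card_image_le[of "{1..k-1}" F] by simp
    have two: "card {a, b} \<le> 2" for a b :: "nat list \<times> nat list" by (simp add: card_insert_if)
    have U: "card (X \<union> Y) \<le> x + y" if "card X \<le> x" "card Y \<le> y" for X Y :: "(nat list \<times> nat list) set" and x y
      using card_Un_le[of X Y] that by linarith
    have "card wrel \<le> (k-2) + card ?P + 2 + (k-2) + (k-2) + k + (k-1)"
      unfolding wrel_def by (intro U s p l r two)
    then show ?thesis by simp
  qed
  ultimately have "card wrel = 3 * (k - 2) + card ?P + 2 + k + (k - 1)" unfolding KW cA by simp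
  moreover have "inj_on (map_prod (map Xgen) (map Xgen)) wrel"
    by (intro inj_on_subset[OF prod.inj_map[OF _ _]]) (auto simp: inj_def)
  then have "card (relW k) = card wrel" unfolding relW_eq by (rule card_image)
  ultimately have W: "card (relW k) = 3 * (k - 2) + card ?P + 2 + k + (k - 1)" by simp
  have "2 * real (card ?P) = real (2 * card ?P)" by simp
  also have "\<dots> = real ((k-2) * (k-2-1))" unfolding card_pairs ..
  also have "\<dots> = real (k-2) * (real k - 3)"
  proof (cases "k = 2")
    case False
    then have "real (k-2-1) = real k - 3" using k2 by linarith
    then show ?thesis by simp
  qed simp
  finally have P: "real (card ?P) = real (k-2) * (real k - 3) / 2" by simp
  have "real (k - 2) = real k - 2" "real (k - 1) = real k - 1" using k2 by linarith+
  then show "real (card (relW k)) = 5 * (real k - 1) + real (k-2) * (real k - 3) / 2"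
    unfolding W of_nat_add of_nat_mult P by simp
  show "finite (relW k)" unfolding relW_eq using finW by simp
qed

text \<open>The left-hand sides tell V, W and V' apart: they contain only letters d, only letters x,
  or both.\<close>

lemma card_rels:
  "real (card (rels k m)) = 1/2 * (9 * real k ^ 2 + (2 * real m + 5) * real k - 4) + (if m = 2 then real k else 0)"
proof -
  have X: "\<exists>a\<in>set (fst p). \<exists>i. a = Xgen i" if p: "p \<in> relV' k m" for p
    using p unfolding relV'_eq[OF k2] actrel_def by auto
  have D: "\<exists>a\<in>set (fst p). \<exists>i. a = Dgen i" if p: "p \<in> relV' k m" for p
  proof -
    have *: "\<exists>a\<in>set w. \<exists>i. a = Dgen i" if "w \<noteq> []" "last w = Dgen i" for w i
      using that by (metis last_in_set)
    have "\<exists>a\<in>set (eword k m j). \<exists>i. a = Dgen i" "\<exists>a\<in>set (gword m j). \<exists>i. a = Dgen i" for j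
      using *[OF eword_props(1,3)[OF m2]] *[OF gword_props(1,3)[OF m2]] by blast+
    then show ?thesis using p unfolding relV'_eq[OF k2] actrel_def by fastforce
  qed
  have VD: "\<forall>a\<in>set (fst p). \<exists>i. a = Dgen i" if p: "p \<in> relV k m" for p
  proof -
    obtain u v where uv: "p = (u, v)" by fastforce
    then have "(u, v) \<in> relV k m" using p by simp
    then show ?thesis unfolding uv
      by (cases rule: relV_cases[OF k2]) (auto simp: eword_def gword_def V5lhs_def set_word_power split: if_splits)
  qed
  have WX: "\<forall>a\<in>set (fst p). \<exists>i. a = Xgen i" "fst p \<noteq> []" if p: "p \<in> relW k" for p
    using p unfolding relW_eq wrel_def by auto
  have "p \<notin> relW k" if "p \<in> relV k m" for p
    using VD[OF that] WX[of p] by (cases "fst p") auto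
  then have "relV k m \<inter> relW k = {}" by blast
  moreover have "p \<notin> relV' k m" if "p \<in> relV k m \<union> relW k" for p
    using that VD[of p] WX(1)[of p] X[of p] D[of p] by auto
  then have "(relV k m \<union> relW k) \<inter> relV' k m = {}" by blast
  ultimately have "card (rels k m) = card (relV k m) + card (relW k) + card (relV' k m)"
    unfolding rels_def using card_relV(1) card_relW(1) card_relV'(1) by (simp add: card_Un_disjoint)
  then have "real (card (rels k m)) = real (card (relV k m)) + real (card (relW k)) + real (card (relV' k m))"
    by simp
  also have "real (card (relV k m)) = 4 * real k + real k * real (m - 3) + real k * (real k - 1) + real k * (real k - 2)"
    using k2 by (simp add: card_relV(2) of_nat_diff)
  also have "real (card (relV' k m)) = 2 * (real k * (real k + 1))" by (simp add: card_relV'(2) algebra_simps)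
  finally have "real (card (rels k m)) = 4 * real k + real k * real (m - 3) + real k * (real k - 1) + real k * (real k - 2)
      + (5 * (real k - 1) + (real k - 2) * (real k - 3) / 2) + 2 * (real k * (real k + 1))"
    using k2 by (simp add: card_relW(2) of_nat_diff)
  \<comment> \<open>The truncated difference at m = 2 is 0 and not -1, which produces the additional
    k.\<close>
  moreover have "real (m - 3) = (if m = 2 then 0 else real m - 3)" using m2 by (auto simp: of_nat_diff)
  ultimately show ?thesis by (simp add: field_simps power2_eq_square)
qed

lemma card_gens: "card (gens k) = 2 * k"
proof -
  have "Dgen ` {1..k} \<inter> Xgen ` {0..k-1} = {}" by auto
  then show ?thesis unfolding gens_def using k2 by (simp add: card_Un_disjoint card_image inj_on_def)
qed

end

theorem theorem3p12:
  fixes k m :: nat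
  assumes "k \<ge> 2" and "m \<ge> 2"
  shows "POI k m \<cong> presented_monoid (gens k) (rels k m)
    \<and> card (gens k) = 2 * k
    \<and> (m \<ge> 3 \<longrightarrow>
        real (card (rels k m)) = 1/2 * (9 * real k ^ 2 + (2 * real m + 5) * real k - 4))
    \<and> (m = 2 \<longrightarrow>
        real (card (rels k m)) = 1/2 * (9 * real k ^ 2 + (2 * real m + 5) * real k - 4) + real k)"
proof (intro conjI impI)
  interpret sizes k m using assms by unfold_locales
  show "POI k m \<cong> presented_monoid (gens k) (rels k m)" by (rule POI_presentation)
  show "card (gens k) = 2 * k" by (rule card_gens[OF assms])
  show "real (card (rels k m)) = 1/2 * (9 * real k ^ 2 + (2 * real m + 5) * real k - 4)" if "m \<ge> 3"
    using card_rels[OF assms] that by simp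
  show "real (card (rels k m)) = 1/2 * (9 * real k ^ 2 + (2 * real m + 5) * real k - 4) + real k" if "m = 2"
    using card_rels[OF assms] that by simp
qed

end
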